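(* Let $\widetilde{\mathrm{Sp}}_4(\mathbb{R})$ be the universal cover of $\mathrm{Sp}_4(\mathbb{R})$, with exponential map $\exp:\mathfrak{sp}_4(\mathbb{R})\to\widetilde{\mathrm{Sp}}_4(\mathbb{R})$. Every continuous isometric action of $\widetilde{\mathrm{Sp}}_4(\mathbb{R})$ on a uniformly convex Banach space has a point fixed by the one-parameter subgroup $\exp(\mathbb{R}\,\mathfrak{X}_{2\beta})$, where $\mathfrak{X}_{2\beta}\in\mathfrak{sp}_4(\mathbb{R})$ is the $4\times 4$ matrix whose $(2,4)$-entry is $1$ and all other entries are $0$.
   Context: $\mathrm{Sp}_4(\mathbb{R})=\{g\in\mathrm{GL}_4(\mathbb{R}): g^TJg=J\}$ with $J=\begin{pmatrix}0&I_2\\-I_2&0\end{pmatrix}$, and $\mathfrak{sp}_4(\mathbb{R})=\{M: M^TJ+JM=0\}$. A Banach space is uniformly convex if for every $\varepsilon\in(0,2]$ there is $\delta>0$ such that unit vectors $\xi,\eta$ with $\|\xi-\eta\|\ge\varepsilon$ satisfy $\|(\xi+\eta)/2\|\le1-\delta$. *)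

theory Defs
  imports "HOL-Analysis.Analysis"
begin

text \<open>1-based index of an element of the 4-element index type (values 1..4).\<close>
definition ent :: "4 \<Rightarrow> nat" where
  "ent a = nat (Rep_bit0 a) + 1"

text \<open>The matrix J = [[0, I2], [-I2, 0]].\<close>
definition Jmat :: "real^4^4" where
  "Jmat = (\<chi> a b. if ent b = ent a + 2 then 1 else if ent a = ent b + 2 then -1 else 0)"

definition Sp4 :: "(real^4^4) set" where
  "Sp4 = {g. transpose g ** Jmat ** g = Jmat}"

definition sp4 :: "(real^4^4) set" where
  "sp4 = {M. transpose M ** Jmat + Jmat ** M = 0}"

definition X2beta :: "real^4^4" where
  "X2beta = (\<chi> a b. if ent a = 2 \<and> ent b = 4 then 1 else 0)"

fun matpow :: "real^'n^'n \<Rightarrow> nat \<Rightarrow> real^'n^'n" where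
  "matpow A 0 = mat 1"
| "matpow A (Suc k) = A ** matpow A k"

definition mat_exp :: "real^'n^'n \<Rightarrow> real^'n^'n" where
  "mat_exp A = (\<chi> i j. (\<Sum>k. (matpow A k) $ i $ j / fact k))"

text \<open>A topological group structure on the whole type 'g (Hausdorff not needed here).\<close>
definition topological_group ::
  "('g::topological_space \<Rightarrow> 'g \<Rightarrow> 'g) \<Rightarrow> 'g \<Rightarrow> ('g \<Rightarrow> 'g) \<Rightarrow> bool" where
  "topological_group gmul e iv \<longleftrightarrow>
     (\<forall>x y z. gmul (gmul x y) z = gmul x (gmul y z)) \<and>
     (\<forall>x. gmul e x = x \<and> gmul x e = x) \<and>
     (\<forall>x. gmul (iv x) x = e \<and> gmul x (iv x) = e) \<and>
     continuous_on UNIV (\<lambda>z. gmul (fst z) (snd z)) \<and>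
     continuous_on UNIV iv"

definition universal_cover_Sp4 ::
  "('g::topological_space \<Rightarrow> 'g \<Rightarrow> 'g) \<Rightarrow> 'g \<Rightarrow> ('g \<Rightarrow> 'g) \<Rightarrow> ('g \<Rightarrow> real^4^4) \<Rightarrow> bool" where
  "universal_cover_Sp4 gmul e iv p \<longleftrightarrow>
     topological_group gmul e iv \<and>
     path_connected (UNIV :: 'g set) \<and> simply_connected (UNIV :: 'g set) \<and>
     covering_space UNIV p Sp4 \<and>
     (\<forall>x y. p (gmul x y) = p x ** p y)"

text \<open>The exponential of X in the universal cover, as a one-parameter subgroup:
  the continuous homomorphism R -> G lifting t |-> exp(tX).\<close>
definition lifted_one_param ::
  "('g::topological_space \<Rightarrow> 'g \<Rightarrow> 'g) \<Rightarrow> ('g \<Rightarrow> real^4^4) \<Rightarrow> real^4^4 \<Rightarrow> (real \<Rightarrow> 'g) \<Rightarrow> bool" where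
  "lifted_one_param gmul p X \<phi> \<longleftrightarrow>
     continuous_on UNIV \<phi> \<and>
     (\<forall>s t. \<phi> (s + t) = gmul (\<phi> s) (\<phi> t)) \<and>
     (\<forall>t. p (\<phi> t) = mat_exp (t *\<^sub>R X))"

definition uniformly_convex :: "'b::real_normed_vector itself \<Rightarrow> bool" where
  "uniformly_convex _ \<longleftrightarrow>
     (\<forall>\<epsilon>. 0 < \<epsilon> \<and> \<epsilon> \<le> 2 \<longrightarrow>
        (\<exists>\<delta>>0. \<forall>\<xi> \<eta> :: 'b. norm \<xi> = 1 \<and> norm \<eta> = 1 \<and> norm (\<xi> - \<eta>) \<ge> \<epsilon> \<longrightarrow>
                 norm ((\<xi> + \<eta>) /\<^sub>R 2) \<le> 1 - \<delta>))"

definition continuous_isometric_action ::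
  "('g::topological_space \<Rightarrow> 'g \<Rightarrow> 'g) \<Rightarrow> 'g \<Rightarrow> ('g \<Rightarrow> 'b::metric_space \<Rightarrow> 'b) \<Rightarrow> bool" where
  "continuous_isometric_action gmul e act \<longleftrightarrow>
     (\<forall>x. act e x = x) \<and>
     (\<forall>g h x. act (gmul g h) x = act g (act h x)) \<and>
     (\<forall>g x y. dist (act g x) (act g y) = dist x y) \<and>
     continuous_on UNIV (\<lambda>z. act (fst z) (snd z))"

end

theory Submission
  imports Defs
begin

text \<open>
  Isometries of a uniformly convex space are affine, so averages of a point along one-parameter subgroups
  make sense. Let \<open>D\<close> be the largest displacement of \<open>\<eta>\<close> under elements of parameter at most 1 of the eight
  root subgroups. It suffices to find, uniformly in \<open>\<eta>\<close>, a point at distance \<open>O(D)\<close> with displacement at most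
  \<open>D / 2\<close>; iteration then converges to a point fixed by all root subgroups.

  The new point is an iterated average of \<open>\<eta>\<close> along long pieces of the tori and root subgroups. Unipotents are
  exponentially distorted, so averaging over length \<open>2 ^ (C * n\<^sup>2)\<close> moves \<open>\<eta>\<close> only by \<open>O(n\<^sup>2 * D)\<close>. With small radii
  along the roots \<open>-2\<alpha>\<close>, \<open>-\<alpha>-\<beta>\<close>, \<open>-2\<beta>\<close> the average is almost invariant under the opposite roots \<open>2\<alpha>\<close> and \<open>\<beta>-\<alpha>\<close>, with
  large radii under the negative ones. The two averages are close: in a Heisenberg subgroup \<open>[x, y] = z\<close>, averaging
  along \<open>x\<close> at \<open>n\<close> successive scales shrinks the displacement by \<open>z\<close> exponentially in \<open>n\<close>, as otherwise uniform
  convexity makes the vector almost invariant under \<open>x\<close> and \<open>y\<close>, hence under \<open>z\<close>. So a radius can be doubled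
  at exponentially small cost, and \<open>O(n\<^sup>2)\<close> doublings lead from the small radii to the large ones.
\<close>

section \<open>Uniform convexity\<close>

text \<open>The obstacle is that invariance under a root and under its opposite ask for
  contradictory radii: \<open>U 0\<close> passes an average along \<open>U 4\<close> by a fractional
  linear reparametrization, harmless only for a tiny radius, whereas invariance under
  \<open>U 4\<close> itself wants a huge one. Hence two averages and the need for cheap doublings.
  On the positive side 2\<alpha> and \<beta>-\<alpha> suffice, as their commutators give the other
  two roots. The root -\<alpha>-\<beta> does not commute with \<alpha>-\<beta>: the commutator lies
  in -2\<beta>. Its radius can be raised only once that of -2\<beta> is large, so the radii grow in
  rounds that keep a fixed ratio between them. All other losses are polynomial. With
  \<open>n\<close> scales per doubling the displacements in play are O(n^2 D), there are O(n^2)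
  doublings, and each costs c^n times the displacement with some c < 1. The total is O(n^4 c^n D),
  and one fixed \<open>n\<close>, depending only on the convexity of the space, brings it below
  D/2.\<close>

definition clustering :: "'b::real_normed_vector itself \<Rightarrow> real \<Rightarrow> bool" where
  "clustering _ \<delta> \<longleftrightarrow> 0 < \<delta> \<and> \<delta> < 1 \<and> (\<forall>(J::nat) (v::nat \<Rightarrow> 'b) (r::real).
     (\<forall>j<J. norm (v j) = r) \<longrightarrow> norm (\<Sum>j<J. v j) > (1 - \<delta>) * r * J \<longrightarrow>
     (\<Sum>j<J. \<Sum>k<J. norm (v j - v k)) \<le> (1/4) * r * J\<^sup>2)"

text \<open>Uniform convexity for many vectors at once: an average that loses little norm has terms
  that are close to each other in the mean. The constant 1/4 is chosen because
  \<open>pure_contraction\<close> doubles it and needs the result below 1.\<close>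

lemma uniformly_convex_clustering:
  assumes uc: "uniformly_convex TYPE('b::real_normed_vector)"
  shows "\<exists>\<delta>. clustering TYPE('b) \<delta>"
proof -
  define \<epsilon> e :: real where "\<epsilon> = 1/4" and "e = 1/8"
  have eps: "0 < \<epsilon>" and e: "0 < e" "e \<le> 2" "e = \<epsilon>/2" by (auto simp: \<epsilon>_def e_def)
  then obtain d where d: "d > 0" and dd: "\<And>\<xi> \<eta> :: 'b. norm \<xi> = 1 \<Longrightarrow> norm \<eta> = 1 \<Longrightarrow> norm (\<xi> - \<eta>) \<ge> e \<Longrightarrow>
                 norm ((\<xi> + \<eta>) /\<^sub>R 2) \<le> 1 - d"
    using uc unfolding uniformly_convex_def by metis
  \<comment> \<open>Small enough that the total deficit \<open>2 * \<delta> * r * J^2\<close>,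
    divided by \<open>d\<close>, uses up half of \<epsilon>; the other half pays for the pairs
    closer than \<open>e * r\<close>.\<close>
  define \<delta> where "\<delta> = min (\<epsilon> * d / 4) (1/2)"
  have pos: "0 < \<delta>" "\<delta> < 1" using eps d by (auto simp: \<delta>_def)
  have main: "(\<Sum>j<J. \<Sum>k<J. norm (v j - v k)) \<le> \<epsilon> * r * J\<^sup>2"
    if v: "\<And>j. j < J \<Longrightarrow> norm (v j) = r" and big: "norm (\<Sum>j<J. v j) > (1 - \<delta>) * r * J"
    for J :: nat and v :: "nat \<Rightarrow> 'b" and r :: real
  proof (cases "J = 0")
    case True then show ?thesis by simp
  next
    case False
    then have r0: "r \<ge> 0" using v[of 0] norm_ge_zero[of "v 0"] by auto
    \<comment> \<open>Either the vectors are closer than \<open>e * r\<close>, or their sum has a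
      deficit of at least \<open>2 * r * d\<close>; divided by \<open>d\<close> this pays for the
      largest possible distance \<open>2 * r\<close>.\<close>
    have pair: "norm (v j - v k) \<le> \<epsilon>/2 * r + (2 * r - norm (v j + v k)) / d" if "j < J" "k < J" for j k
    proof (cases "r = 0")
      case True
      then have "v j = 0" "v k = 0" using v that by auto
      then show ?thesis using True by simp
    next
      case False
      then have rp: "r > 0" using r0 by simp
      have tri: "norm (v j + v k) \<le> 2 * r" using norm_triangle_ineq[of "v j" "v k"] v that by simp
      show ?thesis
      proof (cases "norm (v j - v k) \<ge> e * r")
        case True
        have n1: "norm (v j /\<^sub>R r) = 1" "norm (v k /\<^sub>R r) = 1" using v that rp by auto
        have "norm (v j /\<^sub>R r - v k /\<^sub>R r) = norm (v j - v k) / r"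
          unfolding scaleR_right_diff_distrib[symmetric] using rp by (simp add: divide_inverse mult.commute)
        moreover have "e \<le> norm (v j - v k) / r" using True rp by (simp add: pos_le_divide_eq)
        ultimately have "norm (v j /\<^sub>R r - v k /\<^sub>R r) \<ge> e" by (simp only:)
        from dd[OF n1 this] have A: "norm ((v j /\<^sub>R r + v k /\<^sub>R r) /\<^sub>R 2) \<le> 1 - d" .
        have "(v j /\<^sub>R r + v k /\<^sub>R r) /\<^sub>R 2 = (inverse r / 2) *\<^sub>R (v j + v k)"
          by (simp add: scaleR_add_right)
        then have "norm ((v j /\<^sub>R r + v k /\<^sub>R r) /\<^sub>R 2) = norm (v j + v k) / (2*r)"
          using rp by (simp add: inverse_eq_divide)
        with A have "norm (v j + v k) / (2*r) \<le> 1 - d" by simp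
        then have "norm (v j + v k) \<le> (1 - d) * (2 * r)" using rp by (simp only: pos_divide_le_eq mult_pos_pos zero_less_numeral)
        then have "2 * r * d \<le> 2 * r - norm (v j + v k)" by (simp add: algebra_simps)
        then have "2 * r \<le> (2 * r - norm (v j + v k)) / d" using d by (simp add: field_simps)
        moreover have "norm (v j - v k) \<le> 2 * r" using norm_triangle_ineq4[of "v j" "v k"] v that by simp
        moreover have "0 \<le> \<epsilon>/2 * r" using rp eps by simp
        ultimately show ?thesis by linarith
      next
        case False
        then have "norm (v j - v k) \<le> \<epsilon>/2 * r" by (simp add: e(3))
        moreover have "0 \<le> (2 * r - norm (v j + v k)) / d" using tri d by simp
        ultimately show ?thesis by linarith
      qed
    qed
    have S1: "(\<Sum>j<J. \<Sum>k<J. norm (v j - v k)) \<le> (\<Sum>j<J. \<Sum>k<J. \<epsilon>/2 * r + (2 * r - norm (v j + v k)) / d)"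
      by (intro sum_mono pair) auto
    have S2: "(\<Sum>j<J. \<Sum>k<J. \<epsilon>/2 * r + (2 * r - norm (v j + v k)) / d)
        = \<epsilon>/2 * r * J\<^sup>2 + (2 * r * J\<^sup>2 - (\<Sum>j<J. \<Sum>k<J. norm (v j + v k))) / d"
      by (simp add: sum.distrib sum_subtractf sum_divide_distrib[symmetric] power2_eq_square mult_ac)
    have "2 * real J * norm (\<Sum>j<J. v j) = norm (\<Sum>j<J. \<Sum>k<J. v j + v k)"
    proof -
      have "(\<Sum>j<J. \<Sum>k<J. v j + v k) = (2 * real J) *\<^sub>R (\<Sum>j<J. v j)"
        by (simp only: sum.distrib sum_constant_scaleR scaleR_sum_right[symmetric] scaleR_left_distrib[symmetric] card_lessThan)
          (simp flip: scaleR_left_distrib)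
      then show ?thesis by simp
    qed
    also have "\<dots> \<le> (\<Sum>j<J. \<Sum>k<J. norm (v j + v k))"
      by (rule order_trans[OF norm_sum], intro sum_mono norm_sum)
    finally have S3: "2 * real J * norm (\<Sum>j<J. v j) \<le> (\<Sum>j<J. \<Sum>k<J. norm (v j + v k))" .
    have "2 * real J * ((1 - \<delta>) * r * J) \<le> 2 * real J * norm (\<Sum>j<J. v j)"
      using big by (intro mult_left_mono) auto
    then have "2 * r * J\<^sup>2 - (\<Sum>j<J. \<Sum>k<J. norm (v j + v k)) \<le> 2 * \<delta> * r * J\<^sup>2"
      using S3 by (simp add: power2_eq_square algebra_simps)
    also have "\<dots> \<le> 2 * (\<epsilon> * d / 4) * r * J\<^sup>2"
      using r0 by (intro mult_right_mono) (auto simp: \<delta>_def)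
    finally have "(2 * r * J\<^sup>2 - (\<Sum>j<J. \<Sum>k<J. norm (v j + v k))) / d \<le> \<epsilon>/2 * r * J\<^sup>2"
      using d by (simp add: field_simps)
    then show ?thesis using S1 S2 by linarith
  qed
  show ?thesis using pos main by (auto simp: clustering_def \<epsilon>_def)
qed

text \<open>Strict convexity: the unit vectors \<open>a\<close> and \<open>b\<close> along the two
  halves have a sum of norm 2, so they agree. Uniqueness of metric midpoints lets every isometry
  preserve them, onto or not.\<close>

lemma uniformly_convex_midpoint:
  assumes uc: "uniformly_convex TYPE('b::real_normed_vector)"
    and "dist x m = dist x y / 2" "dist m y = dist x (y::'b) / 2"
  shows "m = (x + y) /\<^sub>R 2"
proof (cases "x = y")
  case True then show ?thesis using assms by (simp add: scaleR_2[symmetric])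
next
  case False
  define r where "r = dist x y / 2"
  have r: "r > 0" using False by (simp add: r_def)
  define a where "a = (m - x) /\<^sub>R r"
  define b where "b = (y - m) /\<^sub>R r"
  have na: "norm a = 1" "norm b = 1" using assms r
    by (auto simp: a_def b_def r_def dist_norm norm_minus_commute)
  have "a + b = (y - x) /\<^sub>R r" by (simp add: a_def b_def flip: scaleR_add_right)
  then have nab: "norm ((a + b) /\<^sub>R 2) = 1" using r by (simp add: r_def dist_norm norm_minus_commute)
  have "a = b"
  proof (rule ccontr)
    assume "a \<noteq> b"
    then have "0 < norm (a - b) \<and> norm (a - b) \<le> 2" using norm_triangle_ineq4[of a b] na by simp
    then obtain d where "d > 0" "norm ((a + b) /\<^sub>R 2) \<le> 1 - d"
      using uc na unfolding uniformly_convex_def by (meson order_refl)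
    then show False using nab by simp
  qed
  then have "m - x = y - m" using r by (simp add: a_def b_def)
  then have "x + y = 2 *\<^sub>R m" by (simp add: algebra_simps scaleR_2)
  then show ?thesis by simp
qed

definition affine_map :: "('b::real_vector \<Rightarrow> 'b) \<Rightarrow> bool" where
  "affine_map g \<longleftrightarrow> linear (\<lambda>v. g v - g 0)"

text \<open>Additivity gives homogeneity over the integers and then the rationals; the isometry
  property supplies the continuity that extends it to the reals.\<close>

lemma additive_isometry_linear:
  fixes f :: "'b::real_normed_vector \<Rightarrow> 'b"
  assumes add: "\<And>x y. f (x + y) = f x + f y" and nrm: "\<And>x. norm (f x) = norm x"
  shows "linear f"
proof
  show "f (x + y) = f x + f y" for x y by (fact add)
  have f0: "f 0 = 0" using add[of 0 0] by simp
  have fm: "f (- x) = - f x" for x using add[of x "-x"] f0 by (simp add: eq_neg_iff_add_eq_0 add.commute)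
  have fd: "f (x - y) = f x - f y" for x y using add[of x "-y"] fm by simp
  have fn: "f (of_nat n *\<^sub>R x) = of_nat n *\<^sub>R f x" for n x
    by (induction n) (auto simp: f0 add scaleR_left_distrib)
  have fi: "f (of_int k *\<^sub>R x) = of_int k *\<^sub>R f x" for k x
  proof (cases k)
    case (nonneg n) then show ?thesis using fn by simp
  next
    case (neg n) then show ?thesis using fn[of "Suc n" x] fm[of "of_nat (Suc n) *\<^sub>R x"]
      by (metis of_int_minus of_int_of_nat_eq scaleR_minus_left)
  qed
  have fq: "f (q *\<^sub>R x) = q *\<^sub>R f x" if q: "q \<in> \<rat>" for q x
  proof -
    from q obtain a b where ab: "b > 0" "q = of_int a / of_int b"
      by (metis Rats_cases')
    have "of_int b *\<^sub>R f (q *\<^sub>R x) = f ((of_int b * q) *\<^sub>R x)" by (simp flip: fi)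
    also have "\<dots> = of_int a *\<^sub>R f x" using ab fi by simp
    finally have *: "of_int b *\<^sub>R f (q *\<^sub>R x) = of_int a *\<^sub>R f x" .
    have "f (q *\<^sub>R x) = inverse (of_int b) *\<^sub>R (of_int b *\<^sub>R f (q *\<^sub>R x))" using ab by simp
    also have "\<dots> = q *\<^sub>R f x" unfolding * using ab by (simp add: divide_inverse mult.commute)
    finally show ?thesis .
  qed
  show "f (r *\<^sub>R x) = r *\<^sub>R f x" for r x
  proof -
    have cont: "continuous_on UNIV f"
    proof -
      have "dist (f x) (f y) = dist x y" for x y using nrm[of "x - y"] fd by (simp add: dist_norm)
      then show ?thesis by (auto simp: continuous_on_iff)
    qed
    have "continuous_on UNIV (\<lambda>r::real. f (r *\<^sub>R x) - r *\<^sub>R f x)"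
      by (intro continuous_intros continuous_on_compose2[OF cont]) auto
    moreover have "closure (\<rat>::real set) = UNIV" by (simp add: Rats_closure_real)
    ultimately have "f (r *\<^sub>R x) - r *\<^sub>R f x = 0"
      using continuous_constant_on_closure[of "\<rat>::real set" "\<lambda>r::real. f (r *\<^sub>R x) - r *\<^sub>R f x" 0 r] fq
      by auto
    then show ?thesis by simp
  qed
qed

text \<open>The pairs \<open>x\<close>, \<open>y\<close> and \<open>x + y\<close>, 0 have the same
  midpoint. Preserving it makes the linear part additive.\<close>

lemma isometry_affine:
  fixes g :: "'b::real_normed_vector \<Rightarrow> 'b"
  assumes uc: "uniformly_convex TYPE('b)" and iso: "\<And>x y. dist (g x) (g y) = dist x y"
  shows "affine_map g"
  unfolding affine_map_def
proof (rule additive_isometry_linear)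
  have mid: "g ((x + y) /\<^sub>R 2) = (g x + g y) /\<^sub>R 2" for x y
  proof (rule uniformly_convex_midpoint[OF uc])
    have h: "x = x /\<^sub>R 2 + x /\<^sub>R 2" for x :: 'b by (simp flip: scaleR_left_distrib)
    have "x - (x + y) /\<^sub>R 2 = (x - y) /\<^sub>R 2"
      by (subst (1) h) (simp add: scaleR_right_diff_distrib scaleR_right_distrib)
    moreover have "(x + y) /\<^sub>R 2 - y = (x - y) /\<^sub>R 2"
      by (subst (2) h) (simp add: scaleR_right_diff_distrib scaleR_right_distrib)
    ultimately have "dist x ((x + y) /\<^sub>R 2) = dist x y / 2" "dist ((x + y) /\<^sub>R 2) y = dist x y / 2"
      by (auto simp: dist_norm)
    then show "dist (g x) (g ((x + y) /\<^sub>R 2)) = dist (g x) (g y) / 2"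
      "dist (g ((x + y) /\<^sub>R 2)) (g y) = dist (g x) (g y) / 2"
      unfolding iso by auto
  qed
  have g2: "g x + g y = 2 *\<^sub>R g ((x + y) /\<^sub>R 2)" for x y unfolding mid by simp
  show "g (x + y) - g 0 = g x - g 0 + (g y - g 0)" for x y
    using g2[of x y] g2[of "x + y" 0] by (simp add: algebra_simps)
  show "norm (g x - g 0) = norm x" for x using iso[of x 0] by (simp add: dist_norm)
qed

section \<open>Contraction in a Heisenberg group\<close>

abbreviation disp :: "('b::real_normed_vector \<Rightarrow> 'b) \<Rightarrow> 'b \<Rightarrow> real" where
  "disp g q \<equiv> norm (g q - q)"

lemma norm_diff_chain4:
  fixes a b c d e :: "'b::real_normed_vector"
  shows "norm (a - e) \<le> norm (a - b) + norm (b - c) + norm (c - d) + norm (d - e)"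
proof -
  have "a - e = (a - b) + (b - c) + (c - d) + (d - e)" by simp
  then show ?thesis by (simp only:) (intro norm_triangle_le add_mono order_refl)
qed

text \<open>The vector \<open>u\<close> is an iterated average of translates \<open>x c u0\<close>; the first conjunct says that it lies in their
  closed convex hull. At scale \<open>i\<close> the commutator of
  \<open>x (a i)\<close> and \<open>y (b i)\<close> is the central \<open>z \<tau>\<close>.\<close>

lemma pure_contraction:
  fixes x y z :: "real \<Rightarrow> 'b::real_normed_vector \<Rightarrow> 'b" and J n :: nat and a b :: "nat \<Rightarrow> real" and e \<tau> \<delta> :: real
  defines "s \<equiv> \<lambda>i. \<Sum>k<i. real J * a k"
  assumes uc: "clustering TYPE('b) \<delta>" and J: "J \<ge> 1"
    and lx: "\<And>c. linear (x c)" and nx: "\<And>c v. norm (x c v) = norm v" and xx: "\<And>c c' v. x (c + c') v = x c (x c' v)"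
    and lz: "\<And>c. linear (z c)" and nz: "\<And>c v. norm (z c v) = norm v" and zz: "\<And>c c' v. z (c + c') v = z c (z c' v)"
    and ly: "\<And>c. linear (y c)" and ny: "\<And>c v. norm (y c v) = norm v"
    and ab: "\<And>i. i < n \<Longrightarrow> a i * b i = \<tau>" and a0: "\<And>i. 0 \<le> a i"
    and H1: "\<And>i c. i < n \<Longrightarrow> 0 \<le> c \<Longrightarrow> c \<le> s (Suc i) \<Longrightarrow> norm (y (b i) (x c u0) - z (- (c * b i)) (x c u0)) \<le> e"
    and H2: "\<And>i c c'. i < n \<Longrightarrow> 0 \<le> c \<Longrightarrow> c \<le> s i \<Longrightarrow> 0 \<le> c' \<Longrightarrow> c' \<le> s n \<Longrightarrow> disp (z (- (c * b i))) (x c' u0) \<le> e"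
    and H3: "\<And>c. 0 \<le> c \<Longrightarrow> c \<le> s n \<Longrightarrow> norm (\<Sum>j<J. z (real j * \<tau>) (x c u0)) \<le> J * e"
  shows "\<exists>u. (\<forall>F c r. linear F \<longrightarrow> (\<forall>c'. 0 \<le> c' \<longrightarrow> c' \<le> s n \<longrightarrow> norm (F (x c' u0) - c) \<le> r) \<longrightarrow> norm (F u - (c::'b)) \<le> r)
       \<and> norm u \<le> max ((1 - \<delta>) ^ n * norm u0) (10 * e)"
proof -
  have d: "0 < \<delta>" "\<delta> < 1" using uc by (auto simp: clustering_def)
  define D where "D = (\<lambda>c v. (\<Sum>j<J. x (real j * c) v) /\<^sub>R J)"
  define u where "u = rec_nat u0 (\<lambda>i v. D (a i) v)"
  have u_0: "u 0 = u0" and u_Suc: "u (Suc i) = (\<Sum>j<J. x (real j * a i) (u i)) /\<^sub>R J" for i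
    by (auto simp: u_def D_def)
  have x0: "x 0 v = v" for v
  proof -
    have "x 0 (x 0 v - v) = 0" using xx[of 0 0 v] by (simp add: linear_diff[OF lx])
    then show ?thesis using nx[of 0 "x 0 v - v"] by simp
  qed
  have z0: "z 0 v = v" for v
  proof -
    have "z 0 (z 0 v - v) = 0" using zz[of 0 0 v] by (simp add: linear_diff[OF lz])
    then show ?thesis using nz[of 0 "z 0 v - v"] by simp
  qed
  have s_Suc: "s (Suc i) = s i + J * a i" for i by (simp add: s_def)
  have s_mono: "s i \<le> s j" if "i \<le> j" for i j
    unfolding s_def using that a0 by (intro sum_mono2) auto
  have s_0: "s 0 = 0" by (simp add: s_def)
  \<comment> \<open>\<open>u i\<close> is a convex combination of vectors \<open>x c' u0\<close>
    with \<open>c'\<close> in \<open>[0, s i]\<close>, so a bound of this convex form passes from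
    them to \<open>u i\<close>.\<close>
  have conv: "norm (F (u i) - c) \<le> r"
    if "linear F" "\<And>c'. 0 \<le> c' \<Longrightarrow> c' \<le> s i \<Longrightarrow> norm (F (x c' u0) - c) \<le> r"
    for F :: "'b \<Rightarrow> 'b" and i c r
    using that
  proof (induction i arbitrary: F)
    case 0
    then show ?case using "0.prems"(2)[of 0] by (simp add: u_0 s_0 x0)
  next
    case (Suc i)
    have each: "norm (F (x (real j * a i) (u i)) - c) \<le> r" if j: "j < J" for j
    proof -
      have "norm ((F \<circ> x (real j * a i)) (u i) - c) \<le> r"
      proof (rule Suc.IH)
        show "linear (F \<circ> x (real j * a i))" by (intro linear_compose lx Suc.prems(1))
        fix c' assume c': "0 \<le> c'" "c' \<le> s i"
        have "real j * a i \<le> real J * a i" using j a0 by (intro mult_right_mono) auto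
        then have "norm (F (x (real j * a i + c') u0) - c) \<le> r"
          using c' a0[of i] by (intro Suc.prems(2)) (auto simp: s_Suc)
        then show "norm ((F \<circ> x (real j * a i)) (x c' u0) - c) \<le> r" by (simp add: xx)
      qed
      then show ?thesis by simp
    qed
    have "F (u (Suc i)) - c = (\<Sum>j<J. F (x (real j * a i) (u i)) - c) /\<^sub>R J"
      using J by (simp add: u_Suc linear_scale[OF Suc.prems(1)] linear_sum[OF Suc.prems(1)] sum_subtractf
          sum_constant_scaleR scaleR_right_diff_distrib)
    also have "norm \<dots> \<le> (\<Sum>j<J. r) / J"
      using J by (simp add: divide_inverse mult.commute) (intro mult_right_mono order_trans[OF norm_sum] order_trans[OF sum_mono[OF each]], auto)
    also have "\<dots> = r" using J by simp
    finally show ?case .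
  qed
  \<comment> \<open>If averaging at scale \<open>i\<close> loses less than the fraction \<delta> of
    the norm, the translates cluster. Then \<open>z\<close> moves \<open>u i\<close> only by a
    fraction of its norm on average, while averages of its \<open>z\<close>-translates are nearly
    zero.\<close>
  have small: "norm (u i) \<le> 10 * e" if i: "i < n" and no: "norm (u (Suc i)) > (1 - \<delta>) * norm (u i)" for i
  proof -
    let ?u = "u i" and ?x = "\<lambda>j. x (real j * a i) (u i)"
    \<comment> \<open>Interchanging \<open>y (b i)\<close> with \<open>x c\<close> costs
      \<open>z (- (c * b i))\<close>. For \<open>c = j * a i + c'\<close> the part \<open>c'\<close>
      stems from the earlier scales, and \<open>H2\<close> makes its central factor negligible;
      \<open>z (- (j * \<tau>))\<close> remains.\<close>
    have yx: "norm (y (b i) (?x j) - z (- (j * \<tau>)) (?x j)) \<le> 2 * e" if j: "j < J" for j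
    proof -
      define F where "F = (\<lambda>v. y (b i) (x (real j * a i) v) - z (- (j * \<tau>)) (x (real j * a i) v))"
      have lF: "linear F" unfolding F_def
        using linear_compose_sub[OF linear_compose[OF lx ly] linear_compose[OF lx lz]] by (simp add: o_def)
      have "norm (F (u i) - 0) \<le> 2 * e"
      proof (rule conv[OF lF])
        fix c' assume c': "0 \<le> c'" "c' \<le> s i"
        let ?c = "real j * a i + c'"
        have "real j * a i \<le> real J * a i" using j a0 by (intro mult_right_mono) auto
        then have c: "0 \<le> ?c" "?c \<le> s (Suc i)" using c' a0[of i] by (auto simp: s_Suc)
        have cn: "?c \<le> s n" using c(2) s_mono[of "Suc i" n] i by simp
        have eq: "z (- (?c * b i)) v = z (- (j * \<tau>)) (z (- (c' * b i)) v)" for v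
          using ab[OF i] by (simp flip: zz) (simp add: algebra_simps)
        have "norm (z (- (j * \<tau>)) (z (- (c' * b i)) (x ?c u0)) - z (- (j * \<tau>)) (x ?c u0)) \<le> e"
          using H2[OF i c' c(1) cn] by (simp flip: linear_diff[OF lz] add: nz)
        moreover have "norm (y (b i) (x ?c u0) - z (- (j * \<tau>)) (z (- (c' * b i)) (x ?c u0))) \<le> e"
          using H1[OF i c] by (simp add: eq)
        ultimately have "norm (y (b i) (x ?c u0) - z (- (j * \<tau>)) (x ?c u0)) \<le> e + e"
          by (meson norm_diff_triangle_le)
        then show "norm (F (x c' u0) - 0) \<le> 2 * e" by (simp add: F_def xx)
      qed
      then show ?thesis by (simp add: F_def)
    qed
    have yu: "disp (y (b i)) ?u \<le> 2 * e" using yx[of 0] J by (simp add: x0 z0)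
    \<comment> \<open>\<open>y (b i)\<close> acts like \<open>z (- (j * \<tau>))\<close> on the
      translate and almost trivially on \<open>u i\<close>. The closer these two vectors are, the
      less \<open>z (- (j * \<tau>))\<close> can move \<open>u i\<close>.\<close>
    have zu: "disp (z (- (j * \<tau>))) ?u \<le> 2 * norm (?x j - ?u) + 4 * e" if j: "j < J" for j
    proof -
      have "norm (z (- (j * \<tau>)) ?u - z (- (j * \<tau>)) (?x j)) = norm (?x j - ?u)"
        by (simp flip: linear_diff[OF lz] add: nz norm_minus_commute)
      moreover have "norm (y (b i) (?x j) - y (b i) ?u) = norm (?x j - ?u)"
        by (simp flip: linear_diff[OF ly] add: ny)
      ultimately show ?thesis
        using yx[OF j] yu norm_diff_chain4[of "z (- (j * \<tau>)) ?u" ?u "z (- (j * \<tau>)) (?x j)" "y (b i) (?x j)" "y (b i) ?u"]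
        by (simp add: norm_minus_commute)
    qed
    have zu': "disp (z (j * \<tau> - k * \<tau>)) ?u \<le> 2 * norm (?x j - ?x k) + 4 * e" if j: "j < J" "k < J" for j k :: nat
    proof -
      have ord: "disp (z (j * \<tau> - k * \<tau>)) ?u \<le> 2 * norm (?x j - ?x k) + 4 * e \<and> disp (z (k * \<tau> - j * \<tau>)) ?u \<le> 2 * norm (?x j - ?x k) + 4 * e"
        if "j \<le> k" "k < J" for j k :: nat
      proof -
        have "?x k = x (real j * a i) (?x (k - j))"
          using that by (simp flip: xx) (simp add: of_nat_diff algebra_simps)
        then have e1: "norm (?x j - ?x k) = norm (?x (k - j) - ?u)"
          by (simp flip: linear_diff[OF lx] add: nx norm_minus_commute)
        have r: "- (real (k - j) * \<tau>) = j * \<tau> - k * \<tau>" using that by (simp add: of_nat_diff algebra_simps)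
        have A: "disp (z (j * \<tau> - k * \<tau>)) ?u \<le> 2 * norm (?x j - ?x k) + 4 * e"
          using zu[of "k - j"] that unfolding e1 r by auto
        have "z (j * \<tau> - k * \<tau>) (z (k * \<tau> - j * \<tau>) ?u) = ?u" by (simp flip: zz add: z0)
        then have "disp (z (k * \<tau> - j * \<tau>)) ?u = disp (z (j * \<tau> - k * \<tau>)) ?u"
          using nz[of "j * \<tau> - k * \<tau>" "z (k * \<tau> - j * \<tau>) ?u - ?u"]
          by (simp add: linear_diff[OF lz] norm_minus_commute)
        then show ?thesis using A by simp
      qed
      show ?thesis
      proof (cases "j \<le> k")
        case True then show ?thesis using ord j by simp
      next
        case False then show ?thesis using ord[of k j] j by (simp add: norm_minus_commute)
      qed
    qed
    have "(\<Sum>j<J. \<Sum>k<J. norm (?x j - ?x k)) \<le> (1/4) * norm ?u * J\<^sup>2"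
    proof (rule uc[unfolded clustering_def, THEN conjunct2, THEN conjunct2, rule_format])
      show "norm (?x j) = norm ?u" for j by (simp add: nx)
      have "norm (u (Suc i)) = norm (\<Sum>j<J. ?x j) / J" by (simp add: u_Suc divide_inverse mult.commute)
      then show "norm (\<Sum>j<J. ?x j) > (1 - \<delta>) * norm ?u * J" using no J by (simp add: less_divide_eq)
    qed
    then have S: "(\<Sum>j<J. \<Sum>k<J. disp (z (j * \<tau> - k * \<tau>)) ?u) \<le> (1/2) * norm ?u * J\<^sup>2 + 4 * e * J\<^sup>2"
    proof -
      have "(\<Sum>j<J. \<Sum>k<J. disp (z (j * \<tau> - k * \<tau>)) ?u) \<le> (\<Sum>j<J. \<Sum>k<J. 2 * norm (?x j - ?x k) + 4 * e)"
        by (intro sum_mono zu') auto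
      also have "\<dots> = 2 * (\<Sum>j<J. \<Sum>k<J. norm (?x j - ?x k)) + 4 * e * J\<^sup>2"
        by (simp add: sum.distrib sum_distrib_left power2_eq_square)
      finally show ?thesis using \<open>_ \<le> (1/4) * norm ?u * J\<^sup>2\<close> by linarith
    qed
    have Z: "norm (\<Sum>j<J. z (real j * \<tau>) ?u) \<le> J * e"
    proof -
      have "linear (\<lambda>v. \<Sum>j<J. z (real j * \<tau>) v)" by (intro linear_compose_sum ballI lz)
      moreover have "norm ((\<Sum>j<J. z (real j * \<tau>) (x c' u0)) - 0) \<le> J * e" if "0 \<le> c'" "c' \<le> s i" for c'
        using H3[of c'] s_mono[of i n] i that by simp
      ultimately have "norm ((\<Sum>j<J. z (real j * \<tau>) ?u) - 0) \<le> J * e" by (rule conv)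
      then show ?thesis by simp
    qed
    have Z2: "norm (\<Sum>j<J. \<Sum>k<J. z (j * \<tau> - k * \<tau>) ?u) \<le> J * (J * e)"
    proof -
      have "(\<Sum>j<J. \<Sum>k<J. z (j * \<tau> - k * \<tau>) ?u) = (\<Sum>k<J. \<Sum>j<J. z (j * \<tau> - k * \<tau>) ?u)"
        by (rule sum.swap)
      also have "norm \<dots> \<le> (\<Sum>k<J. J * e)"
      proof (rule order_trans[OF norm_sum], rule sum_mono)
        fix k
        have "(\<Sum>j<J. z (real j * \<tau> - real k * \<tau>) ?u) = z (- (real k * \<tau>)) (\<Sum>j<J. z (real j * \<tau>) ?u)"
          by (simp add: linear_sum[OF lz] flip: zz)
        then show "norm (\<Sum>j<J. z (real j * \<tau> - real k * \<tau>) ?u) \<le> J * e" using Z by (simp add: nz)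
      qed
      finally show ?thesis by simp
    qed
    \<comment> \<open>The double average of the \<open>z\<close>-translates has norm at most
      \<open>e\<close> and lies within \<open>norm ?u / 2 + 4 * e\<close> of
      \<open>?u\<close>.\<close>
    have "(real J)\<^sup>2 * norm ?u = norm (\<Sum>j<J. \<Sum>k<J. ?u)"
      by (simp add: sum_constant_scaleR power2_eq_square)
    also have "\<dots> = norm ((\<Sum>j<J. \<Sum>k<J. z (j * \<tau> - k * \<tau>) ?u) - (\<Sum>j<J. \<Sum>k<J. (z (j * \<tau> - k * \<tau>) ?u - ?u)))"
      by (simp only: sum_subtractf) simp
    also have "\<dots> \<le> J * (J * e) + (\<Sum>j<J. \<Sum>k<J. disp (z (j * \<tau> - k * \<tau>)) ?u)"
      by (rule order_trans[OF norm_triangle_ineq4], intro add_mono Z2)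
        (rule order_trans[OF norm_sum], intro sum_mono norm_sum)
    also have "\<dots> \<le> (real J)\<^sup>2 * (5 * e + norm ?u / 2)" using S by (simp add: power2_eq_square algebra_simps)
    finally have "norm ?u \<le> 5 * e + norm ?u / 2" using J by simp
    then show ?thesis by simp
  qed
  have decr: "norm (u (Suc i)) \<le> norm (u i)" for i
  proof -
    have "norm (u (Suc i)) = norm (\<Sum>j<J. x (real j * a i) (u i)) / J" by (simp add: u_Suc divide_inverse mult.commute)
    also have "\<dots> \<le> (\<Sum>j<J. norm (x (real j * a i) (u i))) / J" by (intro divide_right_mono norm_sum) auto
    finally show ?thesis using J by (simp add: nx)
  qed
  have "norm (u i) \<le> max ((1 - \<delta>) ^ i * norm u0) (10 * e)" if "i \<le> n" for i
    using that
  proof (induction i)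
    case 0 then show ?case by (simp add: u_0)
  next
    case (Suc i)
    show ?case
    proof (cases "norm (u (Suc i)) > (1 - \<delta>) * norm (u i)")
      case True
      then have "norm (u i) \<le> 10 * e" using small Suc.prems by simp
      then show ?thesis using decr[of i] by linarith
    next
      case False
      have IH: "norm (u i) \<le> max ((1 - \<delta>) ^ i * norm u0) (10 * e)" using Suc by simp
      show ?thesis
      proof (cases "norm (u i) \<le> 10 * e")
        case True then show ?thesis using decr[of i] by linarith
      next
        case F2: False
        then have "norm (u i) \<le> (1 - \<delta>) ^ i * norm u0" using IH by linarith
        then have "(1 - \<delta>) * norm (u i) \<le> (1 - \<delta>) * ((1 - \<delta>) ^ i * norm u0)" using d by (intro mult_left_mono) auto
        then show ?thesis using False by simp
      qed
    qed
  qed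
  then show ?thesis using conv by blast
qed

section \<open>Averages along isometric flows\<close>

definition flow_avg :: "(real \<Rightarrow> 'b::banach \<Rightarrow> 'b) \<Rightarrow> real \<Rightarrow> 'b \<Rightarrow> 'b" where
  "flow_avg f r q = (1/r) *\<^sub>R integral {0..r} (\<lambda>t. f t q)"

definition isometry_map :: "('b::real_normed_vector \<Rightarrow> 'b) \<Rightarrow> bool" where
  "isometry_map g \<longleftrightarrow> affine_map g \<and> (\<forall>x y. norm (g x - g y) = norm (x - y))"

definition contraction_map :: "('b::real_normed_vector \<Rightarrow> 'b) \<Rightarrow> bool" where
  "contraction_map g \<longleftrightarrow> affine_map g \<and> (\<forall>x y. norm (g x - g y) \<le> norm (x - y))"

lemma contraction_map_norm: "contraction_map g \<Longrightarrow> norm (g x - g y) \<le> norm (x - y)"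
  by (simp add: contraction_map_def)

lemma isometry_map_norm: "isometry_map g \<Longrightarrow> norm (g x - g y) = norm (x - y)"
  by (simp add: isometry_map_def)

lemma isometry_imp_contraction: "isometry_map g \<Longrightarrow> contraction_map g"
  by (simp add: isometry_map_def contraction_map_def)

lemma affine_map_comp: assumes "affine_map f" "affine_map g" shows "affine_map (\<lambda>v. f (g v))"
proof -
  have lf: "linear (\<lambda>v. f v - f 0)" and lg: "linear (\<lambda>v. g v - g 0)" using assms by (auto simp: affine_map_def)
  have "(\<lambda>v. f (g v) - f (g 0)) = (\<lambda>v. f v - f 0) \<circ> (\<lambda>v. g v - g 0)"
    using linear_diff[OF lf, of _ "g 0"] by (auto simp: fun_eq_iff)
  moreover have "linear ((\<lambda>v. f v - f 0) \<circ> (\<lambda>v. g v - g 0))" by (intro linear_compose lf lg)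
  ultimately show ?thesis unfolding affine_map_def by simp
qed

lemma contraction_map_comp: "contraction_map f \<Longrightarrow> contraction_map g \<Longrightarrow> contraction_map (\<lambda>v. f (g v))"
  unfolding contraction_map_def using affine_map_comp[of f g] order_trans by blast

lemma affine_map_combination:
  assumes "affine_map g"
  shows "g ((1 - s) *\<^sub>R x + s *\<^sub>R y) = (1 - s) *\<^sub>R g x + s *\<^sub>R g y"
proof -
  have l: "linear (\<lambda>v. g v - g 0)" using assms by (simp add: affine_map_def)
  show ?thesis using linear_add[OF l, of "(1 - s) *\<^sub>R x" "s *\<^sub>R y"]
    by (simp add: linear_scale[OF l]) (simp add: algebra_simps)
qed

lemma contraction_map_integral:
  fixes g :: "'b::banach \<Rightarrow> 'b"
  assumes g: "contraction_map g" and r: "r > 0" and f: "continuous_on {0..r} f"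
  shows "g ((1/r) *\<^sub>R integral {0..r} f) = (1/r) *\<^sub>R integral {0..r} (\<lambda>t. g (f t))"
proof -
  let ?l = "\<lambda>v. g v - g 0"
  have l: "linear ?l" using g by (simp add: contraction_map_def affine_map_def)
  have bl: "bounded_linear ?l"
    by (rule bounded_linear_intro[where K=1])
      (use linear_add[OF l] linear_scale[OF l] contraction_map_norm[OF g, of _ 0] in auto)
  have int: "f integrable_on {0..r}" by (rule integrable_continuous_real[OF f])
  have "integral {0..r} (\<lambda>t. ?l (f t)) = ?l (integral {0..r} f)"
    using integral_linear[OF int bl] by (simp add: o_def)
  moreover have "(\<lambda>t. ?l (f t)) integrable_on {0..r}"
    using integrable_linear[OF int bl] by (simp add: o_def)
  then have "integral {0..r} (\<lambda>t. ?l (f t) + g 0) = integral {0..r} (\<lambda>t. ?l (f t)) + integral {0..r} (\<lambda>t. g 0)"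
    by (intro integral_add) auto
  ultimately have "integral {0..r} (\<lambda>t. g (f t)) = ?l (integral {0..r} f) + r *\<^sub>R g 0" using r by simp
  then have "(1/r) *\<^sub>R integral {0..r} (\<lambda>t. g (f t)) = ?l ((1/r) *\<^sub>R integral {0..r} f) + g 0"
    using r by (simp only: linear_scale[OF l]) (simp add: scaleR_add_right)
  then show ?thesis by simp
qed

lemma integral_avg_close:
  fixes f :: "real \<Rightarrow> 'b::banach"
  assumes r: "r > 0" and f: "continuous_on {0..r} f" and g: "continuous_on {0..r} g"
    and le: "\<And>t. 0 \<le> t \<Longrightarrow> t \<le> r \<Longrightarrow> norm (f t - g t) \<le> e"
  shows "norm ((1/r) *\<^sub>R integral {0..r} f - (1/r) *\<^sub>R integral {0..r} g) \<le> e"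
proof -
  have "norm (integral {0..r} (\<lambda>t. f t - g t)) \<le> e * (r - 0)"
    by (rule integral_bound) (use assms in \<open>auto intro!: continuous_intros\<close>)
  moreover have "integral {0..r} (\<lambda>t. f t - g t) = integral {0..r} f - integral {0..r} g"
    by (intro integral_diff integrable_continuous_real f g)
  ultimately show ?thesis unfolding scaleR_right_diff_distrib[symmetric] using r
    by (simp add: pos_divide_le_eq)
qed

lemma integral_avg_const:
  fixes c :: "'b::banach"
  shows "r > 0 \<Longrightarrow> (1/r) *\<^sub>R integral {0..r} (\<lambda>t. c) = c"
  by simp

lemma integral_avg_bound:
  fixes f :: "real \<Rightarrow> 'b::banach"
  assumes r: "r > 0" and f: "continuous_on {0..r} f"
    and le: "\<And>t. 0 \<le> t \<Longrightarrow> t \<le> r \<Longrightarrow> norm (f t - c) \<le> e"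
  shows "norm ((1/r) *\<^sub>R integral {0..r} f - c) \<le> e"
  using integral_avg_close[OF r f continuous_on_const le] integral_avg_const[OF r, of c] by simp

text \<open>The parameter change costs twice: for its derivative, and for the endpoint
  \<open>\<psi> r\<close> in place of \<open>r\<close>. Each error is at most
  \<open>\<kappa> * K\<close> after division by \<open>r\<close>. Subtracting \<open>c\<close> first
  lets only the displacement \<open>K\<close> enter, not the size of \<open>f\<close>.\<close>

lemma integral_avg_substitution:
  fixes f :: "real \<Rightarrow> 'b::banach"
  assumes r: "r > 0" and f: "continuous_on {0..2*r} f"
    and psi: "\<And>t. 0 \<le> t \<Longrightarrow> t \<le> r \<Longrightarrow> (\<psi> has_real_derivative \<psi>' t) (at t within {0..r})"
    and psi': "continuous_on {0..r} \<psi>'" and p0: "\<psi> 0 = 0"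
    and k: "\<And>t. 0 \<le> t \<Longrightarrow> t \<le> r \<Longrightarrow> \<bar>\<psi>' t - 1\<bar> \<le> \<kappa>" and k1: "\<kappa> \<le> 1"
    and K: "\<And>t. 0 \<le> t \<Longrightarrow> t \<le> 2*r \<Longrightarrow> norm (f t - c) \<le> K"
  shows "norm ((1/r) *\<^sub>R integral {0..r} (\<lambda>t. f (\<psi> t)) - (1/r) *\<^sub>R integral {0..r} f) \<le> 2 * \<kappa> * K"
    and "\<And>t. 0 \<le> t \<Longrightarrow> t \<le> r \<Longrightarrow> 0 \<le> \<psi> t \<and> \<psi> t \<le> 2 * r"
proof -
  have k0: "\<kappa> \<ge> 0" using k[of 0] r by simp
  have K0: "K \<ge> 0" using order_trans[OF norm_ge_zero K[of 0]] r by simp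
  have psi_t: "\<bar>\<psi> t - t\<bar> \<le> \<kappa> * t" if t: "0 \<le> t" "t \<le> r" for t
  proof -
    have "\<bar>(\<psi> t - t) - (\<psi> 0 - 0)\<bar> \<le> \<kappa> * \<bar>t - 0\<bar>"
    proof -
      have "norm ((\<psi> t - t) - (\<psi> 0 - 0)) \<le> \<kappa> * norm (t - 0)"
        by (rule field_differentiable_bound[where S="{0..r}" and f'="\<lambda>t. \<psi>' t - 1"])
          (use t k r in \<open>auto intro!: derivative_eq_intros psi\<close>)
      then show ?thesis by simp
    qed
    then show ?thesis using t p0 by simp
  qed
  show range: "0 \<le> \<psi> t \<and> \<psi> t \<le> 2 * r" if t: "0 \<le> t" "t \<le> r" for t
  proof -
    have "\<kappa> * t \<le> t" using k1 t k0 mult_right_mono[of \<kappa> 1 t] by simp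
    then show ?thesis using psi_t[OF t] t by linarith
  qed
  have cont_psi: "continuous_on {0..r} \<psi>"
    by (rule DERIV_continuous_on) (use psi in auto)
  have cont_fpsi: "continuous_on {0..r} (\<lambda>t. f (\<psi> t))"
    by (rule continuous_on_compose2[OF f cont_psi]) (use range in auto)
  let ?g = "\<lambda>t. f t - c"
  have cg: "continuous_on {0..2*r} ?g" by (intro continuous_intros f)
  have ig: "?g integrable_on {0..u}" if "u \<le> 2*r" for u
    by (intro integrable_continuous_real continuous_on_subset[OF cg]) (use that in auto)
  have sub: "integral {0..r} (\<lambda>t. \<psi>' t *\<^sub>R ?g (\<psi> t)) = integral {0..\<psi> r} ?g"
  proof -
    let ?F = "\<lambda>u. integral {0..u} ?g"
    have dF: "(?F has_vector_derivative ?g u) (at u within {0..2*r})" if "u \<in> {0..2*r}" for u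
      by (rule integral_has_vector_derivative[OF cg that])
    have "((\<lambda>t. \<psi>' t *\<^sub>R ?g (\<psi> t)) has_integral ((?F \<circ> \<psi>) r - (?F \<circ> \<psi>) 0)) {0..r}"
    proof (rule fundamental_theorem_of_calculus)
      show "0 \<le> r" using r by simp
      fix t assume t: "t \<in> {0..r}"
      show "((?F \<circ> \<psi>) has_vector_derivative \<psi>' t *\<^sub>R ?g (\<psi> t)) (at t within {0..r})"
      proof (rule vector_diff_chain_within)
        show "(\<psi> has_vector_derivative \<psi>' t) (at t within {0..r})"
          using psi t by (simp add: has_real_derivative_iff_has_vector_derivative)
        show "(?F has_vector_derivative ?g (\<psi> t)) (at (\<psi> t) within \<psi> ` {0..r})"
          by (rule has_vector_derivative_within_subset[OF dF]) (use range t in auto)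
      qed
    qed
    then show ?thesis using p0 by (simp add: integral_unique o_def)
  qed
  have A: "norm (integral {0..r} (\<lambda>t. ?g (\<psi> t)) - integral {0..\<psi> r} ?g) \<le> \<kappa> * K * r"
  proof -
    have "integral {0..r} (\<lambda>t. ?g (\<psi> t)) - integral {0..\<psi> r} ?g = integral {0..r} (\<lambda>t. ?g (\<psi> t) - \<psi>' t *\<^sub>R ?g (\<psi> t))"
      unfolding sub[symmetric]
      by (intro integral_diff[symmetric] integrable_continuous_real continuous_intros psi' cont_fpsi)
    also have "\<dots> = integral {0..r} (\<lambda>t. (1 - \<psi>' t) *\<^sub>R ?g (\<psi> t))"
      by (simp add: scaleR_left_diff_distrib)
    also have "norm \<dots> \<le> (\<kappa> * K) * (r - 0)"
    proof (rule integral_bound)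
      show "continuous_on {0..r} (\<lambda>t. (1 - \<psi>' t) *\<^sub>R ?g (\<psi> t))"
        by (intro continuous_intros psi' cont_fpsi)
      fix t assume t: "t \<in> {0..r}"
      have "\<bar>1 - \<psi>' t\<bar> \<le> \<kappa>" using k[of t] t by (simp add: abs_minus_commute)
      moreover have "norm (?g (\<psi> t)) \<le> K" using K range[of t] t by simp
      ultimately show "norm ((1 - \<psi>' t) *\<^sub>R ?g (\<psi> t)) \<le> \<kappa> * K"
        by (simp add: mult_mono k0)
    qed (use r in simp)
    finally show ?thesis by simp
  qed
  have B: "norm (integral {0..\<psi> r} ?g - integral {0..r} ?g) \<le> \<kappa> * K * r"
  proof -
    have seg: "norm (integral {u..v} ?g) \<le> K * (v - u)" if "0 \<le> u" "u \<le> v" "v \<le> 2*r" for u v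
      by (rule integral_bound) (use that K in \<open>auto intro!: continuous_intros continuous_on_subset[OF f]\<close>)
    have pr: "0 \<le> \<psi> r" "\<psi> r \<le> 2 * r" using range[of r] r by auto
    have "norm (integral {0..\<psi> r} ?g - integral {0..r} ?g) \<le> K * \<bar>\<psi> r - r\<bar>"
    proof (cases "\<psi> r \<le> r")
      case True
      have "integral {0..\<psi> r} ?g + integral {\<psi> r..r} ?g = integral {0..r} ?g"
        by (rule Henstock_Kurzweil_Integration.integral_combine) (use True pr r ig[of r] in auto)
      then have "integral {0..\<psi> r} ?g - integral {0..r} ?g = - integral {\<psi> r..r} ?g" by (simp add: algebra_simps)
      then show ?thesis using seg[of "\<psi> r" r] True pr r by simp
    next
      case False
      have "integral {0..r} ?g + integral {r..\<psi> r} ?g = integral {0..\<psi> r} ?g"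
        by (rule Henstock_Kurzweil_Integration.integral_combine) (use False pr r ig[of "\<psi> r"] in auto)
      then have "integral {0..\<psi> r} ?g - integral {0..r} ?g = integral {r..\<psi> r} ?g" by (simp add: algebra_simps)
      then show ?thesis using seg[of r "\<psi> r"] False pr r by simp
    qed
    also have "\<dots> \<le> K * (\<kappa> * r)" using psi_t[of r] r K0 by (intro mult_left_mono) auto
    finally show ?thesis by (simp add: mult_ac)
  qed
  have split: "integral {0..r} (\<lambda>t. h t - c) = integral {0..r} h - r *\<^sub>R c" if "continuous_on {0..r} h" for h :: "real \<Rightarrow> 'b"
    using integral_diff[OF integrable_continuous_real[OF that] integrable_const_ivl[of c]] r by simp
  have "norm (integral {0..r} (\<lambda>t. ?g (\<psi> t)) - integral {0..r} ?g) \<le> \<kappa> * K * r + \<kappa> * K * r"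
    using norm_diff_triangle_le[OF A B] .
  moreover have "integral {0..r} (\<lambda>t. ?g (\<psi> t)) - integral {0..r} ?g = integral {0..r} (\<lambda>t. f (\<psi> t)) - integral {0..r} f"
    using split[OF cont_fpsi] split[OF continuous_on_subset[OF f, of "{0..r}"]] r by simp
  ultimately have "norm (integral {0..r} (\<lambda>t. f (\<psi> t)) - integral {0..r} f) \<le> 2 * \<kappa> * K * r" by (simp add: mult_ac)
  then show "norm ((1/r) *\<^sub>R integral {0..r} (\<lambda>t. f (\<psi> t)) - (1/r) *\<^sub>R integral {0..r} f) \<le> 2 * \<kappa> * K"
    unfolding scaleR_right_diff_distrib[symmetric] using r by (simp add: pos_divide_le_eq)
qed

section \<open>Isometric flows and invariance of their averages\<close>

definition flow :: "(real \<Rightarrow> 'b::real_normed_vector \<Rightarrow> 'b) \<Rightarrow> bool" where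
  "flow f \<longleftrightarrow> (\<forall>t. isometry_map (f t)) \<and> (\<forall>s t q. f (s + t) q = f s (f t q)) \<and> (\<forall>q. f 0 q = q)
     \<and> (\<forall>q. continuous_on UNIV (\<lambda>t. f t q))"

lemma flow_isometry: "flow f \<Longrightarrow> isometry_map (f t)" by (simp add: flow_def)
lemma flow_add: "flow f \<Longrightarrow> f (s + t) q = f s (f t q)" by (simp add: flow_def)
lemma flow_0: "flow f \<Longrightarrow> f 0 q = q" by (simp add: flow_def)
lemma flow_norm: "flow f \<Longrightarrow> norm (f t x - f t y) = norm (x - y)" by (simp add: flow_def isometry_map_norm)
lemma flow_contraction: "flow f \<Longrightarrow> contraction_map (f t)" by (simp add: flow_isometry isometry_imp_contraction)
lemma flow_cont: "flow f \<Longrightarrow> continuous_on S (\<lambda>t. f t q)" using continuous_on_subset unfolding flow_def by blast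
lemma flow_inverse: "flow f \<Longrightarrow> f (- t) (f t q) = q" "flow f \<Longrightarrow> f t (f (- t) q) = q"
  using flow_add[of f "-t" t q] flow_add[of f t "-t" q] flow_0[of f q] by auto

lemma flow_commute: "flow f \<Longrightarrow> f s (f t q) = f t (f s q)"
  by (metis flow_add add.commute)

lemma flow_disp_minus: assumes "flow f" shows "disp (f (- t)) q = disp (f t) q"
  using flow_norm[OF assms, of t "f (-t) q" q] flow_inverse(2)[OF assms, of t q] by (simp add: norm_minus_commute)

lemma disp_near:
  assumes "contraction_map g" shows "disp g q \<le> disp g p + 2 * norm (q - p)"
proof -
  have "disp g q \<le> norm (g q - g p) + disp g p + norm (p - q) + norm (q - q)"
    by (rule norm_diff_chain4)
  then show ?thesis using contraction_map_norm[OF assms, of q p] by (simp add: norm_minus_commute)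
qed

lemma disp_comp:
  assumes "contraction_map g" shows "norm (g (h q) - q) \<le> disp g q + disp h q"
  using contraction_map_norm[OF assms, of "h q" q] norm_triangle_le[of "g (h q) - g q" "g q - q"] by force

lemma flow_linear_part:
  assumes f: "flow f" shows "flow (\<lambda>t v. f t v - f t 0)" "\<And>t. linear (\<lambda>v. f t v - f t 0)"
    "\<And>t v. norm (f t v - f t 0) = norm v"
proof -
  show lin: "linear (\<lambda>v. f t v - f t 0)" for t using flow_isometry[OF f, of t] by (simp add: isometry_map_def affine_map_def)
  show "norm (f t v - f t 0) = norm v" for t v using flow_norm[OF f, of t v 0] by simp
  show "flow (\<lambda>t v. f t v - f t 0)"
    unfolding flow_def
  proof (intro conjI allI)
    show "isometry_map (\<lambda>v. f t v - f t 0)" for t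
      using lin[of t] flow_norm[OF f] by (simp add: isometry_map_def affine_map_def)
    show "f (s + t) q - f (s + t) 0 = f s (f t q - f t 0) - f s 0" for s t q
      using linear_diff[OF lin, of s "f t q" "f t 0"] by (simp add: flow_add[OF f])
    show "f 0 q - f 0 0 = q" for q by (simp add: flow_0[OF f])
    show "continuous_on UNIV (\<lambda>t. f t q - f t 0)" for q by (intro continuous_intros flow_cont[OF f])
  qed
qed

lemma flow_avg_move:
  assumes "flow f" "contraction_map g" "r > 0"
  shows "g (flow_avg f r q) = (1/r) *\<^sub>R integral {0..r} (\<lambda>t. g (f t q))"
  unfolding flow_avg_def by (rule contraction_map_integral[OF assms(2,3) flow_cont[OF assms(1)]])

lemma flow_avg_commute:
  assumes "flow f" "contraction_map g" "r > 0" and "\<And>t. g (f t q) = f t (g q)"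
  shows "g (flow_avg f r q) = flow_avg f r (g q)"
  using flow_avg_move[OF assms(1-3), of q] assms(4) by (simp add: flow_avg_def)

lemma contraction_map_cont: "contraction_map (g::'b::real_normed_vector \<Rightarrow> 'b) \<Longrightarrow> continuous_on S g"
  unfolding continuous_on_iff dist_norm contraction_map_def by (meson order_le_less_trans)

lemma flow_avg_near:
  assumes "flow f" "r > 0" "\<And>t. 0 \<le> t \<Longrightarrow> t \<le> r \<Longrightarrow> norm (f t q - c) \<le> e"
  shows "norm (flow_avg f r q - c) \<le> e"
  unfolding flow_avg_def by (rule integral_avg_bound[OF assms(2) flow_cont[OF assms(1)] assms(3)])

lemma flow_avg_contraction:
  assumes f: "flow f" and r: "r > 0"
  shows "contraction_map (flow_avg f r)"
  unfolding contraction_map_def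
proof (intro conjI allI)
  show "norm (flow_avg f r x - flow_avg f r y) \<le> norm (x - y)" for x y
    unfolding flow_avg_def by (rule integral_avg_close[OF r flow_cont[OF f] flow_cont[OF f]]) (simp add: flow_norm[OF f])
  have lin: "linear (\<lambda>v. f t v - f t 0)" for t by (rule flow_linear_part(2)[OF f])
  have int: "(\<lambda>t. f t v - f t 0) integrable_on {0..r}" for v
    by (intro integrable_continuous_real continuous_intros flow_cont[OF f])
  have eq: "flow_avg f r v - flow_avg f r 0 = (1/r) *\<^sub>R integral {0..r} (\<lambda>t. f t v - f t 0)" for v
    by (simp add: flow_avg_def scaleR_right_diff_distrib integral_diff integrable_continuous_real flow_cont[OF f])
  have "linear (\<lambda>v. (1/r) *\<^sub>R integral {0..r} (\<lambda>t. f t v - f t 0))"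
    by (rule linearI) (simp_all only: linear_add[OF lin] linear_scale[OF lin] integral_add[OF int int] integral_cmul scaleR_add_right,
        simp add: mult.commute)
  then show "affine_map (flow_avg f r)" unfolding affine_map_def eq .
qed

lemma integral_shift_flow:
  fixes f :: "real \<Rightarrow> 'b::banach \<Rightarrow> 'b"
  assumes f: "flow f" and "r > 0" "s \<ge> 0"
  shows "integral {0..r} (\<lambda>t. f (s + t) q) - integral {0..r} (\<lambda>t. f t q) = integral {0..s} (\<lambda>t. f (r + t) q - f t q)"
proof -
  have int: "(\<lambda>t. f t q) integrable_on {a..b}" for a b by (rule integrable_continuous_real[OF flow_cont[OF f]])
  have sh: "integral {0..r} (\<lambda>t. f (s + t) q) = integral {s..s+r} (\<lambda>t. f t q)" for r s
    using integral_shift_Icc_real[of 0 r "\<lambda>t. f t q" s] by (simp add: o_def add.commute)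
  have c1: "integral {0..s} (\<lambda>t. f t q) + integral {s..s+r} (\<lambda>t. f t q) = integral {0..s+r} (\<lambda>t. f t q)"
    by (rule Henstock_Kurzweil_Integration.integral_combine) (use assms int in auto)
  have c2: "integral {0..r} (\<lambda>t. f t q) + integral {r..r+s} (\<lambda>t. f t q) = integral {0..r+s} (\<lambda>t. f t q)"
    by (rule Henstock_Kurzweil_Integration.integral_combine) (use assms int in auto)
  have cont: "continuous_on {0..s} (\<lambda>t. f (r + t) q)"
    by (rule continuous_on_compose2[OF flow_cont[OF f, of UNIV]]) (auto intro!: continuous_intros)
  have "integral {0..s} (\<lambda>t. f (r + t) q - f t q) = integral {r..r+s} (\<lambda>t. f t q) - integral {0..s} (\<lambda>t. f t q)"
    by (subst integral_diff) (auto simp: sh int intro!: integrable_continuous_real[OF cont])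
  moreover have "integral {s..s+r} (\<lambda>t. f t q) = integral {0..s+r} (\<lambda>t. f t q) - integral {0..s} (\<lambda>t. f t q)"
    using c1 by (simp add: eq_diff_eq add.commute)
  moreover have "integral {r..r+s} (\<lambda>t. f t q) = integral {0..s+r} (\<lambda>t. f t q) - integral {0..r} (\<lambda>t. f t q)"
    using c2 by (simp add: eq_diff_eq add.commute)
  ultimately show ?thesis unfolding sh[of r s] by simp
qed

text \<open>Shifting the window by \<open>s\<close> replaces its piece over \<open>[0, s]\<close> by
  that over \<open>[r, r + s]\<close>, and the two differ pointwise by \<open>disp (f r) q\<close>.
  For unipotents this grows only logarithmically in \<open>r\<close>, so long averages are very
  invariant.\<close>

lemma flow_avg_self:
  assumes f: "flow f" and r: "r > 0"
  shows "disp (f s) (flow_avg f r q) \<le> \<bar>s\<bar> / r * disp (f r) q"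
proof -
  have pos: "disp (f s) (flow_avg f r q) \<le> s / r * disp (f r) q" if s: "s \<ge> 0" for s
  proof -
    have "f s (flow_avg f r q) - flow_avg f r q = (1/r) *\<^sub>R (integral {0..r} (\<lambda>t. f (s + t) q) - integral {0..r} (\<lambda>t. f t q))"
      by (simp add: flow_avg_move[OF f flow_contraction[OF f] r] flow_add[OF f] scaleR_right_diff_distrib)
        (simp add: flow_avg_def)
    also have "\<dots> = (1/r) *\<^sub>R integral {0..s} (\<lambda>t. f (r + t) q - f t q)"
      by (simp only: integral_shift_flow[OF f r s])
    finally have eq: "disp (f s) (flow_avg f r q) = norm (integral {0..s} (\<lambda>t. f (r + t) q - f t q)) / r"
      using r by simp
    have cont: "continuous_on {0..s} (\<lambda>t. f (r + t) q)"
      by (rule continuous_on_compose2[OF flow_cont[OF f, of UNIV]]) (auto intro!: continuous_intros)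
    have "norm (f (r + t) q - f t q) = disp (f r) q" for t
      using flow_norm[OF f, of t "f r q" q] by (metis add.commute flow_add f)
    then have "norm (integral {0..s} (\<lambda>t. f (r + t) q - f t q)) \<le> disp (f r) q * (s - 0)"
      by (intro integral_bound) (use s in \<open>auto intro!: continuous_intros cont flow_cont[OF f]\<close>)
    then show ?thesis unfolding eq using r by (simp add: divide_right_mono mult.commute)
  qed
  show ?thesis
  proof (cases "s \<ge> 0")
    case True then show ?thesis using pos by simp
  next
    case False
    then show ?thesis using pos[of "-s"] flow_disp_minus[OF f, of s] by simp
  qed
qed

text \<open>The second half of the window is the first half moved by \<open>f r\<close>. Comparing
  two radii thus becomes a displacement estimate.\<close>

lemma flow_avg_double:
  assumes f: "flow f" and r: "r > 0"
  shows "flow_avg f (2 * r) q = (1 - 1/2) *\<^sub>R flow_avg f r q + (1/2) *\<^sub>R f r (flow_avg f r q)"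
proof -
  have sh: "integral {0..r} (\<lambda>t. f (r + t) q) = integral {r..2*r} (\<lambda>t. f t q)"
    using integral_shift_Icc_real[of 0 r "\<lambda>t. f t q" r] by (simp add: o_def add.commute)
  have "integral {0..r} (\<lambda>t. f t q) + integral {r..2*r} (\<lambda>t. f t q) = integral {0..2*r} (\<lambda>t. f t q)"
    by (rule Henstock_Kurzweil_Integration.integral_combine) (use r integrable_continuous_real[OF flow_cont[OF f]] in auto)
  then show ?thesis using r
    by (simp add: flow_avg_move[OF f flow_contraction[OF f] r] sh flip: flow_add[OF f])
      (simp add: flow_avg_def flip: scaleR_add_right)
qed

text \<open>How near-invariance under \<open>g\<close> survives an average along \<open>f\<close>:
  if \<open>g\<close> carries the orbit of \<open>q\<close> to a reparametrized orbit up to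
  \<open>e\<close>, the average sees only \<open>e\<close> and the distortion of the
  parameter.\<close>

lemma flow_avg_pass:
  assumes f: "flow f" and r: "r > 0" and g: "contraction_map g"
    and psi: "\<And>t. 0 \<le> t \<Longrightarrow> t \<le> r \<Longrightarrow> (\<psi> has_real_derivative \<psi>' t) (at t within {0..r})"
    and psi': "continuous_on {0..r} \<psi>'" and p0: "\<psi> 0 = 0"
    and k: "\<And>t. 0 \<le> t \<Longrightarrow> t \<le> r \<Longrightarrow> \<bar>\<psi>' t - 1\<bar> \<le> \<kappa>" and k1: "\<kappa> \<le> 1"
    and K: "\<And>t. 0 \<le> t \<Longrightarrow> t \<le> 2*r \<Longrightarrow> disp (f t) q \<le> K"
    and e: "\<And>t. 0 \<le> t \<Longrightarrow> t \<le> r \<Longrightarrow> norm (g (f t q) - f (\<psi> t) q) \<le> e"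
  shows "disp g (flow_avg f r q) \<le> e + 2 * \<kappa> * K"
proof -
  have cpsi: "continuous_on {0..r} \<psi>" by (rule DERIV_continuous_on) (use psi in auto)
  have cfp: "continuous_on {0..r} (\<lambda>t. f (\<psi> t) q)"
    by (rule continuous_on_compose2[OF flow_cont[OF f, of UNIV] cpsi]) auto
  have cg: "continuous_on {0..r} (\<lambda>t. g (f t q))"
    by (rule continuous_on_compose2[OF contraction_map_cont[OF g, of UNIV] flow_cont[OF f]]) auto
  have A: "norm (g (flow_avg f r q) - (1/r) *\<^sub>R integral {0..r} (\<lambda>t. f (\<psi> t) q)) \<le> e"
    unfolding flow_avg_move[OF f g r] by (rule integral_avg_close[OF r cg cfp e])
  have B: "norm ((1/r) *\<^sub>R integral {0..r} (\<lambda>t. f (\<psi> t) q) - flow_avg f r q) \<le> 2 * \<kappa> * K"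
    unfolding flow_avg_def by (rule integral_avg_substitution(1)[OF r flow_cont[OF f] psi psi' p0 k k1 K])
  show ?thesis using norm_diff_triangle_le[OF A B] .
qed

lemma flow_avg_pass_id:
  assumes f: "flow f" and r: "r > 0" and g: "contraction_map g"
    and e: "\<And>t. 0 \<le> t \<Longrightarrow> t \<le> r \<Longrightarrow> disp g (f t q) \<le> e"
  shows "disp g (flow_avg f r q) \<le> e"
proof -
  have "continuous_on {0..r} (\<lambda>t. g (f t q))"
    by (rule continuous_on_compose2[OF contraction_map_cont[OF g, of UNIV] flow_cont[OF f]]) auto
  then have "norm ((1/r) *\<^sub>R integral {0..r} (\<lambda>t. g (f t q)) - (1/r) *\<^sub>R integral {0..r} (\<lambda>t. f t q)) \<le> e"
    by (rule integral_avg_close[OF r _ flow_cont[OF f] e])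
  then show ?thesis unfolding flow_avg_move[OF f g r, symmetric] by (simp add: flow_avg_def)
qed

lemma flow_avg_pass_scale:
  assumes f: "flow f" and r: "r > 0" and g: "contraction_map g"
    and l: "\<bar>l - 1\<bar> \<le> 1"
    and K: "\<And>t. 0 \<le> t \<Longrightarrow> t \<le> 2*r \<Longrightarrow> disp (f t) q \<le> K"
    and e: "\<And>t. 0 \<le> t \<Longrightarrow> t \<le> r \<Longrightarrow> norm (g (f t q) - f (l * t) q) \<le> e"
  shows "disp g (flow_avg f r q) \<le> e + 2 * \<bar>l - 1\<bar> * K"
  by (rule flow_avg_pass[OF f r g _ _ _ _ l K e, where \<psi>'="\<lambda>_. l"]) (auto intro!: derivative_eq_intros)

text \<open>The parameter change is the one that appears when opposite unipotents of SL2 are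
  interchanged; its derivative is within \<open>4 * \<bar>s\<bar> * r\<close> of 1.\<close>

lemma flow_avg_pass_moebius:
  assumes f: "flow f" and r: "r > 0" and g: "contraction_map g"
    and s: "\<bar>s\<bar> * r \<le> 1/8"
    and K: "\<And>t. 0 \<le> t \<Longrightarrow> t \<le> 2*r \<Longrightarrow> disp (f t) q \<le> K"
    and e: "\<And>t. 0 \<le> t \<Longrightarrow> t \<le> r \<Longrightarrow> norm (g (f t q) - f (t / (1 + s * t)) q) \<le> e"
  shows "disp g (flow_avg f r q) \<le> e + 8 * (\<bar>s\<bar> * r) * K"
proof -
  have st: "\<bar>s * t\<bar> \<le> \<bar>s\<bar> * r" "\<bar>s * t\<bar> \<le> 1/8" if "0 \<le> t" "t \<le> r" for t
  proof -
    show "\<bar>s * t\<bar> \<le> \<bar>s\<bar> * r" using that by (simp add: abs_mult mult_left_mono)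
    then show "\<bar>s * t\<bar> \<le> 1/8" using s by simp
  qed
  have pos: "1 + s * t > 0" if "0 \<le> t" "t \<le> r" for t using st(2)[OF that] by (auto simp: abs_le_iff)
  have bound: "\<bar>1 / (1 + x)\<^sup>2 - 1\<bar> \<le> 4 * \<bar>x\<bar>" if x: "\<bar>x\<bar> \<le> 1/8" for x :: real
  proof -
    have p: "1 + x \<ge> 7/8" using x by linarith
    have "1 / (1 + x)\<^sup>2 - 1 = - x * (2 + x) / (1 + x)\<^sup>2"
    proof -
      have "1 / (1 + x)\<^sup>2 - 1 = (1 - (1 + x)\<^sup>2) / (1 + x)\<^sup>2" using p by (simp add: diff_divide_distrib)
      moreover have "1 - (1 + x)\<^sup>2 = - x * (2 + x)" by (simp add: power2_eq_square algebra_simps)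
      ultimately show ?thesis by simp
    qed
    then have "\<bar>1 / (1 + x)\<^sup>2 - 1\<bar> = \<bar>x\<bar> * (2 + x) / (1 + x)\<^sup>2"
      using x by (simp add: abs_mult)
    also have "\<dots> \<le> \<bar>x\<bar> * (17/8) / (7/8)\<^sup>2"
      using x p by (intro frac_le mult_left_mono power_mono mult_nonneg_nonneg) auto
    also have "\<dots> \<le> 4 * \<bar>x\<bar>" by (simp add: power2_eq_square)
    finally show ?thesis .
  qed
  have "disp g (flow_avg f r q) \<le> e + 2 * (4 * (\<bar>s\<bar> * r)) * K"
  proof (rule flow_avg_pass[where \<psi>="\<lambda>t. t / (1 + s * t)" and \<psi>'="\<lambda>t. 1 / (1 + s * t)\<^sup>2" and f=f and r=r and g=g, OF f r g _ _ _ _ _ K e])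
    show "((\<lambda>t. t / (1 + s * t)) has_real_derivative 1 / (1 + s * t)\<^sup>2) (at t within {0..r})" if "0 \<le> t" "t \<le> r" for t
      using pos[OF that] by (auto intro!: derivative_eq_intros simp: field_simps power2_eq_square)
    show "continuous_on {0..r} (\<lambda>t. 1 / (1 + s * t)\<^sup>2)"
      using pos by (auto intro!: continuous_intros) (metis less_irrefl)
    show "\<bar>1 / (1 + s * t)\<^sup>2 - 1\<bar> \<le> 4 * (\<bar>s\<bar> * r)" if "0 \<le> t" "t \<le> r" for t
      using bound[OF st(2)[OF that]] st(1)[OF that] by linarith
  qed (use s in auto)
  then show ?thesis by simp
qed

section \<open>Averages that suppress an almost central displacement\<close>

lemma sum_geometric_le:
  fixes P :: real assumes "P \<ge> 2" shows "(\<Sum>k<i. P ^ k) \<le> 2 / P * P ^ i"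
proof (induction i)
  case 0 then show ?case using assms by simp
next
  case (Suc i)
  have "2 / P * P ^ i \<le> P ^ i" using assms by (simp add: field_simps)
  then have "(\<Sum>k<Suc i. P ^ k) \<le> 2 * P ^ i" using Suc by simp
  then show ?case using assms by simp
qed

text \<open>\<open>pure_contraction\<close> is applied to the linear parts, starting from
  \<open>u0 = z \<tau> w - w\<close>. It yields a short iterated average \<open>u\<close> of
  translates of \<open>u0\<close> along \<open>x\<close>, and the average over the much longer
  interval \<open>\<alpha>\<close> hardly distinguishes \<open>u\<close> from \<open>u0\<close>. The
  flow \<open>c\<close> with the parameters \<open>\<kappa>\<close> and \<open>\<mu>\<close> admits
  a correction where the group is Heisenberg only modulo a further subgroup.\<close>

lemma flow_avg_raise:
  fixes x y z c :: "real \<Rightarrow> 'b::banach \<Rightarrow> 'b" and J n :: nat and P \<beta> \<tau> \<alpha> \<delta> e L :: real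
  assumes uc: "clustering TYPE('b) \<delta>" and J: "J \<ge> 1" and P: "P \<ge> 2" and \<beta>: "\<beta> > 0" and tau: "\<tau> > 0" and alpha: "\<alpha> > 0"
    and x: "flow x" and y: "flow y" and z: "flow z" and c: "flow c"
    and yx: "\<And>a b q. y b (x a q) = z (- (a * b)) (x a (c (\<kappa> a b) (y b q)))"
    and zx: "\<And>a s q. z s (x a q) = x a (z s (c (\<mu> a s) q))"
    and yz: "\<And>b s q. y b (z s q) = z s (y b q)" and cz: "\<And>b s q. c b (z s q) = z s (c b q)"
    and Hy: "\<And>i. i < n \<Longrightarrow> disp (y (\<beta> / P ^ i)) w \<le> e"
    and Hc1: "\<And>i a. i < n \<Longrightarrow> 0 \<le> a \<Longrightarrow> a \<le> 2 * J * \<tau> * P ^ i / \<beta> \<Longrightarrow> disp (c (\<kappa> a (\<beta> / P ^ i))) w \<le> e"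
    and Hc2: "\<And>a s. 0 \<le> a \<Longrightarrow> a \<le> 2 * J * \<tau> * P ^ n / (P * \<beta>) \<Longrightarrow> \<bar>s\<bar> \<le> J * \<tau> \<Longrightarrow> disp (c (\<mu> a s)) w \<le> e"
    and Hz: "\<And>s. \<bar>s\<bar> \<le> 2 * J * \<tau> / P \<Longrightarrow> disp (z s) w \<le> e"
    and L: "disp (z (J * \<tau>)) w \<le> L" "disp (z \<tau>) w \<le> L"
  shows "norm (flow_avg x \<alpha> (z \<tau> w) - flow_avg x \<alpha> w)
    \<le> max ((1 - \<delta>) ^ n * L) (40 * e + 10 * L / J) + 4 * J * \<tau> * P ^ n / (P * \<beta> * \<alpha>) * L"
proof -
  have d: "0 < \<delta>" "\<delta> < 1" using uc by (auto simp: clustering_def)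
  define lx ly lz where "lx = (\<lambda>t v. x t v - x t 0)" and "ly = (\<lambda>t v. y t v - y t 0)" and "lz = (\<lambda>t v. z t v - z t 0)"
  note lxf = flow_linear_part[OF x, folded lx_def] and lyf = flow_linear_part[OF y, folded ly_def]
    and lzf = flow_linear_part[OF z, folded lz_def]
  have lin: "linear (lx t)" "linear (ly t)" "linear (lz t)" for t
    unfolding lx_def ly_def lz_def using lxf(2) lyf(2) lzf(2) by auto
  have nrm: "norm (lx t v) = norm v" "norm (ly t v) = norm v" "norm (lz t v) = norm v" for t v
    unfolding lx_def ly_def lz_def using lxf(3) lyf(3) lzf(3) by auto
  have lxd: "lx t u - lx t v = x t u - x t v" "lx t (u - v) = x t u - x t v" for t u v
    using linear_diff[OF flow_linear_part(2)[OF x], of t u v] by (auto simp: lx_def)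
  have lyd: "ly t (u - v) = y t u - y t v" for t u v
    using linear_diff[OF flow_linear_part(2)[OF y], of t u v] by (auto simp: ly_def)
  have lzd: "lz t (u - v) = z t u - z t v" for t u v
    using linear_diff[OF flow_linear_part(2)[OF z], of t u v] by (auto simp: lz_def)
  define u0 where "u0 = z \<tau> w - w"
  \<comment> \<open>The products \<open>a k * b k\<close> are all \<open>\<tau>\<close>, while the
    earlier scales together contribute at most \<open>2 * J / P\<close> times \<open>\<tau>\<close>
    at scale \<open>i\<close>, because \<open>s i\<close> is a geometric sum.\<close>
  define a where "a = (\<lambda>k. \<tau> * P ^ k / \<beta>)"
  define b where "b = (\<lambda>k::nat. \<beta> / P ^ k)"
  define s where "s = (\<lambda>i. \<Sum>k<i. real J * a k)"
  \<comment> \<open>\<open>4 * e\<close> collects errors of \<open>2 * e\<close> at each of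
    \<open>w\<close> and \<open>z \<tau> w\<close>; \<open>L / J\<close> comes from the telescoping
    sum in \<open>H3\<close>.\<close>
  define e' where "e' = 4 * e + L / J"
  have Pp: "P > 0" using P by simp
  have sle: "s i \<le> 2 * J * \<tau> * P ^ i / (P * \<beta>)" for i
  proof -
    have "s i = J * \<tau> / \<beta> * (\<Sum>k<i. P ^ k)" by (simp add: s_def a_def sum_distrib_left sum_divide_distrib mult_ac)
    also have "\<dots> \<le> J * \<tau> / \<beta> * (2 / P * P ^ i)"
      using tau \<beta> by (intro mult_left_mono sum_geometric_le P) auto
    finally show ?thesis by (simp add: mult_ac)
  qed
  have sSuc: "s (Suc i) \<le> 2 * J * \<tau> * P ^ i / \<beta>" for i
    using sle[of "Suc i"] Pp by simp
  have a0: "a k \<ge> 0" for k using tau \<beta> Pp by (simp add: a_def)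
  have e0: "0 \<le> e" using Hz[of 0] tau J Pp by (simp add: flow_0[OF z])
  have L0: "0 \<le> L" using L(2) norm_ge_zero order_trans by blast
  have e'0: "4 * e \<le> e'" using L0 by (simp add: e'_def)
  have lxu: "lx t u0 = x t (z \<tau> w) - x t w" for t by (simp add: u0_def lxd)
  have H1: "norm (ly (b i) (lx t u0) - lz (- (t * b i)) (lx t u0)) \<le> e'"
    if i: "i < n" and t: "0 \<le> t" "t \<le> s (Suc i)" for i t
  proof -
    let ?z = "z (- (t * b i))" and ?y = "y (b i)" and ?c = "c (\<kappa> t (b i))"
    have A: "norm (?c (?y w) - w) \<le> 2 * e"
    proof -
      have "disp ?c w \<le> e" using Hc1[OF i t(1) order_trans[OF t(2) sSuc]] by (simp add: b_def)
      moreover have "disp ?y w \<le> e" using Hy[OF i] by (simp add: b_def)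
      ultimately show ?thesis using disp_comp[of "c (\<kappa> t (b i))" ?y w, OF flow_contraction[OF c]] by simp
    qed
    have B: "norm (?y (x t w) - ?z (x t w)) \<le> 2 * e"
      using A by (simp add: yx flow_norm[OF z] flow_norm[OF x])
    have C: "norm (?y (x t (z \<tau> w)) - ?z (x t (z \<tau> w))) \<le> 2 * e"
      using A by (simp add: yx flow_norm[OF z] flow_norm[OF x] yz cz)
    have "ly (b i) (lx t u0) - lz (- (t * b i)) (lx t u0)
        = (?y (x t (z \<tau> w)) - ?z (x t (z \<tau> w))) - (?y (x t w) - ?z (x t w))"
      by (simp add: lxu lyd lzd algebra_simps)
    also have "norm \<dots> \<le> 2 * e + 2 * e" by (rule order_trans[OF norm_triangle_ineq4 add_mono[OF C B]])
    finally show ?thesis using e'0 by simp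
  qed
  have H2: "disp (lz (- (t * b i))) (lx t' u0) \<le> e'"
    if i: "i < n" and t: "0 \<le> t" "t \<le> s i" and t': "0 \<le> t'" "t' \<le> s n" for i t t'
  proof -
    let ?s = "- (t * b i)" let ?c = "c (\<mu> t' ?s)"
    have bi: "b i > 0" using \<beta> Pp by (simp add: b_def)
    have "t * b i \<le> s i * b i" using t bi by simp
    also have "\<dots> \<le> 2 * J * \<tau> * P ^ i / (P * \<beta>) * b i" by (rule mult_right_mono[OF sle less_imp_le[OF bi]])
    also have "\<dots> = 2 * J * \<tau> / P" using \<beta> Pp by (simp add: b_def)
    finally have s1: "\<bar>?s\<bar> \<le> 2 * J * \<tau> / P" using t bi by simp
    have s2: "\<bar>?s\<bar> \<le> J * \<tau>"
    proof -
      have "2 * J * \<tau> / P \<le> J * \<tau>" using P J tau by (simp add: field_simps)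
      then show ?thesis using s1 by linarith
    qed
    have A: "norm (z ?s (?c w) - w) \<le> 2 * e"
      using disp_comp[of "z ?s" ?c w, OF flow_contraction[OF z]] Hz[OF s1] Hc2[OF t'(1) order_trans[OF t'(2) sle] s2] by simp
    have B: "disp (z ?s) (x t' w) \<le> 2 * e" using A by (simp add: zx flow_norm[OF x])
    have C: "disp (z ?s) (x t' (z \<tau> w)) \<le> 2 * e"
    proof -
      have "z ?s (?c (z \<tau> w)) = z \<tau> (z ?s (?c w))" using cz flow_commute[OF z, of ?s \<tau>] by simp
      then show ?thesis using A by (simp only: zx flow_norm[OF x] flow_norm[OF z])
    qed
    have "lz ?s (lx t' u0) - lx t' u0 = (z ?s (x t' (z \<tau> w)) - x t' (z \<tau> w)) - (z ?s (x t' w) - x t' w)"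
      by (simp add: lxu lzd algebra_simps)
    also have "norm \<dots> \<le> 2 * e + 2 * e" by (rule order_trans[OF norm_triangle_ineq4 add_mono[OF C B]])
    finally show ?thesis using e'0 by simp
  qed
  have H3: "norm (\<Sum>j<J. lz (real j * \<tau>) (lx t u0)) \<le> J * e'" if t: "0 \<le> t" "t \<le> s n" for t
  proof -
    let ?p = "x t w"
    have cw: "disp (c (\<mu> t r)) w \<le> e" if "\<bar>r\<bar> \<le> J * \<tau>" for r using Hc2[OF t(1) order_trans[OF t(2) sle] that] .
    have A: "norm (x t (z \<tau> w) - z \<tau> ?p) \<le> e"
    proof -
      have "z \<tau> ?p = x t (z \<tau> (c (\<mu> t \<tau>) w))" by (rule zx)
      then have "norm (x t (z \<tau> w) - z \<tau> ?p) = disp (c (\<mu> t \<tau>)) w" by (simp add: flow_norm[OF x] flow_norm[OF z] norm_minus_commute)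
      then show ?thesis using cw[of \<tau>] tau J by simp
    qed
    have B: "disp (z (J * \<tau>)) ?p \<le> L + e"
    proof -
      have "disp (z (J * \<tau>)) ?p = norm (z (J * \<tau>) (c (\<mu> t (J * \<tau>)) w) - w)" by (simp add: zx flow_norm[OF x])
      also have "\<dots> \<le> L + e" using disp_comp[of "z (J * \<tau>)" "c (\<mu> t (J * \<tau>))" w, OF flow_contraction[OF z]] L(1) cw[of "J * \<tau>"] tau by simp
      finally show ?thesis .
    qed
    \<comment> \<open>Up to the error in \<open>A\<close> the sum over \<open>j\<close> telescopes
      to one displacement by \<open>z (J * \<tau>)\<close>. Dividing it by \<open>J\<close> is the
      gain.\<close>
    have "lz (real j * \<tau>) (lx t u0) = (z (real j * \<tau>) (x t (z \<tau> w)) - z (real j * \<tau>) (z \<tau> ?p)) + (z (real (Suc j) * \<tau>) ?p - z (real j * \<tau>) ?p)" for j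
    proof -
      have "z (real (Suc j) * \<tau>) ?p = z (real j * \<tau>) (z \<tau> ?p)" by (simp add: algebra_simps flip: flow_add[OF z])
      then show ?thesis by (simp add: lxu lzd)
    qed
    then have "(\<Sum>j<J. lz (real j * \<tau>) (lx t u0)) = (\<Sum>j<J. z (real j * \<tau>) (x t (z \<tau> w)) - z (real j * \<tau>) (z \<tau> ?p)) + (z (J * \<tau>) ?p - ?p)"
      by (simp add: sum.distrib sum_lessThan_telescope[of "\<lambda>j. z (real j * \<tau>) ?p"] flow_0[OF z] del: of_nat_Suc)
    also have "norm \<dots> \<le> (\<Sum>j<J. e) + (L + e)"
      by (intro norm_triangle_le add_mono B order_trans[OF norm_sum] sum_mono) (simp add: flow_norm[OF z] A)
    also have "\<dots> \<le> J * e'"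
    proof -
      have "e \<le> J * e" using J e0 mult_right_mono[of 1 "real J" e] by simp
      moreover have "J * e' = 4 * (J * e) + L" using J by (simp add: e'_def algebra_simps)
      moreover have "0 \<le> J * e" using e0 by simp
      ultimately show ?thesis by (simp add: mult.commute)
    qed
    finally show ?thesis .
  qed
  obtain u where u1: "\<And>F c r. linear F \<Longrightarrow> (\<And>c'. 0 \<le> c' \<Longrightarrow> c' \<le> s n \<Longrightarrow> norm (F (lx c' u0) - c) \<le> r) \<Longrightarrow> norm (F u - (c::'b)) \<le> r"
    and u2: "norm u \<le> max ((1 - \<delta>) ^ n * norm u0) (10 * e')"
  proof -
    have "\<exists>u. (\<forall>F c r. linear F \<longrightarrow> (\<forall>c'. 0 \<le> c' \<longrightarrow> c' \<le> s n \<longrightarrow> norm (F (lx c' u0) - c) \<le> r) \<longrightarrow> norm (F u - (c::'b)) \<le> r)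
       \<and> norm u \<le> max ((1 - \<delta>) ^ n * norm u0) (10 * e')"
      unfolding s_def
    proof (rule pure_contraction[where y=ly and z=lz and b=b and \<tau>=\<tau>])
      show "a i * b i = \<tau>" for i using \<beta> Pp by (simp add: a_def b_def)
    qed (use uc J lin nrm flow_add[OF lxf(1)] flow_add[OF lzf(1)] a0 H1 H2 H3 in \<open>simp_all add: s_def\<close>)
    then show ?thesis using that by blast
  qed
  have nu0: "norm u0 \<le> L" using L(2) by (simp add: u0_def)
  let ?X = "flow_avg lx \<alpha>"
  have Xc: "contraction_map ?X" by (rule flow_avg_contraction[OF lxf(1) alpha])
  have X0: "?X 0 = 0" by (simp add: flow_avg_def lx_def)
  have Xl: "linear ?X" using Xc X0 by (simp add: contraction_map_def affine_map_def)
  have XX: "?X u0 = flow_avg x \<alpha> (z \<tau> w) - flow_avg x \<alpha> w"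
  proof -
    have "integral {0..\<alpha>} (\<lambda>t. lx t u0) = integral {0..\<alpha>} (\<lambda>t. x t (z \<tau> w)) - integral {0..\<alpha>} (\<lambda>t. x t w)"
      unfolding lxu by (intro integral_diff integrable_continuous_real flow_cont[OF x])
    then show ?thesis by (simp add: flow_avg_def scaleR_right_diff_distrib)
  qed
  \<comment> \<open>By \<open>u1\<close> it suffices to test translates \<open>lx c' u0\<close>, and
    for these \<open>flow_avg_self\<close> gives the factor \<open>c' / \<alpha>\<close>.\<close>
  have "norm (?X u - ?X u0) \<le> s n / \<alpha> * (2 * L)"
  proof (rule u1[OF Xl])
    fix c' assume c': "0 \<le> c'" "c' \<le> s n"
    have "?X (lx c' u0) = lx c' (?X u0)"
      by (rule flow_avg_commute[OF lxf(1) flow_contraction[OF lxf(1)] alpha, symmetric]) (rule flow_commute[OF lxf(1)])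
    then have "norm (?X (lx c' u0) - ?X u0) \<le> \<bar>c'\<bar> / \<alpha> * disp (lx \<alpha>) u0"
      using flow_avg_self[OF lxf(1) alpha, of c' u0] by simp
    also have "\<dots> \<le> s n / \<alpha> * (2 * L)"
    proof (intro mult_mono divide_right_mono)
      show "disp (lx \<alpha>) u0 \<le> 2 * L" using norm_triangle_ineq4[of "lx \<alpha> u0" u0] nrm(1)[of \<alpha> u0] nu0 by simp
    qed (use c' alpha in auto)
    finally show "norm (?X (lx c' u0) - ?X u0) \<le> s n / \<alpha> * (2 * L)" .
  qed
  moreover have "norm (?X u) \<le> norm u" using contraction_map_norm[OF Xc, of u 0] X0 by simp
  moreover have "norm (?X u0) \<le> norm (?X u) + norm (?X u - ?X u0)" using norm_triangle_ineq4[of "?X u" "?X u - ?X u0"] by simp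
  moreover have "s n / \<alpha> * (2 * L) \<le> 4 * J * \<tau> * P ^ n / (P * \<beta> * \<alpha>) * L"
  proof -
    have "s n / \<alpha> * (2 * L) \<le> (2 * J * \<tau> * P ^ n / (P * \<beta>)) / \<alpha> * (2 * L)"
      using sle[of n] alpha L0 by (intro mult_right_mono divide_right_mono) auto
    then show ?thesis by (simp add: mult_ac)
  qed
  moreover have "norm u \<le> max ((1 - \<delta>) ^ n * L) (40 * e + 10 * L / J)"
  proof -
    have "(1 - \<delta>) ^ n * norm u0 \<le> (1 - \<delta>) ^ n * L" using nu0 d by (intro mult_left_mono) auto
    then show ?thesis using u2 by (auto simp: e'_def)
  qed
  ultimately show ?thesis unfolding XX by linarith
qed

section \<open>Actions of the root subgroups\<close>

text \<open>The roots are numbered cyclically: \<open>2\<alpha>\<close>, \<open>\<alpha>+\<beta>\<close>, \<open>2\<beta>\<close>, \<open>\<beta>-\<alpha>\<close> are 0, 1, 2, 3, and \<open>i + 4\<close> is the negative of \<open>i\<close>.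
  The torus flows \<open>T0\<close> and \<open>T3\<close> belong to the coroots of 0 and 3, and \<open>weight0 i\<close>, \<open>weight3 i\<close> are the pairings with the root \<open>i\<close>.\<close>

definition weight0 :: "nat \<Rightarrow> real" where "weight0 i = [2, 1, 0, -1, -2, -1, 0, 1] ! i"
definition weight3 :: "nat \<Rightarrow> real" where "weight3 i = [-2, 0, 2, 2, 2, 0, -2, -2] ! i"

lemma less_8_cases: "i < (8::nat) \<longleftrightarrow> i \<in> {0,1,2,3,4,5,6,7}" by auto

lemma weight_bound: assumes "i < 8" shows "\<bar>weight0 i\<bar> \<le> 2" "\<bar>weight3 i\<bar> \<le> 2"
  using assms by (auto simp: less_8_cases weight0_def weight3_def)

text \<open>Pairs of distinct roots whose sum is neither 0 nor a root; a selection of them, each in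
  both orders.\<close>

definition commuting_roots :: "(nat \<times> nat) set" where
  "commuting_roots = {(0,1),(0,2),(1,2),(0,7),(0,6),(6,7),(3,4),(4,5),(4,6),(5,6),
     (1,0),(2,0),(2,1),(7,0),(6,0),(7,6),(4,3),(5,4),(6,4),(6,5)}"

declare One_nat_def [simp del]

text \<open>\<open>mob04\<close> and \<open>mob37\<close> are the Gauss decomposition in the SL2 of
  a root and its opposite, on the range where the torus factor has a real logarithm. The facts
  \<open>r72\<close> to \<open>r74\<close> are commutator formulas, named by the numbers of their
  two roots.\<close>

locale root_flows =
  fixes U :: "nat \<Rightarrow> real \<Rightarrow> 'b::banach \<Rightarrow> 'b" and T0 T3 :: "real \<Rightarrow> 'b \<Rightarrow> 'b"
  assumes flowU: "i < 8 \<Longrightarrow> flow (U i)" and flowT0: "flow T0" and flowT3: "flow T3"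
    and T0T3: "T0 a (T3 b q) = T3 b (T0 a q)"
    and T0U: "i < 8 \<Longrightarrow> T0 a (U i t q) = U i (exp (weight0 i * a) * t) (T0 a q)"
    and T3U: "i < 8 \<Longrightarrow> T3 a (U i t q) = U i (exp (weight3 i * a) * t) (T3 a q)"
    and comm: "(i, j) \<in> commuting_roots \<Longrightarrow> U i s (U j t q) = U j t (U i s q)"
    and mob04: "1 + s * c > 0 \<Longrightarrow> U 0 s (U 4 c q) = U 4 (c / (1 + s * c)) (T0 (ln (1 + s * c)) (U 0 (s / (1 + s * c)) q))"
    and mob37: "1 + s * c > 0 \<Longrightarrow> U 3 s (U 7 c q) = U 7 (c / (1 + s * c)) (T3 (ln (1 + s * c)) (U 3 (s / (1 + s * c)) q))"
    and r72: "U 7 t (U 2 c q) = U 2 c (U 1 (t * c) (U 0 (t\<^sup>2 * c) (U 7 t q)))"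
    and r71: "U 7 t (U 1 c q) = U 1 c (U 0 (2 * t * c) (U 7 t q))"
    and r03: "U 0 s (U 3 c q) = U 3 c (U 0 s (U 1 (- (s * c)) (U 2 (s * c\<^sup>2) q)))"
    and r05: "U 0 s (U 5 c q) = U 5 c (U 6 (- (s * c\<^sup>2)) (U 7 (s * c) (U 0 s q)))"
    and r36: "U 3 t (U 6 c q) = U 6 c (U 5 (- (t * c)) (U 4 (t\<^sup>2 * c) (U 3 t q)))"
    and r35: "U 3 t (U 5 c q) = U 5 c (U 4 (- (2 * t * c)) (U 3 t q))"
    and r75: "U 7 t (U 5 c q) = U 5 c (U 6 (- (2 * t * c)) (U 7 t q))"
    and r74: "U 7 t (U 4 c q) = U 4 c (U 5 (- (t * c)) (U 6 (t\<^sup>2 * c) (U 7 t q)))"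
begin

lemma inv: assumes "i < 8" shows "U i (- t) (U i t q) = q" "U i t (U i (- t) q) = q"
  using flow_inverse[OF flowU[OF assms]] by auto

lemma U_norm: "i < 8 \<Longrightarrow> norm (U i t x - U i t y) = norm (x - y)" by (rule flow_norm[OF flowU])

lemma contr: "i < 8 \<Longrightarrow> contraction_map (U i t)" by (rule flow_contraction[OF flowU])

lemma U_zero: "i < 8 \<Longrightarrow> U i 0 q = q" by (rule flow_0[OF flowU])

text \<open>Inverting both sides of \<open>mob37\<close> at \<open>- c\<close> and
  \<open>- s\<close> exchanges the roles of the two opposite roots.\<close>

lemma mob73:
  assumes "1 + s * c > 0"
  shows "U 7 s (U 3 c q) = U 3 (c / (1 + s * c)) (T3 (- ln (1 + s * c)) (U 7 (s / (1 + s * c)) q))"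
proof -
  let ?R = "U 3 (c / (1 + s * c)) (T3 (- ln (1 + s * c)) (U 7 (s / (1 + s * c)) q))"
  have "U 3 (- c) (U 7 (- s) ?R) = U 7 (- (s / (1 + s * c))) (T3 (ln (1 + s * c)) (U 3 (- (c / (1 + s * c))) ?R))"
    using mob37[of "-c" "-s"] assms by (simp add: mult.commute)
  also have "\<dots> = q" by (simp add: inv flow_inverse[OF flowT3])
  finally have "U 7 (- s) ?R = U 3 c q" using inv(2)[of 3 c "U 7 (- s) ?R"] by simp
  then show ?thesis using inv(2)[of 7 s ?R] by simp
qed

lemma r57: "U 5 c (U 7 a p) = U 7 a (U 5 c (U 6 (2 * a * c) p))"
  using r75[of "-a" c "U 7 a p"] inv(1)[of 7 a p] inv(2)[of 7 a "U 5 c (U 7 a p)"] by simp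

lemma r47: "U 4 c (U 7 a p) = U 7 a (U 4 c (U 5 (a * c) (U 6 (a\<^sup>2 * c) p)))"
  using r74[of "-a" c "U 7 a p"] inv(1)[of 7 a p] inv(2)[of 7 a "U 4 c (U 7 a p)"] by simp

abbreviation "A i r \<equiv> flow_avg (U i) r"

lemma A_contr: "i < 8 \<Longrightarrow> r > 0 \<Longrightarrow> contraction_map (A i r)" by (rule flow_avg_contraction[OF flowU])

lemma disp2: "i < 8 \<Longrightarrow> norm (U i s (h q) - q) \<le> disp (U i s) q + disp h q"
  by (rule disp_comp[OF contr])

lemma disp3:
  "i < 8 \<Longrightarrow> j < 8 \<Longrightarrow> norm (U i s (U j t (h q)) - q) \<le> disp (U i s) q + (disp (U j t) q + disp h q)"
  using disp2[of i s "\<lambda>p. U j t (h p)" q] disp2[of j t h q] by simp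

lemma commuting_less: "(i, j) \<in> commuting_roots \<Longrightarrow> i < 8 \<and> j < 8"
  by (auto simp: commuting_roots_def)

lemma disp_A_commute:
  assumes "(i, j) \<in> commuting_roots" "r > 0"
  shows "disp (U i s) (A j r q) \<le> disp (U i s) q"
proof -
  have ij: "i < 8" "j < 8" using commuting_less assms by auto
  have "U i s (A j r q) = A j r (U i s q)"
    by (rule flow_avg_commute[OF flowU contr]) (use assms comm ij in auto)
  then show ?thesis using contraction_map_norm[OF A_contr[OF ij(2) assms(2)]] by simp
qed

lemma disp_A_self: "i < 8 \<Longrightarrow> r > 0 \<Longrightarrow> disp (U i r) q \<le> L \<Longrightarrow> disp (U i s) (A i r q) \<le> \<bar>s\<bar> / r * L"
  by (rule order_trans[OF flow_avg_self[OF flowU] mult_left_mono]) auto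

lemma A_commute:
  assumes "(i, j) \<in> commuting_roots" "r > 0" "r' > 0"
  shows "A i r (A j r' q) = A j r' (A i r q)"
proof -
  have ij: "i < 8" "j < 8" using commuting_less assms by auto
  have "A j r' (A i r q) = A i r (A j r' q)"
  proof (rule flow_avg_commute[OF flowU A_contr])
    show "A j r' (U i t q) = U i t (A j r' q)" for t
      by (rule flow_avg_commute[OF flowU contr, symmetric]) (use assms ij comm in auto)
  qed (use assms ij in auto)
  then show ?thesis by simp
qed

end

section \<open>Displacement bounds near the starting point\<close>

lemma exp_minus_one_bound: assumes "\<bar>x\<bar> \<le> (1::real)" shows "\<bar>exp x - 1\<bar> \<le> 2 * \<bar>x\<bar>"
proof (cases "x \<ge> 0")
  case True
  have "exp x \<le> 1 + x + x\<^sup>2" by (rule exp_bound) (use True assms in auto)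
  moreover have "x\<^sup>2 \<le> x" using True assms by (simp add: power2_eq_square mult_left_le)
  ultimately show ?thesis using True by simp
next
  case False
  then have "exp x \<le> 1" by simp
  then show ?thesis using False exp_ge_add_one_self[of x] by linarith
qed

lemma ln_one_plus_bound: assumes "\<bar>x\<bar> \<le> (1/2::real)" shows "\<bar>ln (1 + x)\<bar> \<le> 2 * \<bar>x\<bar>"
proof (cases "x \<ge> 0")
  case True
  then show ?thesis using ln_add_one_self_le_self[of x] by simp
next
  case False
  then have p: "1 + x > 0" using assms by linarith
  have "- ln (1 + x) = ln (1 / (1 + x))" using p by (simp add: ln_div)
  also have "\<dots> \<le> 1 / (1 + x) - 1" using p by (intro ln_le_minus_one) auto
  also have "\<dots> = - x / (1 + x)" using p by (simp add: field_simps)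
  also have "\<dots> \<le> - x / (1/2)" using False assms by (intro divide_left_mono) auto
  finally have "- ln (1 + x) \<le> 2 * \<bar>x\<bar>" using False by simp
  moreover have "ln (1 + x) \<le> 0" using False p by simp
  ultimately show ?thesis by simp
qed

text \<open>\<open>L = 31 * l\<close> bounds displacements at all points within
  \<open>15 * l\<close> of \<open>\<eta>\<close>: a displacement grows by at most twice the distance
  between the points.\<close>

locale root_flows_at = root_flows U T0 T3
  for U :: "nat \<Rightarrow> real \<Rightarrow> 'b::banach \<Rightarrow> 'b" and T0 T3 :: "real \<Rightarrow> 'b \<Rightarrow> 'b" +
  fixes \<eta> :: 'b and l M L :: real
  assumes boundU: "i < 8 \<Longrightarrow> \<bar>t\<bar> \<le> M \<Longrightarrow> disp (U i t) \<eta> \<le> l"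
    and boundT0: "\<bar>t\<bar> \<le> 1 \<Longrightarrow> disp (T0 t) \<eta> \<le> l"
    and boundT3: "\<bar>t\<bar> \<le> 1 \<Longrightarrow> disp (T3 t) \<eta> \<le> l"
    and L: "L = 31 * l" and M: "M \<ge> 1"
begin

text \<open>Distances are counted in units of \<open>l\<close>, since each average along a flow
  whose displacements are at most \<open>l\<close> costs one unit.\<close>

definition near :: "real \<Rightarrow> 'b \<Rightarrow> bool" where "near k q \<longleftrightarrow> norm (q - \<eta>) \<le> k * l"

lemma l0: "0 \<le> l" using order_trans[OF norm_ge_zero boundU[of 0 0]] M by simp
lemma L0: "0 \<le> L" using l0 L by simp

lemma near_flow_avg:
  assumes f: "flow f" and r: "r > 0" and b: "\<And>t. 0 \<le> t \<Longrightarrow> t \<le> r \<Longrightarrow> disp (f t) \<eta> \<le> l" and q: "near k q"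
  shows "near (k + 1) (flow_avg f r q)"
  unfolding near_def
proof (rule flow_avg_near[OF f r])
  fix t assume t: "0 \<le> t" "t \<le> r"
  have "norm (f t q - \<eta>) \<le> norm (f t q - f t \<eta>) + disp (f t) \<eta>" by (metis norm_diff_triangle_le order_refl)
  then show "norm (f t q - \<eta>) \<le> (k + 1) * l" using b[OF t] q by (simp add: near_def flow_norm[OF f] algebra_simps)
qed

lemma near_A: "i < 8 \<Longrightarrow> r > 0 \<Longrightarrow> r \<le> M \<Longrightarrow> near k q \<Longrightarrow> near (k + 1) (A i r q)"
  by (rule near_flow_avg[OF flowU]) (auto intro: boundU)

lemma near_mono: "near k q \<Longrightarrow> k \<le> k' \<Longrightarrow> near k' q"
  unfolding near_def using l0 mult_right_mono order_trans by blast

lemma near_disp: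
  assumes "near 15 q" shows "i < 8 \<Longrightarrow> \<bar>t\<bar> \<le> M \<Longrightarrow> disp (U i t) q \<le> L"
    "\<bar>t\<bar> \<le> 1 \<Longrightarrow> disp (T0 t) q \<le> L" "\<bar>t\<bar> \<le> 1 \<Longrightarrow> disp (T3 t) q \<le> L"
proof -
  have n: "norm (q - \<eta>) \<le> 15 * l" using assms by (simp add: near_def)
  have *: "disp g q \<le> L" if "contraction_map g" "disp g \<eta> \<le> l" for g
    using disp_near[OF that(1), of q \<eta>] that(2) n L by simp
  show "i < 8 \<Longrightarrow> \<bar>t\<bar> \<le> M \<Longrightarrow> disp (U i t) q \<le> L" by (intro * contr boundU)
  show "\<bar>t\<bar> \<le> 1 \<Longrightarrow> disp (T0 t) q \<le> L" by (intro * flow_contraction[OF flowT0] boundT0)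
  show "\<bar>t\<bar> \<le> 1 \<Longrightarrow> disp (T3 t) q \<le> L" by (intro * flow_contraction[OF flowT3] boundT3)
qed

text \<open>A torus element normalizes the root subgroup and rescales its parameter by
  \<open>exp (k * t)\<close> with \<open>\<bar>k\<bar> \<le> 2\<close>, so the loss is linear in
  \<open>t\<close>.\<close>

lemma disp_torus_A:
  assumes i: "i < 8" and r: "r > 0" "2 * r \<le> M" and q: "near 15 q" and t: "\<bar>t\<bar> \<le> 1/4"
  shows "disp (T0 t) (A i r q) \<le> disp (T0 t) q + 8 * \<bar>t\<bar> * L"
    "disp (T3 t) (A i r q) \<le> disp (T3 t) q + 8 * \<bar>t\<bar> * L"
proof -
  have *: "disp (T t) (A i r q) \<le> disp (T t) q + 8 * \<bar>t\<bar> * L"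
    if T: "flow T" and TU: "\<And>u q. T t (U i u q) = U i (exp (k * t) * u) (T t q)" and k: "\<bar>k\<bar> \<le> 2" for T :: "real \<Rightarrow> 'b \<Rightarrow> 'b" and k
  proof -
    have kt: "\<bar>k * t\<bar> \<le> 2 * \<bar>t\<bar>" using k by (simp add: abs_mult mult_right_mono)
    then have e: "\<bar>exp (k * t) - 1\<bar> \<le> 4 * \<bar>t\<bar>" using exp_minus_one_bound[of "k * t"] t by simp
    have "disp (T t) (A i r q) \<le> disp (T t) q + 2 * \<bar>exp (k * t) - 1\<bar> * L"
    proof (rule flow_avg_pass_scale[OF flowU[OF i] r(1) flow_contraction[OF T]])
      show "\<bar>exp (k * t) - 1\<bar> \<le> 1" using e t by linarith
      show "disp (U i u) q \<le> L" if "0 \<le> u" "u \<le> 2 * r" for u by (rule near_disp(1)[OF q i]) (use that r in auto)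
      show "norm (T t (U i u q) - U i (exp (k * t) * u) q) \<le> disp (T t) q" for u by (simp add: TU U_norm[OF i])
    qed
    also have "2 * \<bar>exp (k * t) - 1\<bar> * L \<le> 2 * (4 * \<bar>t\<bar>) * L" using e L0 by (intro mult_right_mono) auto
    finally show ?thesis by simp
  qed
  show "disp (T0 t) (A i r q) \<le> disp (T0 t) q + 8 * \<bar>t\<bar> * L"
    by (rule *[OF flowT0 T0U[OF i] weight_bound(1)[OF i]])
  show "disp (T3 t) (A i r q) \<le> disp (T3 t) q + 8 * \<bar>t\<bar> * L"
    by (rule *[OF flowT3 T3U[OF i] weight_bound(2)[OF i]])
qed

end

section \<open>The iterated average and its near-invariance\<close>

locale root_flows_chain = root_flows_at U T0 T3 \<eta> l M L
  for U :: "nat \<Rightarrow> real \<Rightarrow> 'b::banach \<Rightarrow> 'b" and T0 T3 :: "real \<Rightarrow> 'b \<Rightarrow> 'b" and \<eta> :: 'b and l M L :: real +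
  fixes \<sigma> \<Theta> :: real
  assumes sg: "\<sigma> \<ge> 1" "2 * \<sigma> \<le> M" and Th: "\<Theta> \<ge> 1" "2 * \<Theta> \<le> M"
begin

text \<open>The order decides which relations apply. Roots 0, 1, 2 commute with each other, as do 4,
  5, 6, while 3 and 7 normalize both families. The tori, root 7 with radius 1 and the roots 0, 1, 2
  come innermost: their near-invariance absorbs what is produced when \<open>U 0\<close> and
  \<open>U 7\<close> later pass the averages along 3, 4 and 5. Only the radii on 4, 5, 6 vary;
  \<open>v\<close> stays fixed.\<close>

definition "q0 = flow_avg T0 1 (flow_avg T3 1 \<eta>)"
definition "q1 = A 7 1 q0"
definition "q2 = A 0 \<Theta> q1"
definition "q3 = A 1 \<Theta> q2"
definition "w = A 2 \<Theta> q3"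
definition "v = A 3 \<sigma> w"
definition "neg_box r4 r5 r6 = A 4 r4 (A 5 r5 (A 6 r6 v))"
definition "xi r4 r5 r6 = A 7 \<sigma> (neg_box r4 r5 r6)"

lemma pos: "\<sigma> > 0" "\<Theta> > 0" "M > 0" "\<sigma> \<le> M" "\<Theta> \<le> M" using sg Th M by auto

lemma near_q: "near 2 q0" "near 3 q1" "near 4 q2" "near 5 q3" "near 6 w" "near 7 v"
proof -
  have "near 0 \<eta>" by (simp add: near_def)
  then have "near (0 + 1) (flow_avg T3 1 \<eta>)" by (intro near_flow_avg[OF flowT3] boundT3) auto
  then have "near (0 + 1 + 1) q0" unfolding q0_def by (intro near_flow_avg[OF flowT0] boundT0) auto
  then show 0: "near 2 q0" by simp
  show 1: "near 3 q1" unfolding q1_def using near_A[OF _ _ _ 0, of 7 1] M by simp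
  show 2: "near 4 q2" unfolding q2_def using near_A[OF _ _ _ 1, of 0 \<Theta>] pos by simp
  show 3: "near 5 q3" unfolding q3_def using near_A[OF _ _ _ 2, of 1 \<Theta>] pos by simp
  show 4: "near 6 w" unfolding w_def using near_A[OF _ _ _ 3, of 2 \<Theta>] pos by simp
  show "near 7 v" unfolding v_def using near_A[OF _ _ _ 4, of 3 \<sigma>] pos by simp
qed

lemma near15: "near 15 q0" "near 15 q1" "near 15 q2" "near 15 q3" "near 15 w" "near 15 v"
  using near_q[THEN near_mono, of 15] by auto

lemma disp_q1_7: "disp (U 7 t) q1 \<le> \<bar>t\<bar> * L"
  unfolding q1_def using disp_A_self[of 7 1 q0 L t] near_disp(1)[OF near15(1)] M by simp

lemma disp_q2_0: "disp (U 0 s) q2 \<le> \<bar>s\<bar> / \<Theta> * L"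
  unfolding q2_def by (rule disp_A_self) (use near_disp(1)[OF near15(2)] pos in auto)

lemma disp_q2_7: "disp (U 7 t) q2 \<le> \<bar>t\<bar> * L"
  unfolding q2_def by (rule order_trans[OF disp_A_commute disp_q1_7]) (use pos in \<open>auto simp: commuting_roots_def\<close>)

lemma disp_q3_0: "disp (U 0 s) q3 \<le> \<bar>s\<bar> / \<Theta> * L"
  unfolding q3_def by (rule order_trans[OF disp_A_commute disp_q2_0]) (use pos in \<open>auto simp: commuting_roots_def\<close>)

lemma disp_q3_1: "disp (U 1 s) q3 \<le> \<bar>s\<bar> / \<Theta> * L"
  unfolding q3_def by (rule disp_A_self) (use near_disp(1)[OF near15(3)] pos in auto)

lemma scaled_bound: assumes "\<bar>s\<bar> \<le> c * d" "d > 0" shows "\<bar>s\<bar> / d * L \<le> c * L"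
  using assms L0 by (intro mult_right_mono) (auto simp: pos_divide_le_eq)

text \<open>Passing \<open>U 1 c\<close> produces \<open>U 0\<close> with a parameter up to
  \<open>2 * \<bar>t\<bar> * \<Theta>\<close>; since \<open>q2\<close> is an average over length
  \<open>\<Theta>\<close>, this moves it by at most \<open>2 * \<bar>t\<bar> * L\<close>.\<close>

lemma disp_q3_7: "disp (U 7 t) q3 \<le> 3 * \<bar>t\<bar> * L"
  unfolding q3_def
proof (rule flow_avg_pass_id[OF flowU pos(2) contr])
  fix c assume c: "0 \<le> c" "c \<le> \<Theta>"
  have "disp (U 7 t) (U 1 c q2) = norm (U 0 (2 * t * c) (U 7 t q2) - q2)"
    by (simp add: r71 U_norm)
  also have "\<dots> \<le> disp (U 0 (2 * t * c)) q2 + disp (U 7 t) q2" by (rule disp2) auto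
  also have "\<dots> \<le> 2 * \<bar>t\<bar> * L + \<bar>t\<bar> * L"
    by (intro add_mono disp_q2_7 order_trans[OF disp_q2_0] scaled_bound)
      (use c pos in \<open>auto simp: abs_mult mult_left_mono\<close>)
  finally show "disp (U 7 t) (U 1 c q2) \<le> 3 * \<bar>t\<bar> * L" by (simp add: mult_ac)
qed auto

lemma disp_w: "disp (U 0 s) w \<le> \<bar>s\<bar> / \<Theta> * L" "disp (U 1 s) w \<le> \<bar>s\<bar> / \<Theta> * L"
    "disp (U 2 s) w \<le> \<bar>s\<bar> / \<Theta> * L"
proof -
  show "disp (U 0 s) w \<le> \<bar>s\<bar> / \<Theta> * L"
    unfolding w_def by (rule order_trans[OF disp_A_commute disp_q3_0]) (use pos in \<open>auto simp: commuting_roots_def\<close>)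
  show "disp (U 1 s) w \<le> \<bar>s\<bar> / \<Theta> * L"
    unfolding w_def by (rule order_trans[OF disp_A_commute disp_q3_1]) (use pos in \<open>auto simp: commuting_roots_def\<close>)
  show "disp (U 2 s) w \<le> \<bar>s\<bar> / \<Theta> * L"
    unfolding w_def by (rule disp_A_self) (use near_disp(1)[OF near15(4)] pos in auto)
qed

lemma disp_w_7: assumes t: "\<bar>t\<bar> \<le> 1" shows "disp (U 7 t) w \<le> 5 * \<bar>t\<bar> * L"
  unfolding w_def
proof (rule flow_avg_pass_id[OF flowU pos(2) contr])
  fix c assume c: "0 \<le> c" "c \<le> \<Theta>"
  have "disp (U 7 t) (U 2 c q3) = norm (U 1 (t * c) (U 0 (t\<^sup>2 * c) (U 7 t q3)) - q3)"
    by (simp add: r72 U_norm)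
  also have "\<dots> \<le> disp (U 1 (t * c)) q3 + (disp (U 0 (t\<^sup>2 * c)) q3 + disp (U 7 t) q3)" by (rule disp3) auto
  also have "\<dots> \<le> \<bar>t\<bar> * L + (\<bar>t\<bar> * L + 3 * \<bar>t\<bar> * L)"
  proof (intro add_mono disp_q3_7 order_trans[OF disp_q3_0] order_trans[OF disp_q3_1] scaled_bound)
    show "\<bar>t * c\<bar> \<le> \<bar>t\<bar> * \<Theta>" using c by (simp add: abs_mult mult_left_mono)
    have "\<bar>t\<bar> * \<bar>t\<bar> * c \<le> \<bar>t\<bar> * 1 * \<Theta>" using c t by (intro mult_mono) auto
    then show "\<bar>t\<^sup>2 * c\<bar> \<le> \<bar>t\<bar> * \<Theta>" using c by (simp add: abs_mult power2_eq_square)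
  qed (use pos in auto)
  finally show "disp (U 7 t) (U 2 c q3) \<le> 5 * \<bar>t\<bar> * L" by (simp add: mult_ac)
qed auto

lemma disp_q0_torus: "disp (T0 t) q0 \<le> \<bar>t\<bar> * L" "disp (T3 t) q0 \<le> \<bar>t\<bar> * L"
proof -
  have e: "near 15 \<eta>" using l0 by (simp add: near_def)
  have n: "near 15 (flow_avg T3 1 \<eta>)"
    using near_flow_avg[OF flowT3, of 1 14 \<eta>] boundT3 l0 by (simp add: near_def)
  show "disp (T0 t) q0 \<le> \<bar>t\<bar> * L"
    unfolding q0_def
    by (rule order_trans[OF flow_avg_self[OF flowT0]]) (use near_disp(2)[OF n, of 1] in \<open>auto intro: mult_left_mono\<close>)
  have "T3 t (flow_avg T0 1 (flow_avg T3 1 \<eta>)) = flow_avg T0 1 (T3 t (flow_avg T3 1 \<eta>))"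
    by (rule flow_avg_commute[OF flowT0 flow_contraction[OF flowT3]]) (auto simp: T0T3)
  then have "disp (T3 t) q0 \<le> disp (T3 t) (flow_avg T3 1 \<eta>)"
    unfolding q0_def using contraction_map_norm[OF flow_avg_contraction[OF flowT0, of 1]] by simp
  also have "\<dots> \<le> \<bar>t\<bar> * L"
    by (rule order_trans[OF flow_avg_self[OF flowT3]]) (use near_disp(3)[OF e, of 1] in \<open>auto intro: mult_left_mono\<close>)
  finally show "disp (T3 t) q0 \<le> \<bar>t\<bar> * L" .
qed

lemma near_up: "i < 8 \<Longrightarrow> r > 0 \<Longrightarrow> 2 * r \<le> M \<Longrightarrow> near k q \<Longrightarrow> near (k + 1) (A i r q)"
  by (rule near_A) auto

lemma disp_torus_step:
  assumes "i < 8" "r > 0" "2 * r \<le> M" "near 15 q" and t: "\<bar>t\<bar> \<le> 1/4"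
    and k: "disp (T0 t) q \<le> k * \<bar>t\<bar> * L" "disp (T3 t) q \<le> k * \<bar>t\<bar> * L"
  shows "disp (T0 t) (A i r q) \<le> (k + 8) * \<bar>t\<bar> * L" "disp (T3 t) (A i r q) \<le> (k + 8) * \<bar>t\<bar> * L"
  using disp_torus_A[OF assms(1-4) t] k by (simp_all add: distrib_right)

text \<open>The constant is 1 at \<open>q0\<close> and every further average adds 8: four averages
  lead to \<open>w\<close>, a fifth to \<open>v\<close>.\<close>

lemma disp_torus_w: assumes t: "\<bar>t\<bar> \<le> 1/4"
  shows "disp (T0 t) w \<le> 33 * \<bar>t\<bar> * L" "disp (T3 t) w \<le> 33 * \<bar>t\<bar> * L"
    "disp (T0 t) v \<le> 41 * \<bar>t\<bar> * L" "disp (T3 t) v \<le> 41 * \<bar>t\<bar> * L"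
proof -
  note 1 = disp_torus_step[of 7 1, OF _ _ _ near15(1) t, of 1, folded q1_def]
  note 2 = disp_torus_step[of 0 \<Theta>, OF _ pos(2) Th(2) near15(2) t, of 9, folded q2_def]
  note 3 = disp_torus_step[of 1 \<Theta>, OF _ pos(2) Th(2) near15(3) t, of 17, folded q3_def]
  note 4 = disp_torus_step[of 2 \<Theta>, OF _ pos(2) Th(2) near15(4) t, of 25, folded w_def]
  note 5 = disp_torus_step[of 3 \<sigma>, OF _ pos(1) sg(2) near15(5) t, of 33, folded v_def]
  have q1: "disp (T0 t) q1 \<le> 9 * \<bar>t\<bar> * L" "disp (T3 t) q1 \<le> 9 * \<bar>t\<bar> * L"
    using 1 disp_q0_torus[of t] sg by simp_all
  have q2: "disp (T0 t) q2 \<le> 17 * \<bar>t\<bar> * L" "disp (T3 t) q2 \<le> 17 * \<bar>t\<bar> * L" using 2 q1 by simp_all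
  have q3: "disp (T0 t) q3 \<le> 25 * \<bar>t\<bar> * L" "disp (T3 t) q3 \<le> 25 * \<bar>t\<bar> * L" using 3 q2 by simp_all
  show w: "disp (T0 t) w \<le> 33 * \<bar>t\<bar> * L" "disp (T3 t) w \<le> 33 * \<bar>t\<bar> * L" using 4 q3 by simp_all
  show "disp (T0 t) v \<le> 41 * \<bar>t\<bar> * L" "disp (T3 t) v \<le> 41 * \<bar>t\<bar> * L" using 5 w by simp_all
qed

text \<open>\<open>U 0\<close> passes \<open>U 3 c\<close> with corrections along 1 and 2, of sizes
  up to \<open>\<bar>s\<bar> * \<sigma>\<close> and \<open>\<bar>s\<bar> * \<sigma>^2\<close>. So
  \<open>\<Theta>\<close> will have to be large against \<open>\<sigma>^2\<close>.\<close>

lemma disp_v_0: "disp (U 0 s) v \<le> 3 * \<bar>s\<bar> * \<sigma>\<^sup>2 / \<Theta> * L"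
  unfolding v_def
proof (rule flow_avg_pass_id[OF flowU pos(1) contr])
  fix c assume c: "0 \<le> c" "c \<le> \<sigma>"
  let ?b = "\<bar>s\<bar> * \<sigma>\<^sup>2 / \<Theta> * L"
  have "disp (U 0 s) (U 3 c w) = norm (U 0 s (U 1 (- (s * c)) (U 2 (s * c\<^sup>2) w)) - w)"
    by (simp add: r03 U_norm)
  also have "\<dots> \<le> disp (U 0 s) w + (disp (U 1 (- (s * c))) w + disp (U 2 (s * c\<^sup>2)) w)" by (rule disp3) auto
  also have "\<dots> \<le> ?b + (?b + ?b)"
  proof (intro add_mono disp_w[THEN order_trans] mult_right_mono divide_right_mono)
    have 1: "1 \<le> \<sigma>\<^sup>2" "\<sigma> \<le> \<sigma>\<^sup>2" using sg by (auto simp: self_le_power)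
    show "\<bar>s\<bar> \<le> \<bar>s\<bar> * \<sigma>\<^sup>2" using 1 mult_left_mono[of 1 "\<sigma>\<^sup>2" "\<bar>s\<bar>"] by simp
    show "\<bar>- (s * c)\<bar> \<le> \<bar>s\<bar> * \<sigma>\<^sup>2" using 1 c by (simp add: abs_mult mult_left_mono)
    show "\<bar>s * c\<^sup>2\<bar> \<le> \<bar>s\<bar> * \<sigma>\<^sup>2" using c by (simp add: abs_mult mult_left_mono power_mono)
  qed (use L0 pos in auto)
  finally show "disp (U 0 s) (U 3 c w) \<le> 3 * \<bar>s\<bar> * \<sigma>\<^sup>2 / \<Theta> * L" by (simp add: mult_ac)
qed auto

lemma moebius_param:
  fixes s c r :: real
  assumes "\<bar>s\<bar> * r \<le> 1/8" "0 \<le> c" "c \<le> r"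
  shows "1 + s * c > 0" "\<bar>s * c\<bar> \<le> \<bar>s\<bar> * r" "\<bar>ln (1 + s * c)\<bar> \<le> 2 * (\<bar>s\<bar> * r)" "\<bar>ln (1 + s * c)\<bar> \<le> 1/4"
    "\<bar>s / (1 + s * c)\<bar> \<le> 2 * \<bar>s\<bar>"
proof -
  show sc: "\<bar>s * c\<bar> \<le> \<bar>s\<bar> * r" using assms by (simp add: abs_mult mult_left_mono)
  then have h: "\<bar>s * c\<bar> \<le> 1/8" using assms by linarith
  then show p: "1 + s * c > 0" by linarith
  show "\<bar>ln (1 + s * c)\<bar> \<le> 2 * (\<bar>s\<bar> * r)" using ln_one_plus_bound[of "s * c"] h sc by linarith
  then show "\<bar>ln (1 + s * c)\<bar> \<le> 1/4" using assms by linarith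
  have "1 + s * c \<ge> 1/2" using h by linarith
  then have "\<bar>s\<bar> / (1 + s * c) \<le> \<bar>s\<bar> / (1/2)" by (intro divide_left_mono) auto
  then show "\<bar>s / (1 + s * c)\<bar> \<le> 2 * \<bar>s\<bar>" using p by simp
qed

text \<open>Roots 7 and 3 are opposite, so the passage leaves a torus element and a
  \<open>U 7\<close>, both already controlled at \<open>w\<close>. The constant is 2 * 33 + 2 * 5 +
  8, the 8 coming from the reparametrization.\<close>

lemma disp_v_7: assumes t: "\<bar>t\<bar> * \<sigma> \<le> 1/8" shows "disp (U 7 t) v \<le> 84 * \<bar>t\<bar> * \<sigma> * L"
proof -
  have t1: "\<bar>t\<bar> \<le> \<bar>t\<bar> * \<sigma>" using sg mult_left_mono[of 1 \<sigma> "\<bar>t\<bar>"] by simp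
  have "disp (U 7 t) v \<le> 76 * (\<bar>t\<bar> * \<sigma>) * L + 8 * (\<bar>t\<bar> * \<sigma>) * L"
    unfolding v_def
  proof (rule flow_avg_pass_moebius[OF flowU pos(1) contr t])
    show "disp (U 3 u) w \<le> L" if "0 \<le> u" "u \<le> 2 * \<sigma>" for u
      by (rule near_disp(1)[OF near15(5)]) (use that sg in auto)
    fix c assume c: "0 \<le> c" "c \<le> \<sigma>"
    note m = moebius_param[OF t c]
    have m6: "\<bar>t / (1 + t * c)\<bar> \<le> 1" using m(5) t t1 by linarith
    have "norm (U 7 t (U 3 c w) - U 3 (c / (1 + t * c)) w) = norm (T3 (- ln (1 + t * c)) (U 7 (t / (1 + t * c)) w) - w)"
      by (simp add: mob73[OF m(1)] U_norm)
    also have "\<dots> \<le> disp (T3 (- ln (1 + t * c))) w + disp (U 7 (t / (1 + t * c))) w"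
      by (rule disp_comp[OF flow_contraction[OF flowT3]])
    also have "\<dots> \<le> 33 * \<bar>- ln (1 + t * c)\<bar> * L + 5 * \<bar>t / (1 + t * c)\<bar> * L"
      by (intro add_mono disp_torus_w disp_w_7 m6) (use m(4) in simp)
    also have "\<dots> \<le> 33 * (2 * (\<bar>t\<bar> * \<sigma>)) * L + 5 * (2 * (\<bar>t\<bar> * \<sigma>)) * L"
      by (intro add_mono mult_left_mono mult_right_mono) (use m(3,5) t1 L0 in auto)
    finally show "norm (U 7 t (U 3 c w) - U 3 (c / (1 + t * c)) w) \<le> 76 * (\<bar>t\<bar> * \<sigma>) * L" by (simp add: algebra_simps)
  qed auto
  then show ?thesis by (simp add: mult_ac)
qed

lemma disp_v_3: "disp (U 3 t) v \<le> \<bar>t\<bar> / \<sigma> * L"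
  unfolding v_def by (rule disp_A_self) (use near_disp(1)[OF near15(5)] pos in auto)

context
  fixes r4 r5 r6 :: real
  assumes r4: "r4 > 0" "2 * r4 \<le> M" and r5: "r5 > 0" "2 * r5 \<le> M" and r6: "r6 > 0" "2 * r6 \<le> M"
begin

lemma neg_box_perm: "neg_box r4 r5 r6 = A 6 r6 (A 5 r5 (A 4 r4 v))"
  using r4 r5 r6 unfolding neg_box_def
  by (simp add: A_commute[of 5 4] A_commute[of 6 4] A_commute[of 6 5] commuting_roots_def)

lemma near_boxes: "near 8 (A 6 r6 v)" "near 9 (A 5 r5 (A 6 r6 v))" "near 10 (neg_box r4 r5 r6)"
   "near 8 (A 4 r4 v)" "near 9 (A 5 r5 (A 4 r4 v))" "near 11 (xi r4 r5 r6)"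
proof -
  show 1: "near 8 (A 6 r6 v)" using near_up[OF _ r6 near_q(6)] by simp
  show 2: "near 9 (A 5 r5 (A 6 r6 v))" using near_up[OF _ r5 1] by simp
  show 3: "near 10 (neg_box r4 r5 r6)" unfolding neg_box_def using near_up[OF _ r4 2] by simp
  show 4: "near 8 (A 4 r4 v)" using near_up[OF _ r4 near_q(6)] by simp
  show "near 9 (A 5 r5 (A 4 r4 v))" using near_up[OF _ r5 4] by simp
  show "near 11 (xi r4 r5 r6)" unfolding xi_def using near_up[OF _ pos(1) sg(2) 3] by simp
qed

lemmas near_boxes15 = near_boxes[THEN near_mono, of 15, simplified]

lemma disp_box_self: "disp (U 4 s) (neg_box r4 r5 r6) \<le> \<bar>s\<bar> / r4 * L"
  "disp (U 5 s) (neg_box r4 r5 r6) \<le> \<bar>s\<bar> / r5 * L"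
  "disp (U 6 s) (neg_box r4 r5 r6) \<le> \<bar>s\<bar> / r6 * L"
proof -
  show "disp (U 4 s) (neg_box r4 r5 r6) \<le> \<bar>s\<bar> / r4 * L"
    unfolding neg_box_def by (rule disp_A_self) (use near_disp(1)[OF near_boxes15(2)] r4 in auto)
  have "disp (U 5 s) (A 5 r5 (A 6 r6 v)) \<le> \<bar>s\<bar> / r5 * L"
    by (rule disp_A_self) (use near_disp(1)[OF near_boxes15(1)] r5 in auto)
  then show "disp (U 5 s) (neg_box r4 r5 r6) \<le> \<bar>s\<bar> / r5 * L"
    unfolding neg_box_def by - (rule order_trans[OF disp_A_commute], use r4 in \<open>auto simp: commuting_roots_def\<close>)
  have "disp (U 6 s) (A 6 r6 v) \<le> \<bar>s\<bar> / r6 * L"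
    by (rule disp_A_self) (use near_disp(1)[OF near15(6)] r6 in auto)
  then show "disp (U 6 s) (neg_box r4 r5 r6) \<le> \<bar>s\<bar> / r6 * L"
    unfolding neg_box_def
    by - (rule order_trans[OF disp_A_commute], use r4 in \<open>simp_all add: commuting_roots_def\<close>,
        rule order_trans[OF disp_A_commute], use r5 in \<open>simp_all add: commuting_roots_def\<close>)
qed

text \<open>Root 5 is averaged outside root 6 here: \<open>U 0\<close> passing \<open>U 5 c\<close>
  creates a \<open>U 6\<close> of size \<open>\<bar>s\<bar> * c^2\<close>, which the inner average
  absorbs, and \<open>U 0\<close> commutes with \<open>U 6\<close>.\<close>

lemma disp_b5_0:
  assumes s: "\<bar>s\<bar> * r5 * \<sigma> \<le> 1/8"
  shows "disp (U 0 s) (A 5 r5 (A 6 r6 v)) \<le> \<bar>s\<bar> * (r5\<^sup>2 / r6 + 84 * r5 * \<sigma> + 3 * \<sigma>\<^sup>2 / \<Theta>) * L"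
proof (rule flow_avg_pass_id[OF flowU r5(1) contr])
  fix c assume c: "0 \<le> c" "c \<le> r5"
  let ?b = "A 6 r6 v"
  have sc: "\<bar>s * c\<bar> \<le> \<bar>s\<bar> * r5" using c by (simp add: abs_mult mult_left_mono)
  have sc1: "\<bar>s * c\<bar> * \<sigma> \<le> 1/8" using mult_right_mono[OF sc, of \<sigma>] s pos by linarith
  have "disp (U 0 s) (U 5 c ?b) = norm (U 6 (- (s * c\<^sup>2)) (U 7 (s * c) (U 0 s ?b)) - ?b)"
    by (simp add: r05 U_norm)
  also have "\<dots> \<le> disp (U 6 (- (s * c\<^sup>2))) ?b + (disp (U 7 (s * c)) ?b + disp (U 0 s) ?b)" by (rule disp3) auto
  also have "\<dots> \<le> (\<bar>s\<bar> * r5\<^sup>2) / r6 * L + (84 * (\<bar>s\<bar> * r5) * \<sigma> * L + 3 * \<bar>s\<bar> * \<sigma>\<^sup>2 / \<Theta> * L)"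
  proof (intro add_mono)
    have "disp (U 6 (- (s * c\<^sup>2))) ?b \<le> \<bar>- (s * c\<^sup>2)\<bar> / r6 * L"
      by (rule disp_A_self) (use near_disp(1)[OF near15(6)] r6 in auto)
    also have "\<dots> \<le> (\<bar>s\<bar> * r5\<^sup>2) / r6 * L"
      using c r6 L0 by (intro mult_right_mono divide_right_mono) (auto simp: abs_mult mult_left_mono power_mono)
    finally show "disp (U 6 (- (s * c\<^sup>2))) ?b \<le> (\<bar>s\<bar> * r5\<^sup>2) / r6 * L" .
    have "disp (U 7 (s * c)) ?b \<le> disp (U 7 (s * c)) v"
      by (rule disp_A_commute) (use r6 in \<open>auto simp: commuting_roots_def\<close>)
    also have "\<dots> \<le> 84 * \<bar>s * c\<bar> * \<sigma> * L" by (rule disp_v_7[OF sc1])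
    also have "\<dots> \<le> 84 * (\<bar>s\<bar> * r5) * \<sigma> * L" using sc pos L0 by (intro mult_right_mono mult_left_mono) auto
    finally show "disp (U 7 (s * c)) ?b \<le> 84 * (\<bar>s\<bar> * r5) * \<sigma> * L" .
    show "disp (U 0 s) ?b \<le> 3 * \<bar>s\<bar> * \<sigma>\<^sup>2 / \<Theta> * L"
      by (rule order_trans[OF disp_A_commute disp_v_0]) (use r6 in \<open>auto simp: commuting_roots_def\<close>)
  qed
  also have "\<dots> = \<bar>s\<bar> * (r5\<^sup>2 / r6 + 84 * r5 * \<sigma> + 3 * \<sigma>\<^sup>2 / \<Theta>) * L" by (simp add: algebra_simps)
  finally show "disp (U 0 s) (U 5 c ?b) \<le> \<bar>s\<bar> * (r5\<^sup>2 / r6 + 84 * r5 * \<sigma> + 3 * \<sigma>\<^sup>2 / \<Theta>) * L" .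
qed auto

text \<open>The outermost average, along 7, commutes with root 0, and the next one is along the
  opposite root 4. The factor 122 is 2 * 57 for the torus, with 57 = 41 + 2 * 8, plus 8 for the
  reparametrization.\<close>

lemma disp_xi_0:
  assumes s4: "\<bar>s\<bar> * r4 \<le> 1/8" and s5: "\<bar>s\<bar> * r5 * \<sigma> \<le> 1/16"
  shows "disp (U 0 s) (xi r4 r5 r6) \<le> \<bar>s\<bar> * (122 * r4 + 2 * (r5\<^sup>2 / r6 + 84 * r5 * \<sigma> + 3 * \<sigma>\<^sup>2 / \<Theta>)) * L"
proof -
  let ?b = "A 5 r5 (A 6 r6 v)" and ?K = "r5\<^sup>2 / r6 + 84 * r5 * \<sigma> + 3 * \<sigma>\<^sup>2 / \<Theta>"
  have K0: "?K \<ge> 0" using r5 r6 pos by simp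
  have T: "disp (T0 t) ?b \<le> 57 * \<bar>t\<bar> * L" if t: "\<bar>t\<bar> \<le> 1/4" for t
  proof -
    note 1 = disp_torus_step[OF _ r6 near15(6) t disp_torus_w(3,4)[OF t], of 6]
    show ?thesis using disp_torus_step(1)[OF _ r5 near_boxes15(1) t 1, of 5] by simp
  qed
  have "disp (U 0 s) (A 4 r4 ?b) \<le> (114 * (\<bar>s\<bar> * r4) * L + 2 * \<bar>s\<bar> * ?K * L) + 8 * (\<bar>s\<bar> * r4) * L"
  proof (rule flow_avg_pass_moebius[OF flowU r4(1) contr s4])
    show "disp (U 4 u) ?b \<le> L" if "0 \<le> u" "u \<le> 2 * r4" for u
      by (rule near_disp(1)[OF near_boxes15(2)]) (use that r4 in auto)
    fix c assume c: "0 \<le> c" "c \<le> r4"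
    note m = moebius_param[OF s4 c]
    let ?s = "s / (1 + s * c)"
    have s': "\<bar>?s\<bar> * r5 * \<sigma> \<le> 1/8"
    proof -
      have "\<bar>?s\<bar> * r5 * \<sigma> \<le> (2 * \<bar>s\<bar>) * r5 * \<sigma>" using m(5) r5 pos by (intro mult_right_mono) auto
      then show ?thesis using s5 by linarith
    qed
    have "norm (U 0 s (U 4 c ?b) - U 4 (c / (1 + s * c)) ?b) = norm (T0 (ln (1 + s * c)) (U 0 ?s ?b) - ?b)"
      by (simp add: mob04[OF m(1)] U_norm)
    also have "\<dots> \<le> disp (T0 (ln (1 + s * c))) ?b + disp (U 0 ?s) ?b"
      by (rule disp_comp[OF flow_contraction[OF flowT0]])
    also have "\<dots> \<le> 57 * \<bar>ln (1 + s * c)\<bar> * L + \<bar>?s\<bar> * ?K * L"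
      by (intro add_mono T disp_b5_0 m(4) s')
    also have "\<dots> \<le> 57 * (2 * (\<bar>s\<bar> * r4)) * L + (2 * \<bar>s\<bar>) * ?K * L"
      by (intro add_mono mult_right_mono mult_left_mono m K0 L0) auto
    finally show "norm (U 0 s (U 4 c ?b) - U 4 (c / (1 + s * c)) ?b) \<le> 114 * (\<bar>s\<bar> * r4) * L + 2 * \<bar>s\<bar> * ?K * L" by simp
  qed auto
  then have "disp (U 0 s) (neg_box r4 r5 r6) \<le> \<bar>s\<bar> * (122 * r4 + 2 * ?K) * L"
    unfolding neg_box_def by (simp add: algebra_simps)
  then show ?thesis unfolding xi_def
    by (intro order_trans[OF disp_A_commute]) (use pos in \<open>auto simp: commuting_roots_def\<close>)
qed

text \<open>The commuting averages are rearranged with 4 innermost and 6 outermost: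
  \<open>U 3\<close> commutes with 4, creates 4 when passing 5, and creates 5 and 4 when passing 6.
  The conditions on the radii make the inner averages absorb these. Passing the opposite root 7 then
  gives 148 = 2 * 65 + 2 * 5 + 8, with 65 = 41 + 3 * 8.\<close>

lemma disp_xi_3:
  assumes t: "\<bar>t\<bar> * \<sigma> \<le> 1/8" and g: "r4 = r6" "r6 \<le> r5 * \<sigma>" "r5 \<le> r6"
  shows "disp (U 3 t) (xi r4 r5 r6) \<le> 148 * \<bar>t\<bar> * \<sigma> * L"
proof -
  have t1: "\<bar>t\<bar> \<le> \<bar>t\<bar> * \<sigma>" using sg mult_left_mono[of 1 \<sigma> "\<bar>t\<bar>"] by simp
  let ?c4 = "A 4 r4 v" let ?c5 = "A 5 r5 ?c4" let ?c6 = "A 6 r6 ?c5"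
  have c4_3: "disp (U 3 u) ?c4 \<le> \<bar>u\<bar> * L" for u
  proof -
    have "\<bar>u\<bar> / \<sigma> * L \<le> \<bar>u\<bar> / 1 * L" using sg L0 by (intro mult_right_mono divide_left_mono) auto
    then show ?thesis by (intro order_trans[OF disp_A_commute] order_trans[OF disp_v_3]) (use r4 in \<open>auto simp: commuting_roots_def\<close>)
  qed
  have c4_4: "disp (U 4 u) ?c4 \<le> \<bar>u\<bar> / r4 * L" for u
    by (rule disp_A_self) (use near_disp(1)[OF near15(6)] r4 in auto)
  have c5_4: "disp (U 4 u) ?c5 \<le> \<bar>u\<bar> / r4 * L" for u
    by (rule order_trans[OF disp_A_commute c4_4]) (use r5 in \<open>auto simp: commuting_roots_def\<close>)
  have c5_5: "disp (U 5 u) ?c5 \<le> \<bar>u\<bar> / r5 * L" for u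
    by (rule disp_A_self) (use near_disp(1)[OF near_boxes15(4)] r5 in auto)
  have c5_3: "disp (U 3 u) ?c5 \<le> 3 * \<bar>u\<bar> * L" for u
  proof (rule flow_avg_pass_id[OF flowU r5(1) contr])
    fix c assume c: "0 \<le> c" "c \<le> r5"
    have "disp (U 3 u) (U 5 c ?c4) = norm (U 4 (- (2 * u * c)) (U 3 u ?c4) - ?c4)"
      by (simp add: r35 U_norm)
    also have "\<dots> \<le> disp (U 4 (- (2 * u * c))) ?c4 + disp (U 3 u) ?c4" by (rule disp2) auto
    also have "\<dots> \<le> (2 * \<bar>u\<bar>) * L + \<bar>u\<bar> * L"
    proof (intro add_mono c4_3 order_trans[OF c4_4] scaled_bound)
      have "\<bar>u\<bar> * c \<le> \<bar>u\<bar> * r4" using c g by (intro mult_left_mono) auto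
      then show "\<bar>- (2 * u * c)\<bar> \<le> 2 * \<bar>u\<bar> * r4" using c by (simp add: abs_mult)
    qed (use r4 in auto)
    finally show "disp (U 3 u) (U 5 c ?c4) \<le> 3 * \<bar>u\<bar> * L" by (simp add: mult_ac)
  qed auto
  have c6_3: "disp (U 3 u) ?c6 \<le> 5 * \<bar>u\<bar> * \<sigma> * L" if u: "\<bar>u\<bar> \<le> 1" for u
  proof (rule flow_avg_pass_id[OF flowU r6(1) contr])
    fix c assume c: "0 \<le> c" "c \<le> r6"
    have us: "\<bar>u\<bar> \<le> \<bar>u\<bar> * \<sigma>" using sg mult_left_mono[of 1 \<sigma> "\<bar>u\<bar>"] by simp
    have "disp (U 3 u) (U 6 c ?c5) = norm (U 5 (- (u * c)) (U 4 (u\<^sup>2 * c) (U 3 u ?c5)) - ?c5)"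
      by (simp add: r36 U_norm)
    also have "\<dots> \<le> disp (U 5 (- (u * c))) ?c5 + (disp (U 4 (u\<^sup>2 * c)) ?c5 + disp (U 3 u) ?c5)" by (rule disp3) auto
    also have "\<dots> \<le> (\<bar>u\<bar> * \<sigma>) * L + ((\<bar>u\<bar> * \<sigma>) * L + 3 * (\<bar>u\<bar> * \<sigma>) * L)"
    proof (intro add_mono order_trans[OF c5_3] order_trans[OF c5_5] order_trans[OF c5_4] scaled_bound)
      have "\<bar>u\<bar> * c \<le> \<bar>u\<bar> * (r5 * \<sigma>)" using c g by (intro mult_left_mono) auto
      then show "\<bar>- (u * c)\<bar> \<le> \<bar>u\<bar> * \<sigma> * r5" using c by (simp add: abs_mult mult_ac)
      have "\<bar>u\<bar> * \<bar>u\<bar> * c \<le> (\<bar>u\<bar> * 1) * r4" using c g u by (intro mult_mono) auto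
      also have "\<dots> \<le> \<bar>u\<bar> * \<sigma> * r4" using us r4 by (intro mult_right_mono) auto
      finally show "\<bar>u\<^sup>2 * c\<bar> \<le> \<bar>u\<bar> * \<sigma> * r4" using c by (simp add: abs_mult power2_eq_square)
      show "3 * \<bar>u\<bar> * L \<le> 3 * (\<bar>u\<bar> * \<sigma>) * L" using us L0 by (intro mult_right_mono) auto
    qed (use r4 r5 in auto)
    finally show "disp (U 3 u) (U 6 c ?c5) \<le> 5 * \<bar>u\<bar> * \<sigma> * L" by (simp add: mult_ac)
  qed auto
  have T: "disp (T3 u) ?c6 \<le> 65 * \<bar>u\<bar> * L" if u: "\<bar>u\<bar> \<le> 1/4" for u
  proof -
    note 1 = disp_torus_step[OF _ r4 near15(6) u disp_torus_w(3,4)[OF u], of 4]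
    note 2 = disp_torus_step[OF _ r5 near_boxes15(4) u 1, of 5]
    show ?thesis using disp_torus_step(2)[OF _ r6 near_boxes15(5) u 2, of 6] by simp
  qed
  have "disp (U 3 t) (A 7 \<sigma> ?c6) \<le> 140 * (\<bar>t\<bar> * \<sigma>) * L + 8 * (\<bar>t\<bar> * \<sigma>) * L"
  proof (rule flow_avg_pass_moebius[OF flowU pos(1) contr t])
    show "disp (U 7 u) ?c6 \<le> L" if "0 \<le> u" "u \<le> 2 * \<sigma>" for u
      by (rule near_disp(1)[OF near_boxes15(3)[unfolded neg_box_perm]]) (use that sg in auto)
    fix c assume c: "0 \<le> c" "c \<le> \<sigma>"
    note m = moebius_param[OF t c]
    let ?t = "t / (1 + t * c)"
    have t': "\<bar>?t\<bar> \<le> 1" using m(5) t t1 by linarith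
    have "norm (U 3 t (U 7 c ?c6) - U 7 (c / (1 + t * c)) ?c6) = norm (T3 (ln (1 + t * c)) (U 3 ?t ?c6) - ?c6)"
      by (simp add: mob37[OF m(1)] U_norm)
    also have "\<dots> \<le> disp (T3 (ln (1 + t * c))) ?c6 + disp (U 3 ?t) ?c6"
      by (rule disp_comp[OF flow_contraction[OF flowT3]])
    also have "\<dots> \<le> 65 * \<bar>ln (1 + t * c)\<bar> * L + 5 * \<bar>?t\<bar> * \<sigma> * L"
      by (intro add_mono T c6_3 m(4) t')
    also have "\<dots> \<le> 65 * (2 * (\<bar>t\<bar> * \<sigma>)) * L + 5 * (2 * \<bar>t\<bar>) * \<sigma> * L"
      by (intro add_mono mult_right_mono mult_left_mono m L0) (use pos in auto)
    finally show "norm (U 3 t (U 7 c ?c6) - U 7 (c / (1 + t * c)) ?c6) \<le> 140 * (\<bar>t\<bar> * \<sigma>) * L" by (simp add: mult_ac)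
  qed auto
  then show ?thesis unfolding xi_def neg_box_perm by (simp add: mult_ac)
qed

text \<open>Here large radii help. The outer average along 7 turns \<open>U 4\<close> into a product
  with \<open>U 5\<close> and \<open>U 6\<close> of parameters up to \<open>\<sigma>\<close> and
  \<open>\<sigma>^2\<close>, so \<open>r5\<close> has to beat \<open>\<sigma>\<close> and
  \<open>r6\<close> has to beat \<open>\<sigma>^2\<close>.\<close>

lemma disp_xi_neg: assumes t: "\<bar>t\<bar> \<le> 1"
  shows "disp (U 7 t) (xi r4 r5 r6) \<le> 1 / \<sigma> * L"
    "disp (U 6 t) (xi r4 r5 r6) \<le> 1 / r6 * L"
    "disp (U 5 t) (xi r4 r5 r6) \<le> (2 * \<sigma> / r6 + 1 / r5) * L"
    "disp (U 4 t) (xi r4 r5 r6) \<le> (1 / r4 + \<sigma> / r5 + \<sigma>\<^sup>2 / r6) * L"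
proof -
  let ?b = "neg_box r4 r5 r6"
  have "\<bar>t\<bar> / \<sigma> * L \<le> 1 / \<sigma> * L" using t pos L0 by (intro mult_right_mono divide_right_mono) auto
  then show "disp (U 7 t) (xi r4 r5 r6) \<le> 1 / \<sigma> * L"
    unfolding xi_def by (intro order_trans[OF disp_A_self]) (use near_disp(1)[OF near_boxes15(3)] pos in auto)
  have "\<bar>t\<bar> / r6 * L \<le> 1 / r6 * L" using t r6 L0 by (intro mult_right_mono divide_right_mono) auto
  then show "disp (U 6 t) (xi r4 r5 r6) \<le> 1 / r6 * L"
    unfolding xi_def by (intro order_trans[OF disp_A_commute] order_trans[OF disp_box_self(3)]) (use pos in \<open>auto simp: commuting_roots_def\<close>)
  show "disp (U 5 t) (xi r4 r5 r6) \<le> (2 * \<sigma> / r6 + 1 / r5) * L"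
    unfolding xi_def
  proof (rule flow_avg_pass_id[OF flowU pos(1) contr])
    fix c assume c: "0 \<le> c" "c \<le> \<sigma>"
    have "disp (U 5 t) (U 7 c ?b) = norm (U 5 t (U 6 (2 * c * t) ?b) - ?b)" by (simp add: r57 U_norm)
    also have "\<dots> \<le> disp (U 5 t) ?b + disp (U 6 (2 * c * t)) ?b" by (rule disp2) auto
    also have "\<dots> \<le> (1 / r5) * L + (2 * \<sigma> / r6) * L"
    proof (intro add_mono order_trans[OF disp_box_self(2)] order_trans[OF disp_box_self(3)] scaled_bound)
      show "\<bar>t\<bar> \<le> 1 / r5 * r5" using t r5 by simp
      have "c * \<bar>t\<bar> \<le> \<sigma> * 1" using c t by (intro mult_mono) auto
      then show "\<bar>2 * c * t\<bar> \<le> 2 * \<sigma> / r6 * r6" using c r6 by (simp add: abs_mult)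
    qed (use r5 r6 in auto)
    finally show "disp (U 5 t) (U 7 c ?b) \<le> (2 * \<sigma> / r6 + 1 / r5) * L" by (simp add: algebra_simps)
  qed auto
  show "disp (U 4 t) (xi r4 r5 r6) \<le> (1 / r4 + \<sigma> / r5 + \<sigma>\<^sup>2 / r6) * L"
    unfolding xi_def
  proof (rule flow_avg_pass_id[OF flowU pos(1) contr])
    fix c assume c: "0 \<le> c" "c \<le> \<sigma>"
    have "disp (U 4 t) (U 7 c ?b) = norm (U 4 t (U 5 (c * t) (U 6 (c\<^sup>2 * t) ?b)) - ?b)" by (simp add: r47 U_norm)
    also have "\<dots> \<le> disp (U 4 t) ?b + (disp (U 5 (c * t)) ?b + disp (U 6 (c\<^sup>2 * t)) ?b)" by (rule disp3) auto
    also have "\<dots> \<le> (1 / r4) * L + ((\<sigma> / r5) * L + (\<sigma>\<^sup>2 / r6) * L)"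
    proof (intro add_mono order_trans[OF disp_box_self(1)] order_trans[OF disp_box_self(2)] order_trans[OF disp_box_self(3)] scaled_bound)
      show "\<bar>t\<bar> \<le> 1 / r4 * r4" using t r4 by simp
      have "c * \<bar>t\<bar> \<le> \<sigma> * 1" using c t by (intro mult_mono) auto
      then show "\<bar>c * t\<bar> \<le> \<sigma> / r5 * r5" using c r5 by (simp add: abs_mult)
      have "c\<^sup>2 * \<bar>t\<bar> \<le> \<sigma>\<^sup>2 * 1" using c t by (intro mult_mono power_mono) auto
      then show "\<bar>c\<^sup>2 * t\<bar> \<le> \<sigma>\<^sup>2 / r6 * r6" using c r6 by (simp add: abs_mult)
    qed (use r4 r5 r6 in auto)
    finally show "disp (U 4 t) (U 7 c ?b) \<le> (1 / r4 + \<sigma> / r5 + \<sigma>\<^sup>2 / r6) * L" by (simp add: algebra_simps)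
  qed auto
qed

end

text \<open>With \<open>g\<close> an outer average, this reduces the cost of doubling a radius to
  the quantity estimated by \<open>flow_avg_raise\<close>.\<close>

lemma avg_double_close:
  assumes g: "contraction_map g" and i: "i < 8" and t: "\<tau> > 0"
  shows "norm (g (A i (2 * \<tau>) p) - g (A i \<tau> p)) \<le> norm (g (U i \<tau> (A i \<tau> p)) - g (A i \<tau> p))"
proof -
  have "affine_map g" using g by (simp add: contraction_map_def)
  then have "g (A i (2 * \<tau>) p) = (1 - 1/2) *\<^sub>R g (A i \<tau> p) + (1/2) *\<^sub>R g (U i \<tau> (A i \<tau> p))"
    unfolding flow_avg_double[OF flowU[OF i] t] by (rule affine_map_combination)
  then have "g (A i (2 * \<tau>) p) - g (A i \<tau> p) = (1/2) *\<^sub>R (g (U i \<tau> (A i \<tau> p)) - g (A i \<tau> p))"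
    by (simp only: scaleR_left_diff_distrib scaleR_right_diff_distrib scaleR_one) simp
  then show ?thesis by simp
qed

lemma xi_contr4: "contraction_map (\<lambda>p. A 7 \<sigma> (A 6 r6 (A 5 r5 p)))" if "r5 > 0" "r6 > 0"
  using contraction_map_comp[OF A_contr[of 7 \<sigma>] contraction_map_comp[OF A_contr[of 6 r6] A_contr[of 5 r5]]] that pos by simp

end

section \<open>Raising the averaging radii\<close>

lemma flow_rescale: assumes f: "flow f" shows "flow (\<lambda>t. f (k * t))"
  unfolding flow_def
proof (intro conjI allI)
  show "continuous_on UNIV (\<lambda>t. f (k * t) q)" for q
    by (rule continuous_on_compose2[OF flow_cont[OF f, of UNIV]]) (auto intro!: continuous_intros)
qed (auto simp: flow_isometry[OF f] distrib_left flow_add[OF f] flow_0[OF f])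

text \<open>\<open>E\<close> will be the price of one doubling: the contraction over
  \<open>n\<close> scales, and errors of order \<open>1 / J\<close> with 174 = 40 * 4 + 10 + 4 as
  added up in \<open>E_bound\<close>. \<open>P = J^2\<close> makes the fraction
  \<open>2 * J / P\<close> left by earlier scales equal to \<open>2 / J\<close>.\<close>

locale root_flows_raise = root_flows_chain U T0 T3 \<eta> l M L \<sigma> \<Theta>
  for U :: "nat \<Rightarrow> real \<Rightarrow> 'b::banach \<Rightarrow> 'b" and T0 T3 :: "real \<Rightarrow> 'b \<Rightarrow> 'b" and \<eta> :: 'b and l M L \<sigma> \<Theta> :: real +
  fixes \<delta> :: real and n :: nat and J :: nat and P E :: real
  assumes uc: "clustering TYPE('b) \<delta>" and n: "n \<ge> 1" and J: "J = 2 ^ n" and P: "P = (real J)\<^sup>2"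
    and E: "E = ((1 - \<delta>) ^ n + 174 / J) * L"
begin

lemma d: "0 < \<delta>" "\<delta> < 1" using uc by (auto simp: clustering_def)

lemma J1: "J \<ge> 2" "real J \<ge> 2" "P \<ge> 2" "P \<ge> 1" "J \<ge> 1" "P > 0" "real J > 0"
proof -
  have "(2::nat) ^ 1 \<le> 2 ^ n" using n by (intro power_increasing) auto
  then show 1: "J \<ge> 2" by (simp add: J)
  then show 2: "real J \<ge> 2" by simp
  have "2 * 1 \<le> real J * real J" using 2 by (intro mult_mono) auto
  then show "P \<ge> 2" by (simp add: P power2_eq_square)
  then show "P \<ge> 1" "P > 0" by auto
  show "J \<ge> 1" "real J > 0" using 1 by auto
qed

lemma E_bound:
  assumes "e \<le> 4 * L / J" "X \<le> 4 / J"
  shows "max ((1 - \<delta>) ^ n * L) (40 * e + 10 * L / J) + X * L \<le> E"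
proof -
  have "max ((1 - \<delta>) ^ n * L) (40 * e + 10 * L / J) \<le> (1 - \<delta>) ^ n * L + 170 * L / J"
  proof (rule max.boundedI)
    show "(1 - \<delta>) ^ n * L \<le> (1 - \<delta>) ^ n * L + 170 * L / J" using L0 by simp
    have "40 * e + 10 * L / J \<le> 170 * L / J" using assms(1) by (simp add: add_divide_distrib[symmetric])
    moreover have "0 \<le> (1 - \<delta>) ^ n * L" using L0 d by simp
    ultimately show "40 * e + 10 * L / J \<le> (1 - \<delta>) ^ n * L + 170 * L / J" by linarith
  qed
  moreover have "X * L \<le> 4 / J * L" using assms(2) L0 by (intro mult_right_mono)
  moreover have "170 * L / J + 4 / J * L = 174 / J * L" by (simp flip: add_divide_distrib)
  ultimately show ?thesis unfolding E distrib_right by linarith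
qed

lemma small_ratio: fixes x y :: real assumes "J * x \<le> 4 * y" "0 < y" shows "x / y \<le> 4 / J"
  using assms J1 by (simp add: field_simps)

lemma scaled_bound_J:
  assumes "\<bar>s\<bar> \<le> c / J * d" "d > 0" shows "\<bar>s\<bar> / d * L \<le> c * L / J"
  using scaled_bound[OF assms] by simp

lemma remainder_bound:
  fixes \<tau> \<beta> \<alpha> :: real
  assumes "J\<^sup>2 * P ^ n * \<tau> \<le> \<beta> * \<alpha>" "\<beta> > 0" "\<alpha> > 0"
  shows "4 * J * \<tau> * P ^ n / (P * \<beta> * \<alpha>) \<le> 4 / J"
proof (rule small_ratio)
  have "J * (4 * J * \<tau> * P ^ n) = 4 * (J\<^sup>2 * P ^ n * \<tau>)" by (simp add: power2_eq_square)
  also have "\<dots> \<le> 4 * (1 * (\<beta> * \<alpha>))" using assms by simp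
  also have "\<dots> \<le> 4 * (P * (\<beta> * \<alpha>))" using J1 assms by (intro mult_left_mono mult_right_mono) auto
  finally show "J * (4 * J * \<tau> * P ^ n) \<le> 4 * (P * \<beta> * \<alpha>)" by (simp add: mult_ac)
qed (use J1 assms in auto)

lemma divided_condition:
  fixes \<tau> x y :: real assumes "J ^ 3 * P ^ n * \<tau> \<le> x * y" shows "J\<^sup>2 * P ^ n * \<tau> \<le> x / J * y"
proof -
  have "J\<^sup>2 * P ^ n * \<tau> = J ^ 3 * P ^ n * \<tau> / J" using J1 by (simp add: power2_eq_square power3_eq_cube)
  also have "\<dots> \<le> x * y / J" using assms by (rule divide_right_mono) simp
  finally show ?thesis by simp
qed

text \<open>The case of a true Heisenberg triple with \<open>k\<close> central. The factor
  \<open>\<kappa>\<close> normalizes the commutator coefficient. Starting the scales along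
  \<open>j\<close> at \<open>\<beta> / J\<close> instead of \<open>\<beta>\<close> keeps their
  displacement of \<open>w\<close> below \<open>2 * L / J\<close>.\<close>

lemma raise_double:
  fixes \<tau> \<alpha> \<beta> \<kappa> :: real and w :: 'b
  assumes ijk: "(k, i) \<in> commuting_roots" "(k, j) \<in> commuting_roots"
    and tau: "\<tau> > 0" "2 * \<tau> \<le> M" "J * \<tau> \<le> M" and ab: "\<alpha> > 0" "\<beta> > 0" and kappa: "\<bar>\<kappa>\<bar> \<le> 2"
    and rel: "\<And>a b q. U j (\<kappa> * b) (U i a q) = U k (- (a * b)) (U i a (U j (\<kappa> * b) q))"
    and w: "near 15 w" and wj: "\<And>s. disp (U j s) w \<le> \<bar>s\<bar> / \<beta> * L" and wk: "\<And>s. disp (U k s) w \<le> \<bar>s\<bar> / \<tau> * L"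
    and c: "J ^ 3 * P ^ n * \<tau> \<le> \<beta> * \<alpha>"
  shows "norm (A i \<alpha> (U k \<tau> w) - A i \<alpha> w) \<le> E"
proof -
  have lt: "i < 8" "j < 8" "k < 8" using ijk commuting_less by blast+
  have "norm (A i \<alpha> (U k \<tau> w) - A i \<alpha> w)
    \<le> max ((1 - \<delta>) ^ n * L) (40 * (2 * L / J) + 10 * L / J) + 4 * J * \<tau> * P ^ n / (P * (\<beta> / J) * \<alpha>) * L"
  proof (rule flow_avg_raise[OF uc J1(5,3) _ tau(1) ab(1), where x="U i" and y="\<lambda>b. U j (\<kappa> * b)" and z="U k" and c="U k"
        and \<kappa>="\<lambda>_ _. 0" and \<mu>="\<lambda>_ _. 0" and \<beta>="\<beta> / J" and w=w and n=n])
    show "flow (\<lambda>b. U j (\<kappa> * b))" by (rule flow_rescale[OF flowU[OF lt(2)]])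
    show "U j (\<kappa> * b) (U i a q) = U k (- (a * b)) (U i a (U k 0 (U j (\<kappa> * b) q)))" for a b q
      unfolding U_zero[OF lt(3)] by (rule rel)
    show "U k s (U i a q) = U i a (U k s (U k 0 q))" for a s q
      unfolding U_zero[OF lt(3)] by (rule comm[OF ijk(1)])
    show "U j (\<kappa> * b) (U k s q) = U k s (U j (\<kappa> * b) q)" for b s q by (rule comm[OF ijk(2), symmetric])
    show "U k b (U k s q) = U k s (U k b q)" for b s q by (rule flow_commute[OF flowU[OF lt(3)]])
    show "disp (U j (\<kappa> * (\<beta> / J / P ^ i))) w \<le> 2 * L / J" for i
    proof -
      have "1 \<le> P ^ i" using J1 by simp
      then have "\<beta> / J / P ^ i \<le> \<beta> / J / 1" using ab J1 by (intro divide_left_mono) auto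
      then have "\<bar>\<kappa>\<bar> * (\<beta> / J / P ^ i) \<le> 2 * (\<beta> / J)" using kappa ab J1 by (intro mult_mono) auto
      then have "\<bar>\<kappa> * (\<beta> / J / P ^ i)\<bar> \<le> 2 / J * \<beta>" using ab J1 by (simp add: abs_mult)
      then show ?thesis by (intro order_trans[OF wj scaled_bound_J[OF _ ab(2)]])
    qed
    show "disp (U k s) w \<le> 2 * L / J" if "\<bar>s\<bar> \<le> 2 * J * \<tau> / P" for s
    proof -
      have "\<bar>s\<bar> \<le> 2 / J * \<tau>" using that J1 by (simp add: P power2_eq_square)
      then show ?thesis by (intro order_trans[OF wk scaled_bound_J[OF _ tau(1)]])
    qed
    show "disp (U k (J * \<tau>)) w \<le> L" "disp (U k \<tau>) w \<le> L"
      by (intro near_disp(1)[OF w lt(3)]; use tau in simp)+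
  qed (use flowU lt ab J1 L0 in \<open>simp_all add: U_zero\<close>)
  also have "\<dots> \<le> E"
  proof (rule E_bound)
    show "4 * J * \<tau> * P ^ n / (P * (\<beta> / J) * \<alpha>) \<le> 4 / J"
      by (intro remainder_bound divided_condition) (use c J1 ab in auto)
  qed (use J1 L0 in \<open>auto intro!: divide_right_mono\<close>)
  finally show ?thesis .
qed

text \<open>Roots 5 and 3 have their commutator in 4. The average along 5, placed next to 4 by
  commutativity, does the contraction; invariance under 3 comes from the average of radius
  \<open>\<sigma>\<close> inside \<open>v\<close>.\<close>

lemma raise4:
  fixes \<tau> r5 r6 :: real
  assumes tau: "\<tau> > 0" "2 * \<tau> \<le> M" "J * \<tau> \<le> M" and r5: "r5 > 0" "2 * r5 \<le> M" and r6: "r6 > 0" "2 * r6 \<le> M"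
    and c: "J ^ 3 * P ^ n * \<tau> \<le> \<sigma> * r5"
  shows "norm (xi (2 * \<tau>) r5 r6 - xi \<tau> r5 r6) \<le> E"
proof -
  let ?w = "A 4 \<tau> v"
  have A: "norm (A 5 r5 (U 4 \<tau> ?w) - A 5 r5 ?w) \<le> E"
  proof (rule raise_double[where j=3 and \<kappa>="1/2" and \<beta>=\<sigma>])
    show "U 3 (1/2 * b) (U 5 a q) = U 4 (- (a * b)) (U 5 a (U 3 (1/2 * b) q))" for a b q
      by (simp add: r35 comm[of 4 5] commuting_roots_def mult.commute)
    show "near 15 ?w" by (rule near_mono[OF near_up[OF _ tau(1,2) near_q(6)]]) auto
    show "disp (U 4 s) ?w \<le> \<bar>s\<bar> / \<tau> * L" for s
      by (rule disp_A_self) (use near_disp(1)[OF near15(6)] tau in auto)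
    show "disp (U 3 s) ?w \<le> \<bar>s\<bar> / \<sigma> * L" for s
      by (rule order_trans[OF disp_A_commute disp_v_3]) (use tau in \<open>auto simp: commuting_roots_def\<close>)
  qed (use tau r5 pos c in \<open>auto simp: commuting_roots_def\<close>)
  have xi: "xi r r5 r6 = A 7 \<sigma> (A 6 r6 (A 5 r5 (A 4 r v)))" if "r > 0" for r
    unfolding xi_def neg_box_def using r5 r6 that
    by (simp add: A_commute[of 5 4] A_commute[of 6 4] A_commute[of 6 5] commuting_roots_def)
  have "norm (xi (2 * \<tau>) r5 r6 - xi \<tau> r5 r6) \<le> norm (A 7 \<sigma> (A 6 r6 (A 5 r5 (U 4 \<tau> ?w))) - A 7 \<sigma> (A 6 r6 (A 5 r5 ?w)))"
    unfolding xi[OF tau(1)] xi[OF mult_pos_pos[OF zero_less_numeral tau(1)]]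
    by (rule avg_double_close[OF xi_contr4]) (use r5 r6 tau in auto)
  also have "\<dots> \<le> norm (A 5 r5 (U 4 \<tau> ?w) - A 5 r5 ?w)"
    by (rule order_trans[OF contraction_map_norm[OF A_contr]], use pos in simp_all)
      (rule contraction_map_norm[OF A_contr], use r6 in simp_all)
  finally show ?thesis using A by simp
qed

text \<open>Roots 7 and 5 have their commutator in 6, and the outermost average along 7 does the
  contraction.\<close>

lemma raise6:
  fixes \<tau> r4 r5 :: real
  assumes tau: "\<tau> > 0" "2 * \<tau> \<le> M" "J * \<tau> \<le> M" and r4: "r4 > 0" "2 * r4 \<le> M" and r5: "r5 > 0" "2 * r5 \<le> M"
    and c: "J ^ 3 * P ^ n * \<tau> \<le> \<sigma> * r5"
  shows "norm (xi r4 r5 (2 * \<tau>) - xi r4 r5 \<tau>) \<le> E"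
proof -
  let ?w = "neg_box r4 r5 \<tau>"
  note ws = disp_box_self[OF r4 r5 tau(1,2)]
  have A: "norm (A 7 \<sigma> (U 6 \<tau> ?w) - A 7 \<sigma> ?w) \<le> E"
  proof (rule raise_double[where j=5 and \<kappa>="-1/2" and \<beta>=r5])
    show "U 5 (-1/2 * b) (U 7 a q) = U 6 (- (a * b)) (U 7 a (U 5 (-1/2 * b) q))" for a b q
      by (simp add: r57 comm[of 6 7] comm[of 5 6] commuting_roots_def)
    show "near 15 ?w" by (rule near_mono[OF near_boxes(3)[OF r4 r5 tau(1,2)]]) auto
  qed (use tau r5 pos c ws in \<open>auto simp: commuting_roots_def mult.commute\<close>)
  have b: "neg_box r4 r5 r = A 6 r (A 5 r5 (A 4 r4 v))" if "r > 0" for r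
    unfolding neg_box_def using r4 r5 that
    by (simp add: A_commute[of 5 4] A_commute[of 6 4] A_commute[of 6 5] commuting_roots_def)
  have "norm (xi r4 r5 (2 * \<tau>) - xi r4 r5 \<tau>) \<le> norm (A 7 \<sigma> (U 6 \<tau> ?w) - A 7 \<sigma> ?w)"
    unfolding xi_def b[OF tau(1)] b[OF mult_pos_pos[OF zero_less_numeral tau(1)]]
    by (rule avg_double_close[OF A_contr]) (use pos tau in auto)
  then show ?thesis using A by simp
qed

text \<open>Roots 7, 4, 5 form a Heisenberg triple only modulo root 6, because 5 and 7 do not
  commute. The corrections along 6 are harmless when \<open>r6\<close> is large enough, which is the
  first inequality in \<open>c\<close>. The first scale \<open>b\<close> along 4 is left
  free.\<close>

lemma raise5:
  fixes \<tau> r4 r6 b :: real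
  assumes tau: "\<tau> > 0" "2 * \<tau> \<le> M" "J * \<tau> \<le> M" and r4: "r4 > 0" "2 * r4 \<le> M" and r6: "r6 > 0" "2 * r6 \<le> M"
    and b: "b > 0" "J * b \<le> r4" and c: "J ^ 3 * P ^ n * \<tau>\<^sup>2 \<le> b * r6" "J\<^sup>2 * P ^ n * \<tau> \<le> b * \<sigma>"
  shows "norm (xi r4 (2 * \<tau>) r6 - xi r4 \<tau> r6) \<le> E"
proof -
  let ?w = "neg_box r4 \<tau> r6"
  have w: "near 15 ?w" by (rule near_mono[OF near_boxes(3)[OF r4 tau(1,2) r6]]) auto
  note ws = disp_box_self[OF r4 tau(1,2) r6]
  \<comment> \<open>The bound on \<open>s\<close> covers both kinds of correction:
    \<open>a^2 * b\<close> from interchanging 4 and 7, and \<open>2 * a * s\<close> from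
    interchanging 5 and 7.\<close>
  have six: "disp (U 6 s) ?w \<le> 4 * L / J" if s: "\<bar>s\<bar> \<le> 4 * J\<^sup>2 * \<tau>\<^sup>2 * P ^ n / b" for s
  proof -
    have "J ^ 3 * P ^ n * \<tau>\<^sup>2 / b \<le> r6" using c(1) b by (simp add: pos_divide_le_eq mult.commute)
    then have "4 / J * (J ^ 3 * P ^ n * \<tau>\<^sup>2 / b) \<le> 4 / J * r6" using J1 by (intro mult_left_mono) auto
    moreover have "4 / J * (J ^ 3 * P ^ n * \<tau>\<^sup>2 / b) = 4 * J\<^sup>2 * \<tau>\<^sup>2 * P ^ n / b" using J1 by (simp add: power2_eq_square power3_eq_cube)
    ultimately have "\<bar>s\<bar> \<le> 4 / J * r6" using s by simp
    then show ?thesis by (intro order_trans[OF ws(3) scaled_bound_J[OF _ r6(1)]])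
  qed
  have "norm (A 7 \<sigma> (U 5 \<tau> ?w) - A 7 \<sigma> ?w)
    \<le> max ((1 - \<delta>) ^ n * L) (40 * (4 * L / J) + 10 * L / J) + 4 * J * \<tau> * P ^ n / (P * b * \<sigma>) * L"
  proof (rule flow_avg_raise[OF uc J1(5,3) b(1) tau(1) pos(1), where x="U 7" and y="\<lambda>b. U 4 (-1 * b)" and z="U 5" and c="U 6"
        and \<kappa>="\<lambda>a b. a\<^sup>2 * b" and \<mu>="\<lambda>a s. 2 * a * s" and w="?w" and n=n])
    show "flow (\<lambda>b. U 4 (-1 * b))" by (rule flow_rescale[OF flowU]) simp
    have c65: "U 6 s (U 5 t q) = U 5 t (U 6 s q)" "U 6 s (U 4 t q) = U 4 t (U 6 s q)" "U 5 s (U 4 t q) = U 4 t (U 5 s q)"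
      "U 6 s (U 7 t q) = U 7 t (U 6 s q)" for s t q
      by (rule comm, simp add: commuting_roots_def)+
    show zx: "U 5 s (U 7 a q) = U 7 a (U 5 s (U 6 (2 * a * s) q))" for a s q by (rule r57)
    show "U 4 (-1 * b) (U 7 a q) = U 5 (- (a * b)) (U 7 a (U 6 (a\<^sup>2 * b) (U 4 (-1 * b) q)))" for a b q
    proof -
      have "U 4 (-1 * b) (U 7 a q) = U 7 a (U 5 (- (a * b)) (U 6 (- (a\<^sup>2 * b)) (U 4 (- b) q)))"
        by (simp add: r47 c65)
      \<comment> \<open>Bringing \<open>U 5\<close> in front of \<open>U 7\<close> adds
        \<open>2 * a^2 * b\<close> to the parameter \<open>- (a^2 * b)\<close> of
        \<open>U 6\<close>, which changes its sign.\<close>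
      also have "\<dots> = U 5 (- (a * b)) (U 7 a (U 6 (a\<^sup>2 * b) (U 4 (- b) q)))"
      proof -
        have "U 6 (2 * a * (- (a * b))) (U 6 (a\<^sup>2 * b) p) = U 6 (- (a\<^sup>2 * b)) p" for p
          by (simp flip: flow_add[OF flowU] add: power2_eq_square algebra_simps)
        then show ?thesis by (simp only: zx)
      qed
      finally show ?thesis by simp
    qed
    show "U 4 (-1 * b) (U 5 s q) = U 5 s (U 4 (-1 * b) q)" for b s q by (rule comm) (simp add: commuting_roots_def)
    show "U 6 b (U 5 s q) = U 5 s (U 6 b q)" for b s q by (rule c65)
    show "disp (U 4 (-1 * (b / P ^ i))) ?w \<le> 4 * L / J" for i
    proof -
      have "1 \<le> P ^ i" using J1 by simp
      then have "b / P ^ i \<le> b / 1" using b J1 by (intro divide_left_mono) auto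
      also have "b / 1 \<le> 1 / J * r4" using b J1 by (simp add: field_simps)
      also have "\<dots> \<le> 4 / J * r4" using r4 J1 by (intro mult_right_mono divide_right_mono) auto
      finally have "\<bar>-1 * (b / P ^ i)\<bar> \<le> 4 / J * r4" using b J1 by simp
      then show ?thesis by (intro order_trans[OF ws(1) scaled_bound_J[OF _ r4(1)]])
    qed
    show "disp (U 6 (a\<^sup>2 * (b / P ^ i))) ?w \<le> 4 * L / J" if "i < n" "0 \<le> a" "a \<le> 2 * J * \<tau> * P ^ i / b" for a i
    proof (rule six)
      have Pi: "P ^ i > 0" "P ^ i \<le> P ^ n" using J1 that by (auto intro: power_increasing)
      have "a\<^sup>2 * (b / P ^ i) \<le> (2 * J * \<tau> * P ^ i / b)\<^sup>2 * (b / P ^ i)"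
        using that b Pi by (intro mult_right_mono power_mono) auto
      also have "\<dots> = 4 * J\<^sup>2 * \<tau>\<^sup>2 * P ^ i / b" using b Pi by (simp add: power2_eq_square)
      also have "\<dots> \<le> 4 * J\<^sup>2 * \<tau>\<^sup>2 * P ^ n / b" using b Pi by (intro divide_right_mono mult_left_mono) auto
      finally show "\<bar>a\<^sup>2 * (b / P ^ i)\<bar> \<le> 4 * J\<^sup>2 * \<tau>\<^sup>2 * P ^ n / b" using b Pi by (simp add: abs_mult)
    qed
    show "disp (U 6 (2 * a * s)) ?w \<le> 4 * L / J"
      if a: "0 \<le> a" "a \<le> 2 * J * \<tau> * P ^ n / (P * b)" and s: "\<bar>s\<bar> \<le> J * \<tau>" for a s
    proof (rule six)
      have "a \<le> 2 * J * \<tau> * P ^ n / (1 * b)"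
        by (rule order_trans[OF a(2)], intro divide_left_mono mult_right_mono) (use J1 b tau in auto)
      then have "2 * a * \<bar>s\<bar> \<le> 2 * (2 * J * \<tau> * P ^ n / b) * (J * \<tau>)"
        using a s tau J1 b by (intro mult_mono) auto
      then show "\<bar>2 * a * s\<bar> \<le> 4 * J\<^sup>2 * \<tau>\<^sup>2 * P ^ n / b" using a by (simp add: abs_mult power2_eq_square mult_ac)
    qed
    show "disp (U 5 s) ?w \<le> 4 * L / J" if "\<bar>s\<bar> \<le> 2 * J * \<tau> / P" for s
    proof -
      have "\<bar>s\<bar> \<le> 2 / J * \<tau>" using that J1 by (simp add: P power2_eq_square)
      also have "\<dots> \<le> 4 / J * \<tau>" using tau J1 by (intro mult_right_mono divide_right_mono) auto
      finally show ?thesis by (intro order_trans[OF ws(2) scaled_bound_J[OF _ tau(1)]])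
    qed
    show "disp (U 5 (J * \<tau>)) ?w \<le> L" "disp (U 5 \<tau>) ?w \<le> L"
      by (intro near_disp(1)[OF w]; use tau in simp)+
  qed (use flowU in simp_all)
  also have "\<dots> \<le> E"
  proof (rule E_bound)
    show "4 * J * \<tau> * P ^ n / (P * b * \<sigma>) \<le> 4 / J"
      by (rule remainder_bound) (use c b pos in auto)
  qed simp
  finally have A: "norm (A 7 \<sigma> (U 5 \<tau> ?w) - A 7 \<sigma> ?w) \<le> E" .
  have b: "neg_box r4 \<tau> r6 = A 5 \<tau> (A 6 r6 (A 4 r4 v))" "neg_box r4 (2 * \<tau>) r6 = A 5 (2 * \<tau>) (A 6 r6 (A 4 r4 v))"
    unfolding neg_box_def using r4 r6 tau
    by (simp_all add: A_commute[of 5 4] A_commute[of 6 4] commuting_roots_def)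
  have "norm (xi r4 (2 * \<tau>) r6 - xi r4 \<tau> r6) \<le> norm (A 7 \<sigma> (U 5 \<tau> ?w) - A 7 \<sigma> ?w)"
    unfolding xi_def b by (rule avg_double_close[OF A_contr]) (use pos tau in auto)
  then show ?thesis using A by simp
qed

end

section \<open>From the small radii to the large ones\<close>

lemma doubling_chain:
  fixes f :: "real \<Rightarrow> 'b::real_normed_vector"
  assumes step: "\<And>\<tau>. \<tau>0 \<le> \<tau> \<Longrightarrow> 2 * \<tau> \<le> 2 ^ m * \<tau>0 \<Longrightarrow> norm (f (2 * \<tau>) - f \<tau>) \<le> E" and t: "\<tau>0 > 0"
  shows "norm (f (2 ^ m * \<tau>0) - f \<tau>0) \<le> m * E"
proof -
  have "norm (f (2 ^ k * \<tau>0) - f \<tau>0) \<le> k * E" if "k \<le> m" for k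
    using that
  proof (induction k)
    case 0 then show ?case by simp
  next
    case (Suc k)
    have "(2::real) ^ Suc k \<le> 2 ^ m" using Suc.prems by (intro power_increasing) auto
    moreover have "(1::real) \<le> 2 ^ k" by simp
    ultimately have "norm (f (2 * (2 ^ k * \<tau>0)) - f (2 ^ k * \<tau>0)) \<le> E"
      using t by (intro step) (auto simp: mult_right_mono)
    moreover have "norm (f (2 ^ k * \<tau>0) - f \<tau>0) \<le> k * E" using Suc by simp
    ultimately have "norm (f (2 * (2 ^ k * \<tau>0)) - f \<tau>0) \<le> E + k * E" by (rule norm_diff_triangle_le)
    then show ?case by (simp add: algebra_simps)
  qed
  then show ?thesis by simp
qed

text \<open>All sizes are powers of a \<open>q\<close> that dominates the loss
  \<open>J^3 * P^n\<close> of a doubling. \<open>\<sigma> = q^4\<close> serves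
  \<open>raise_round\<close>; \<open>\<Theta> = q^14\<close> exceeds \<open>q^5 * \<sigma>^2\<close>
  by one factor \<open>q\<close>, as \<open>disp_xi_at_0\<close> demands;
  \<open>M = q * \<Theta>\<close> bounds all radii together with factors 2 and
  \<open>J\<close>.\<close>

locale root_flows_final = root_flows_raise U T0 T3 \<eta> l M L \<sigma> \<Theta> \<delta> n J P E
  for U :: "nat \<Rightarrow> real \<Rightarrow> 'b::banach \<Rightarrow> 'b" and T0 T3 :: "real \<Rightarrow> 'b \<Rightarrow> 'b" and \<eta> :: 'b and l M L \<sigma> \<Theta> \<delta> :: real
    and n J :: nat and P E :: real +
  fixes q :: real and m :: nat
  assumes q: "q = 2 ^ m" "q \<ge> 32" "J ^ 3 * P ^ n \<le> q" and sq: "\<sigma> = q ^ 4" and Tq: "\<Theta> = q ^ 14" and Mq: "M = q ^ 15"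
begin

lemma q0: "q > 0" "q \<ge> 1" using q by auto

lemma Jq: "J \<le> q" "J\<^sup>2 * P ^ n \<le> q"
proof -
  have 1: "real J ^ 2 * P ^ n \<le> real J ^ 3 * P ^ n" using J1 by (intro mult_right_mono power_increasing) auto
  then show "J\<^sup>2 * P ^ n \<le> q" using q(3) by simp
  have "real J * 1 \<le> real J ^ 2 * P ^ n" using J1 by (intro mult_mono self_le_power) auto
  then show "J \<le> q" using 1 q(3) by simp
qed

lemma E0: "0 \<le> E" unfolding E using d L0 by simp

text \<open>Roots 4 and 6 go from \<open>r * q^2\<close> to \<open>r * q^3\<close> while 5 still has
  radius \<open>r\<close>: this asks for \<open>q * r * q^3 \<le> \<sigma> * r\<close>. Then 5 can
  go from \<open>r\<close> to \<open>r * q\<close>, as \<open>r6\<close> is now large enough. The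
  final radii have the initial shape with \<open>r * q\<close> for \<open>r\<close>, so rounds can
  be iterated.\<close>

lemma raise_round:
  assumes r: "r > 0" "r \<le> q ^ 6"
  shows "norm (xi (r * q ^ 3) (r * q) (r * q ^ 3) - xi (r * q\<^sup>2) r (r * q\<^sup>2)) \<le> 3 * m * E"
proof -
  have big: "2 * \<tau> \<le> M" "J * \<tau> \<le> M" if "\<tau> \<le> r * q ^ 3" "\<tau> > 0" for \<tau> :: real
  proof -
    have "r * q ^ 3 \<le> q ^ 6 * q ^ 3" using r q0 by (intro mult_right_mono) auto
    then have t: "\<tau> \<le> q ^ 9" using that by (simp flip: power_add)
    have 10: "q * q ^ 9 \<le> M" unfolding Mq power_Suc[symmetric] using q0 by (intro power_increasing) auto
    have "c * \<tau> \<le> M" if "c \<le> q" for c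
    proof -
      have "c * \<tau> \<le> q * q ^ 9" using that t \<open>\<tau> > 0\<close> q0 by (intro mult_mono) auto
      then show ?thesis using 10 by linarith
    qed
    then show "2 * \<tau> \<le> M" "J * \<tau> \<le> M" using Jq(1) q(2) by auto
  qed
  have le: "r \<le> r * q ^ 3" "r * q \<le> r * q ^ 3" "r * q\<^sup>2 \<le> r * q ^ 3"
    using r q0 by (auto simp: power_increasing self_le_power)
  have e: "2 ^ m * (r * q\<^sup>2) = r * q ^ 3" "2 ^ m * r = r * q" using q(1) by (auto simp: power2_eq_square power3_eq_cube)
  have c46: "J ^ 3 * P ^ n * \<tau> \<le> \<sigma> * r" if "2 * \<tau> \<le> r * q ^ 3" "\<tau> > 0" for \<tau> :: real
  proof -
    have "J ^ 3 * P ^ n * \<tau> \<le> q * (r * q ^ 3)" using that q q0 by (intro mult_mono) auto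
    then show ?thesis by (simp add: sq power_numeral_reduce mult_ac)
  qed
  have rM: "r * q ^ 3 > 0" "2 * (r * q ^ 3) \<le> M" "r * q\<^sup>2 > 0" "2 * (r * q\<^sup>2) \<le> M" "2 * r \<le> M"
    using r q0 big(1)[of "r * q ^ 3"] big(1)[OF le(3)] big(1)[OF le(1)] by simp_all
  have "norm (xi (2 ^ m * (r * q\<^sup>2)) r (r * q\<^sup>2) - xi (r * q\<^sup>2) r (r * q\<^sup>2)) \<le> m * E"
  proof (rule doubling_chain[where f="\<lambda>\<tau>. xi \<tau> r (r * q\<^sup>2)"])
    fix \<tau> assume t: "r * q\<^sup>2 \<le> \<tau>" "2 * \<tau> \<le> 2 ^ m * (r * q\<^sup>2)"
    then have "\<tau> > 0" using rM by linarith
    then show "norm (xi (2 * \<tau>) r (r * q\<^sup>2) - xi \<tau> r (r * q\<^sup>2)) \<le> E"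
      using big[of \<tau>] t c46[of \<tau>] r rM unfolding e by (intro raise4) auto
  qed (rule rM)
  then have 1: "norm (xi (r * q ^ 3) r (r * q\<^sup>2) - xi (r * q\<^sup>2) r (r * q\<^sup>2)) \<le> m * E" unfolding e .
  have "norm (xi (r * q ^ 3) r (2 ^ m * (r * q\<^sup>2)) - xi (r * q ^ 3) r (r * q\<^sup>2)) \<le> m * E"
  proof (rule doubling_chain[where f="\<lambda>\<tau>. xi (r * q ^ 3) r \<tau>"])
    fix \<tau> assume t: "r * q\<^sup>2 \<le> \<tau>" "2 * \<tau> \<le> 2 ^ m * (r * q\<^sup>2)"
    then have "\<tau> > 0" using rM by linarith
    then show "norm (xi (r * q ^ 3) r (2 * \<tau>) - xi (r * q ^ 3) r \<tau>) \<le> E"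
      using big[of \<tau>] t c46[of \<tau>] r rM unfolding e by (intro raise6) auto
  qed (rule rM)
  then have 2: "norm (xi (r * q ^ 3) r (r * q ^ 3) - xi (r * q ^ 3) r (r * q\<^sup>2)) \<le> m * E" unfolding e .
  have "norm (xi (r * q ^ 3) (2 ^ m * r) (r * q ^ 3) - xi (r * q ^ 3) r (r * q ^ 3)) \<le> m * E"
  proof (rule doubling_chain[where f="\<lambda>\<tau>. xi (r * q ^ 3) \<tau> (r * q ^ 3)"])
    fix \<tau> assume t: "r \<le> \<tau>" "2 * \<tau> \<le> 2 ^ m * r"
    have tp: "\<tau> > 0" using t r by linarith
    have t2: "\<tau> \<le> r * q" using t tp unfolding e by linarith
    show "norm (xi (r * q ^ 3) (2 * \<tau>) (r * q ^ 3) - xi (r * q ^ 3) \<tau> (r * q ^ 3)) \<le> E"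
    proof (rule raise5[where b=r])
      have "\<tau> \<le> r * q ^ 3" using t2 le by linarith
      then show "2 * \<tau> \<le> M" "J * \<tau> \<le> M" using big tp by auto
      have "J * r \<le> q ^ 3 * r" using Jq r self_le_power[of q 3] q0 by (intro mult_right_mono) auto
      then show "J * r \<le> r * q ^ 3" by (simp add: mult.commute)
      have "J ^ 3 * P ^ n * \<tau>\<^sup>2 \<le> q * (r * q)\<^sup>2" using q q0 t2 tp by (intro mult_mono power_mono) auto
      then show "J ^ 3 * P ^ n * \<tau>\<^sup>2 \<le> r * (r * q ^ 3)" by (simp add: power2_eq_square power3_eq_cube mult_ac)
      have "J\<^sup>2 * P ^ n * \<tau> \<le> q * (r * q)" using Jq q0 t2 tp by (intro mult_mono) auto
      also have "\<dots> = r * q ^ 2" by (simp add: power2_eq_square mult_ac)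
      also have "\<dots> \<le> r * \<sigma>" unfolding sq using r q0 by (intro mult_left_mono power_increasing) auto
      finally show "J\<^sup>2 * P ^ n * \<tau> \<le> r * \<sigma>" .
    qed (use tp rM r in auto)
  qed (rule r)
  then have 3: "norm (xi (r * q ^ 3) (r * q) (r * q ^ 3) - xi (r * q ^ 3) r (r * q ^ 3)) \<le> m * E" unfolding e .
  show ?thesis using norm_diff_triangle_le[OF 3 norm_diff_triangle_le[OF 2 1]] by (simp add: mult_ac)
qed

text \<open>The scale q^(k - 12), a quotient because exponents are natural numbers, runs from
  q^(-12), where root 0 is under control, to q^7 at \<open>k = 19\<close>, where the negative roots
  are. The 19 rounds of three chains explain the factor 57 below.\<close>

definition "xi_at k = xi (q ^ k / q ^ 12 * q\<^sup>2) (q ^ k / q ^ 12) (q ^ k / q ^ 12 * q\<^sup>2)"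

lemma xi_at_close: assumes "k \<le> 19" shows "norm (xi_at k - xi_at 0) \<le> 3 * m * E * k"
  using assms
proof (induction k)
  case 0 then show ?case by simp
next
  case (Suc k)
  let ?r = "q ^ k / q ^ 12"
  have "q ^ k \<le> q ^ 18" using Suc.prems q0 by (intro power_increasing) auto
  also have "q ^ 18 = q ^ 6 * q ^ 12" by (simp flip: power_add)
  finally have "?r \<le> q ^ 6" using q0 by (simp add: pos_divide_le_eq)
  then have "norm (xi (?r * q ^ 3) (?r * q) (?r * q ^ 3) - xi (?r * q\<^sup>2) ?r (?r * q\<^sup>2)) \<le> 3 * m * E"
    using q0 by (intro raise_round) auto
  then have "norm (xi_at (Suc k) - xi_at k) \<le> 3 * m * E"
    by (simp add: xi_at_def power2_eq_square power3_eq_cube mult_ac)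
  then have "norm (xi_at (Suc k) - xi_at 0) \<le> 3 * m * E + 3 * m * E * k"
    using Suc by (intro norm_diff_triangle_le) auto
  then show ?case by (simp add: algebra_simps)
qed

lemma disp_from_xi_19:
  assumes "contraction_map g" "disp g (xi_at 19) \<le> 3 / q * L"
  shows "disp g (xi_at 0) \<le> 3 * (L / q + 57 * m * E)"
proof -
  have "norm (xi_at 0 - xi_at 19) \<le> 57 * m * E" using xi_at_close[of 19] by (simp add: norm_minus_commute)
  moreover have "0 \<le> m * E" using E0 by simp
  ultimately show ?thesis using disp_near[OF assms(1), of "xi_at 0" "xi_at 19"] assms(2) by simp
qed

lemma q_powers: "q ^ k / q ^ j \<le> 1 / q" if "k < j"
proof -
  have "q ^ Suc k \<le> q ^ j" using that q0 by (intro power_increasing) auto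
  then show ?thesis using q0 by (simp add: field_simps)
qed

text \<open>At stage 19 the radii are \<open>q^9\<close>, \<open>q^7\<close>, \<open>q^9\<close>,
  and the critical terms, such as \<open>\<sigma>^2 / r6 = q^8 / q^9\<close>, are just
  \<open>1 / q\<close>.\<close>

lemma disp_xi_at:
  assumes t: "\<bar>t\<bar> \<le> 1" and i: "i \<in> {4, 5, 6, 7}"
  shows "disp (U i t) (xi_at 0) \<le> 3 * (L / q + 57 * m * E)"
proof (rule disp_from_xi_19)
  show "contraction_map (U i t)" using i by (intro contr) auto
  have r: "q ^ 19 / q ^ 12 = q ^ 7" "q ^ 19 / q ^ 12 * q\<^sup>2 = q ^ 9" using q0 by (auto simp: field_simps simp flip: power_add)
  have M: "q ^ 7 > 0" "2 * q ^ 7 \<le> M" "q ^ 9 > 0" "2 * q ^ 9 \<le> M"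
  proof -
    have "2 * q ^ k \<le> M" if "k < 15" for k
    proof -
      have "2 * q ^ k \<le> q * q ^ k" using q by simp
      also have "\<dots> \<le> M" unfolding Mq using that q0 by (simp flip: power_Suc add: power_increasing)
      finally show ?thesis .
    qed
    then show "2 * q ^ 7 \<le> M" "2 * q ^ 9 \<le> M" by auto
  qed (use q0 in auto)
  note D = disp_xi_neg[OF M(3,4) M(1,2) M(3,4) t]
  have p: "1 / q ^ 4 \<le> 1 / q" "1 / q ^ 7 \<le> 1 / q" "1 / q ^ 9 \<le> 1 / q" "q ^ 4 / q ^ 9 \<le> 1 / q" "q ^ 4 / q ^ 7 \<le> 1 / q" "q ^ 8 / q ^ 9 \<le> 1 / q"
    using q_powers[of 0 4] q_powers[of 0 7] q_powers[of 0 9] q_powers[of 4 9] q_powers[of 4 7] q_powers[of 8 9] by auto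
  have q1: "1 / q \<le> 3 / q" using q0 by (intro divide_right_mono) auto
  have "1 / \<sigma> \<le> 3 / q" "1 / q ^ 9 \<le> 3 / q" unfolding sq using p q1 by linarith+
  moreover have "2 * \<sigma> / q ^ 9 + 1 / q ^ 7 \<le> 3 / q" unfolding sq using p(2,4) by simp
  moreover have "1 / q ^ 9 + \<sigma> / q ^ 7 + \<sigma>\<^sup>2 / q ^ 9 \<le> 3 / q" unfolding sq using p(3,5,6) by (simp flip: power_mult)
  ultimately have "1 / \<sigma> * L \<le> 3 / q * L" "1 / q ^ 9 * L \<le> 3 / q * L" "(2 * \<sigma> / q ^ 9 + 1 / q ^ 7) * L \<le> 3 / q * L"
    "(1 / q ^ 9 + \<sigma> / q ^ 7 + \<sigma>\<^sup>2 / q ^ 9) * L \<le> 3 / q * L"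
    using L0 by (auto intro: mult_right_mono simp del: times_divide_eq_left)
  then show "disp (U i t) (xi_at 19) \<le> 3 / q * L"
    using i D unfolding xi_at_def r by (auto elim: order_trans)
qed

lemma xi0_radii: "1 / q ^ 12 > 0" "2 * (1 / q ^ 12) \<le> M" "1 / q ^ 12 * q\<^sup>2 > 0" "2 * (1 / q ^ 12 * q\<^sup>2) \<le> M"
proof -
  have "2 \<le> q * 1" using q by simp
  also have "q * 1 \<le> M" unfolding Mq using q0 by (simp add: self_le_power)
  finally have M2: "2 \<le> M" .
  have "1 / q ^ 12 \<le> 1" using q0 by simp
  then show "2 * (1 / q ^ 12) \<le> M" using M2 by linarith
  have "1 / q ^ 12 * q\<^sup>2 = 1 / q ^ 10" using q0 by (simp add: field_simps flip: power_add)
  moreover have "1 / q ^ 10 \<le> 1" using q0 by simp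
  ultimately show "2 * (1 / q ^ 12 * q\<^sup>2) \<le> M" using M2 by linarith
qed (use q0 in auto)

text \<open>Parameters up to \<open>q^5\<close> are needed to produce a large torus element in
  \<open>disp_xi_at_3\<close>. The critical term is
  \<open>q^5 * \<sigma>^2 / \<Theta> = 1 / q\<close>.\<close>

lemma disp_xi_at_0: assumes s: "\<bar>s\<bar> \<le> q ^ 5" shows "disp (U 0 s) (xi_at 0) \<le> 300 * (L / q)"
proof -
  let ?a = "1 / q ^ 12 * q\<^sup>2" and ?b = "1 / q ^ 12"
  have eq: "q ^ 5 * ?a = q ^ 0 / q ^ 5" "q ^ 5 * ?b * q ^ 4 = q ^ 0 / q ^ 3" "q ^ 5 * (?b\<^sup>2 / ?a) = q ^ 0 / q ^ 9" "q ^ 5 * ((q ^ 4)\<^sup>2 / q ^ 14) = 1 / q"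
  proof -
    have "q ^ 14 = q ^ 5 * (q ^ 4)\<^sup>2 * q" by algebra
    then show "q ^ 5 * ((q ^ 4)\<^sup>2 / q ^ 14) = 1 / q" using q0 by simp
  qed (use q0 in \<open>simp_all add: field_simps flip: power_add power_mult\<close>)
  have p: "q ^ 0 / q ^ 5 \<le> 1 / q" "q ^ 0 / q ^ 3 \<le> 1 / q" "q ^ 0 / q ^ 9 \<le> 1 / q" by (intro q_powers; simp)+
  have q32: "1 / q \<le> 1 / 16" using q by simp
  have "disp (U 0 s) (xi_at 0) \<le> \<bar>s\<bar> * (122 * ?a + 2 * (?b\<^sup>2 / ?a + 84 * ?b * \<sigma> + 3 * \<sigma>\<^sup>2 / \<Theta>)) * L"
    unfolding xi_at_def power_0
  proof (rule disp_xi_0[OF xi0_radii(3,4) xi0_radii(1,2) xi0_radii(3,4)])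
    have "\<bar>s\<bar> * ?a \<le> q ^ 5 * ?a" using s xi0_radii by (intro mult_right_mono) auto
    then show "\<bar>s\<bar> * ?a \<le> 1/8" using eq(1) p(1) q32 by linarith
    have "\<bar>s\<bar> * ?b * \<sigma> \<le> q ^ 5 * ?b * q ^ 4" unfolding sq using s xi0_radii q0 by (intro mult_right_mono) auto
    then show "\<bar>s\<bar> * ?b * \<sigma> \<le> 1/16" using eq(2) p(2) q32 by linarith
  qed
  also have "\<bar>s\<bar> * (122 * ?a + 2 * (?b\<^sup>2 / ?a + 84 * ?b * \<sigma> + 3 * \<sigma>\<^sup>2 / \<Theta>)) * L
     \<le> q ^ 5 * (122 * ?a + 2 * (?b\<^sup>2 / ?a + 84 * ?b * \<sigma> + 3 * \<sigma>\<^sup>2 / \<Theta>)) * L"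
    using s xi0_radii(1,3) pos L0 by (intro mult_right_mono) auto
  also have "q ^ 5 * (122 * ?a + 2 * (?b\<^sup>2 / ?a + 84 * ?b * \<sigma> + 3 * \<sigma>\<^sup>2 / \<Theta>))
     = 122 * (q ^ 5 * ?a) + 2 * (q ^ 5 * (?b\<^sup>2 / ?a) + 84 * (q ^ 5 * ?b * q ^ 4) + 3 * (q ^ 5 * ((q ^ 4)\<^sup>2 / q ^ 14)))"
    unfolding sq Tq by (simp only: distrib_left mult_ac times_divide_eq_right)
  also have "\<dots> \<le> 122 * (1 / q) + 2 * (1 / q + 84 * (1 / q) + 3 * (1 / q))"
    unfolding eq by (intro add_mono mult_left_mono p order_refl) auto
  also have "\<dots> \<le> 300 * (1 / q)" using q0 by (simp add: divide_right_mono)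
  finally show ?thesis using L0 by (simp add: mult_right_mono)
qed

text \<open>Only tiny parameters are reached directly, because the outer average along the opposite
  root 7 has radius \<open>\<sigma> = q^4\<close>.\<close>

lemma disp_xi_at_3_small: assumes t: "\<bar>t\<bar> \<le> 1 / q ^ 5" shows "disp (U 3 t) (xi_at 0) \<le> 148 * (L / q)"
proof -
  have e: "1 / q ^ 5 * q ^ 4 = 1 / q" using q0 by (simp add: field_simps flip: power_Suc)
  have ts: "\<bar>t\<bar> * \<sigma> \<le> 1 / q" unfolding sq e[symmetric] using t q0 by (intro mult_right_mono) auto
  have "disp (U 3 t) (xi_at 0) \<le> 148 * \<bar>t\<bar> * \<sigma> * L"
    unfolding xi_at_def power_0
  proof (rule disp_xi_3[OF xi0_radii(3,4) xi0_radii(1,2) xi0_radii(3,4)])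
    have "1 / q \<le> 1 / 8" using q(2) by (intro divide_left_mono) auto
    then show "\<bar>t\<bar> * \<sigma> \<le> 1/8" using ts by linarith
    show "1 / q ^ 12 * q\<^sup>2 \<le> 1 / q ^ 12 * \<sigma>" unfolding sq using q0 by (intro mult_left_mono power_increasing) auto
    show "1 / q ^ 12 \<le> 1 / q ^ 12 * q\<^sup>2" using q0 xi0_radii(1) one_le_power[of q 2] mult_left_mono[of 1 "q\<^sup>2" "1 / q ^ 12"] by simp
  qed simp
  also have "\<dots> = 148 * (\<bar>t\<bar> * \<sigma>) * L" by simp
  also have "\<dots> \<le> 148 * (1 / q) * L" using ts L0 by (intro mult_right_mono mult_left_mono) auto
  finally show ?thesis by simp
qed

text \<open>Near-invariance under the opposite roots 0 and 4 at reciprocal scales yields near-invariance under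
  a large torus element, which magnifies the small invariance under root 3.\<close>

lemma disp_xi_at_3: assumes t: "\<bar>t\<bar> \<le> 1" shows "disp (U 3 t) (xi_at 0) \<le> 1360 * (L / q + 57 * m * E)"
proof -
  let ?s = "q ^ 5" let ?a = "ln (1 + ?s * 1)" and ?x = "xi_at 0"
  let ?B = "L / q + 57 * m * E"
  have LB: "L / q \<le> ?B" "0 \<le> ?B" "0 \<le> m * E" using E0 L0 q0 by auto
  have s0: "1 + ?s * 1 > 0" "?s \<ge> 0" using q0 by (auto simp: add_pos_pos)
  \<comment> \<open>The Gauss decomposition solved for its torus factor, with parameter
    \<open>q^5\<close> along root 0 and 1 along root 4.\<close>
  have T: "T0 ?a p = U 4 (- (1 / (1 + ?s * 1))) (U 0 ?s (U 4 1 (U 0 (- (?s / (1 + ?s * 1))) p)))" for p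
    by (simp only: mob04[OF s0(1)] inv zero_less_numeral less_numeral_extra)
  have s1: "\<bar>?s\<bar> \<le> q ^ 5" "\<bar>- (?s / (1 + ?s * 1))\<bar> \<le> q ^ 5" "\<bar>- (1 / (1 + ?s * 1))\<bar> \<le> 1"
  proof -
    have "?s / (1 + ?s * 1) \<le> 1" by (subst pos_divide_le_eq[OF s0(1)]) simp
    also have "1 \<le> q ^ 5" using q0 by simp
    finally show "\<bar>- (?s / (1 + ?s * 1))\<bar> \<le> q ^ 5" using s0 by simp
    have "1 / (1 + ?s * 1) \<le> 1 / 1" by (intro divide_left_mono mult_pos_pos s0(1)) (use s0(2) in auto)
    moreover have "0 \<le> 1 / (1 + ?s * 1)" by (rule divide_nonneg_pos[OF _ s0(1)]) simp
    ultimately show "\<bar>- (1 / (1 + ?s * 1))\<bar> \<le> 1" by linarith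
  qed (use s0 q0 in auto)
  have "disp (T0 ?a) ?x \<le> disp (U 4 (- (1 / (1 + ?s * 1)))) ?x + (disp (U 0 ?s) ?x + (disp (U 4 1) ?x + disp (U 0 (- (?s / (1 + ?s * 1)))) ?x))"
    unfolding T by (intro order_trans[OF disp2] add_mono order_refl) auto
  also have "\<dots> \<le> 3 * ?B + (300 * (L / q) + (3 * ?B + 300 * (L / q)))"
    by (intro add_mono disp_xi_at disp_xi_at_0 s1) auto
  also have "\<dots> \<le> 606 * ?B" using LB by simp
  finally have dT: "disp (T0 ?a) ?x \<le> 606 * ?B" .
  have dT': "disp (T0 (- ?a)) ?x \<le> 606 * ?B" using dT flow_disp_minus[OF flowT0, of ?a ?x] by simp
  \<comment> \<open>Root 3 has weight -1 under \<open>T0\<close>, so conjugation shrinks the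
    parameter by the factor \<open>1 / (1 + q^5)\<close>, into the range of
    \<open>disp_xi_at_3_small\<close>.\<close>
  let ?t = "exp (weight0 3 * ?a) * t"
  have t': "\<bar>?t\<bar> \<le> 1 / q ^ 5"
  proof -
    have "weight0 3 * ?a = - ?a" by (simp add: weight0_def)
    then have "exp (weight0 3 * ?a) = 1 / (1 + ?s)" by (simp only: exp_minus exp_ln[OF s0(1)]) (simp add: divide_inverse)
    also have "\<dots> \<le> 1 / q ^ 5" using q0 by (intro divide_left_mono mult_pos_pos) (use s0(1) in auto)
    finally have "exp (weight0 3 * ?a) * \<bar>t\<bar> \<le> 1 / q ^ 5 * 1" using t q0 by (intro mult_mono) auto
    then show ?thesis by (simp add: abs_mult)
  qed
  have "U 3 t ?x = T0 (- ?a) (U 3 ?t (T0 ?a ?x))" using T0U[of 3 ?a t ?x] flow_inverse(1)[OF flowT0, of ?a "U 3 t ?x"] by simp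
  then have "disp (U 3 t) ?x \<le> disp (T0 (- ?a)) ?x + norm (U 3 ?t (T0 ?a ?x) - ?x)"
    using disp_comp[of "T0 (- ?a)" "\<lambda>p. U 3 ?t (T0 ?a p)" ?x, OF flow_contraction[OF flowT0]] by simp
  also have "\<dots> \<le> disp (T0 (- ?a)) ?x + (disp (U 3 ?t) ?x + disp (T0 ?a) ?x)"
    by (intro add_mono order_refl disp2) auto
  also have "\<dots> \<le> 606 * ?B + (148 * (L / q) + 606 * ?B)" by (intro add_mono dT dT' disp_xi_at_3_small t')
  also have "\<dots> \<le> 1360 * ?B" using LB by simp
  finally show ?thesis .
qed

lemma disp_xi_at_all:
  assumes t: "\<bar>t\<bar> \<le> 1" and i: "i < 8"
  shows "disp (U i t) (xi_at 0) \<le> 10000 * (L / q + 57 * m * E)"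
proof -
  let ?B = "L / q + 57 * m * E" and ?x = "xi_at 0"
  have LB: "L / q \<le> ?B" "0 \<le> ?B" "0 \<le> m * E" using E0 L0 q0 by auto
  have q5: "1 \<le> q ^ 5" using q0 by simp
  have d0: "disp (U 0 s) ?x \<le> 300 * ?B" if "\<bar>s\<bar> \<le> 1" for s
    using disp_xi_at_0[of s] that q5 LB by simp
  have d3: "disp (U 3 s) ?x \<le> 1360 * ?B" if "\<bar>s\<bar> \<le> 1" for s using disp_xi_at_3[OF that] .
  \<comment> \<open>The commutator of 0 and 3 produces roots 1 and 2 together; varying the signs of
    \<open>s\<close> and \<open>c\<close> will separate them.\<close>
  have X: "U 1 (- (s * c)) (U 2 (s * c\<^sup>2) p) = U 0 (- s) (U 3 (- c) (U 0 s (U 3 c p)))" for s c p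
    by (simp add: r03 inv)
  have dX: "norm (U 1 (- (s * c)) (U 2 (s * c\<^sup>2) ?x) - ?x) \<le> 3320 * ?B" if "\<bar>s\<bar> \<le> 1" "\<bar>c\<bar> \<le> 1" for s c
  proof -
    have "norm (U 1 (- (s * c)) (U 2 (s * c\<^sup>2) ?x) - ?x) \<le> disp (U 0 (- s)) ?x + (disp (U 3 (- c)) ?x + (disp (U 0 s) ?x + disp (U 3 c) ?x))"
      unfolding X by (intro order_trans[OF disp2] add_mono order_refl) auto
    also have "\<dots> \<le> 300 * ?B + (1360 * ?B + (300 * ?B + 1360 * ?B))" by (intro add_mono d0 d3) (use that in auto)
    finally show ?thesis by (simp add: mult_ac)
  qed
  have d1: "disp (U 1 s) ?x \<le> 6640 * ?B" if s: "\<bar>s\<bar> \<le> 1" for s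
  proof -
    \<comment> \<open>The parameter pairs \<open>(- s/2, 1)\<close> and \<open>(s/2, - 1)\<close>
      make the parts along root 2 cancel and those along root 1 add up.\<close>
    have "U 1 s p = U 1 (- (- (s/2) * 1)) (U 2 (- (s/2) * 1\<^sup>2) (U 1 (- (s/2 * - 1)) (U 2 (s/2 * (- 1)\<^sup>2) p)))" for p
    proof -
      have "U 2 (- (s/2)) (U 1 (s/2) r) = U 1 (s/2) (U 2 (- (s/2)) r)" for r by (rule comm) (simp add: commuting_roots_def)
      then have "U 1 (s/2) (U 2 (- (s/2)) (U 1 (s/2) (U 2 (s/2) p))) = U 1 (s/2) (U 1 (s/2) p)" by (simp add: inv)
      also have "\<dots> = U 1 s p" by (simp flip: flow_add[OF flowU])
      finally show ?thesis by simp
    qed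
    then have "disp (U 1 s) ?x \<le> norm (U 1 (- (- (s/2) * 1)) (U 2 (- (s/2) * 1\<^sup>2) ?x) - ?x) + norm (U 1 (- (s/2 * - 1)) (U 2 (s/2 * (- 1)\<^sup>2) ?x) - ?x)"
      using disp_comp[of "\<lambda>p. U 1 (- (- (s/2) * 1)) (U 2 (- (s/2) * 1\<^sup>2) p)" "\<lambda>p. U 1 (- (s/2 * - 1)) (U 2 (s/2 * (- 1)\<^sup>2) p)" ?x]
        contraction_map_comp[OF contr[of 1] contr[of 2]] by simp
    also have "\<dots> \<le> 3320 * ?B + 3320 * ?B" by (intro add_mono dX) (use s in auto)
    finally show ?thesis by (simp add: mult_ac)
  qed
  have d2: "disp (U 2 t) ?x \<le> 9960 * ?B"
  proof -
    have "U 2 t p = U 1 t (U 1 (- (t * 1)) (U 2 (t * 1\<^sup>2) p))" for p by (simp add: inv)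
    then have "disp (U 2 t) ?x \<le> disp (U 1 t) ?x + norm (U 1 (- (t * 1)) (U 2 (t * 1\<^sup>2) ?x) - ?x)"
      using disp2[of 1 t "\<lambda>p. U 1 (- (t * 1)) (U 2 (t * 1\<^sup>2) p)" ?x] by simp
    also have "\<dots> \<le> 6640 * ?B + 3320 * ?B" by (intro add_mono dX d1) (use t in auto)
    finally show ?thesis by (simp add: mult_ac)
  qed
  consider "i = 0" | "i = 1" | "i = 2" | "i = 3" | "i \<in> {4,5,6,7}" using i unfolding less_8_cases by blast
  then show ?thesis
  proof cases
    case 1 then show ?thesis using d0[OF t] LB by simp
  next
    case 2 then show ?thesis using d1[OF t] LB by simp
  next
    case 3 then show ?thesis using d2 LB by simp
  next
    case 4 then show ?thesis using d3[OF t] LB by simp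
  next
    case 5 then show ?thesis using disp_xi_at[OF t 5] LB by simp
  qed
qed

lemma near_xi_at: "norm (xi_at 0 - \<eta>) \<le> 11 * l"
  using near_boxes(6)[OF xi0_radii(3,4) xi0_radii(1,2) xi0_radii(3,4)] by (simp add: near_def xi_at_def)

end

section \<open>Contraction of the displacement\<close>

text \<open>With \<open>c = 1\<close> and \<open>1 + s = exp t\<close> the Gauss decomposition
  writes the torus element as a product of four unipotents. As \<open>s \<le> 2\<close>, one of them
  costs \<open>2 * D\<close> and the other three \<open>D\<close> each.\<close>

lemma torus_from_moebius:
  fixes f g T :: "real \<Rightarrow> 'b::banach \<Rightarrow> 'b"
  assumes f: "flow f" and g: "flow g" and T: "flow T"
    and mob: "\<And>s c q. 1 + s * c > 0 \<Longrightarrow> f s (g c q) = g (c / (1 + s * c)) (T (ln (1 + s * c)) (f (s / (1 + s * c)) q))"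
    and df: "\<And>t. \<bar>t\<bar> \<le> 1 \<Longrightarrow> disp (f t) \<eta> \<le> D" and dg: "\<And>t. \<bar>t\<bar> \<le> 1 \<Longrightarrow> disp (g t) \<eta> \<le> D"
    and t: "\<bar>t\<bar> \<le> 1"
  shows "disp (T t) \<eta> \<le> 5 * D"
proof -
  have pos: "disp (T t) \<eta> \<le> 5 * D" if t: "0 \<le> t" "t \<le> 1" for t
  proof -
    define s where "s = exp t - 1"
    have "t\<^sup>2 \<le> 1" using t by (simp add: power_le_one)
    then have s: "0 \<le> s" "s \<le> 2" "1 + s = exp t" using t exp_bound[of t] by (auto simp: s_def)
    have p: "1 + s * 1 > 0" using s by simp
    have T1: "T t q = g (- (1 / (1 + s))) (f s (g 1 (f (- (s / (1 + s))) q)))" for q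
      using mob[OF p, of "f (- (s / (1 + s))) q"] flow_inverse[OF f] flow_inverse[OF g] s by simp
    have fs: "disp (f s) \<eta> \<le> 2 * D"
    proof -
      have "f s \<eta> = f (s/2) (f (s/2) \<eta>)" by (simp flip: flow_add[OF f])
      then have "disp (f s) \<eta> \<le> disp (f (s/2)) \<eta> + disp (f (s/2)) \<eta>"
        using disp_comp[OF flow_contraction[OF f], of "s/2" "f (s/2)" \<eta>] by simp
      also have "\<dots> \<le> D + D" using s by (intro add_mono df) auto
      finally show ?thesis by simp
    qed
    have b: "\<bar>- (1 / (1 + s))\<bar> \<le> 1" "\<bar>- (s / (1 + s))\<bar> \<le> 1" using s(1) by auto
    have "disp (T t) \<eta> \<le> disp (g (- (1 / (1 + s)))) \<eta> + (disp (f s) \<eta> + (disp (g 1) \<eta> + disp (f (- (s / (1 + s)))) \<eta>))"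
      unfolding T1 by (intro order_trans[OF disp_comp] add_mono order_refl flow_contraction[OF f] flow_contraction[OF g])
    also have "\<dots> \<le> D + (2 * D + (D + D))" by (intro add_mono df dg fs b) auto
    finally show ?thesis by simp
  qed
  show ?thesis
  proof (cases "t \<ge> 0")
    case True then show ?thesis using pos t by simp
  next
    case False then show ?thesis using pos[of "-t"] t flow_disp_minus[OF T, of t \<eta>] by simp
  qed
qed

section \<open>Growth of displacements and iteration\<close>

context root_flows
begin

definition disp_le :: "'b \<Rightarrow> real \<Rightarrow> bool" where
  "disp_le x D \<longleftrightarrow> (\<forall>i<8. \<forall>t. \<bar>t\<bar> \<le> 1 \<longrightarrow> disp (U i t) x \<le> D)"

lemma torus_growth:
  assumes D: "disp_le \<eta> D" and t: "\<bar>t\<bar> \<le> 1"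
  shows "disp (T0 t) \<eta> \<le> 5 * D" "disp (T3 t) \<eta> \<le> 5 * D"
proof -
  show "disp (T0 t) \<eta> \<le> 5 * D"
    by (rule torus_from_moebius[OF flowU[of 0] flowU[of 4] flowT0 mob04]) (use D t in \<open>auto simp: disp_le_def\<close>)
  show "disp (T3 t) \<eta> \<le> 5 * D"
    by (rule torus_from_moebius[OF flowU[of 3] flowU[of 7] flowT3 mob37]) (use D t in \<open>auto simp: disp_le_def\<close>)
qed

text \<open>Unipotents are exponentially distorted: a torus element of bounded displacement doubles the parameter.\<close>

lemma unipotent_growth:
  assumes D: "disp_le \<eta> D" and i: "i < 8" and t: "\<bar>t\<bar> \<le> 2 ^ k"
  shows "disp (U i t) \<eta> \<le> (10 * k + 1) * D"
proof -
  have ex: "\<exists>S S' c. contraction_map S \<and> c \<ge> 2 \<and> (\<forall>t p. U i (c * t) p = S (U i t (S' p))) \<and> disp S \<eta> \<le> 5 * D \<and> disp S' \<eta> \<le> 5 * D"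
  proof -
    have ln2: "\<bar>ln (2::real)\<bar> \<le> 1" using ln_2_less_1 by simp
    have gen: ?thesis if T: "flow T" and TU: "\<And>a t q. T a (U i t q) = U i (exp (w * a) * t) (T a q)"
      and dT: "\<And>t. \<bar>t\<bar> \<le> 1 \<Longrightarrow> disp (T t) \<eta> \<le> 5 * D" and w: "\<bar>w\<bar> \<ge> 1" for T w
    proof -
      \<comment> \<open>The sign makes conjugation expanding, by the factor \<open>2\<close> to the
        power \<open>\<bar>w\<bar>\<close>, whichever sign the weight has.\<close>
      let ?a = "sgn w * ln 2"
      have "\<bar>?a\<bar> \<le> 1" using ln2 w by (simp add: abs_mult sgn_if)
      moreover have "exp (w * ?a) \<ge> 2"
      proof -
        have "w * ?a = \<bar>w\<bar> * ln 2" by (simp add: abs_if sgn_if)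
        also have "\<dots> \<ge> 1 * ln 2" using w by (intro mult_right_mono) auto
        finally have "exp (w * ?a) \<ge> exp (ln 2)" by (simp only: exp_le_cancel_iff)
        then show ?thesis by simp
      qed
      moreover have "U i (exp (w * ?a) * t) p = T ?a (U i t (T (- ?a) p))" for t p
        using TU[of ?a t "T (- ?a) p"] flow_inverse(2)[OF T, of ?a p] by simp
      ultimately show ?thesis
        by (intro exI[of _ "T ?a"] exI[of _ "T (- ?a)"] exI[of _ "exp (w * ?a)"]) (auto intro: dT flow_contraction[OF T])
    qed
    have "\<bar>weight0 i\<bar> \<ge> 1 \<or> \<bar>weight3 i\<bar> \<ge> 1" using i by (auto simp: less_8_cases weight0_def weight3_def)
    then show ?thesis using gen[OF flowT0 T0U[OF i] torus_growth(1)[OF D]] gen[OF flowT3 T3U[OF i] torus_growth(2)[OF D]] by blast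
  qed
  then obtain S S' c where S: "contraction_map S" "c \<ge> 2" "\<And>t p. U i (c * t) p = S (U i t (S' p))"
    and dS: "disp S \<eta> \<le> 5 * D" "disp S' \<eta> \<le> 5 * D" by metis
  show ?thesis
    using t
  proof (induction k arbitrary: t)
    case 0 then show ?case using D i by (simp add: disp_le_def)
  next
    case (Suc k)
    have "\<bar>t / c\<bar> = \<bar>t\<bar> / c" using S(2) by simp
    also have "\<dots> \<le> 2 ^ Suc k / 2" using Suc.prems S(2) by (intro frac_le) auto
    finally have IH: "disp (U i (t / c)) \<eta> \<le> (10 * k + 1) * D" using Suc.IH[of "t / c"] by simp
    have "U i t \<eta> = S (U i (t / c) (S' \<eta>))" using S(3)[of "t / c" \<eta>] S(2) by simp
    then have "disp (U i t) \<eta> \<le> disp S \<eta> + norm (U i (t / c) (S' \<eta>) - \<eta>)"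
      using disp_comp[OF S(1), of "\<lambda>p. U i (t / c) (S' p)" \<eta>] by simp
    also have "\<dots> \<le> disp S \<eta> + (disp (U i (t / c)) \<eta> + disp S' \<eta>)" by (intro add_mono order_refl disp2 i)
    also have "\<dots> \<le> 5 * D + ((10 * k + 1) * D + 5 * D)" by (intro add_mono dS IH)
    finally show ?case by (simp add: algebra_simps)
  qed
qed

lemma disp_le_nonneg: "disp_le x D \<Longrightarrow> 0 \<le> D"
  unfolding disp_le_def using order_trans[OF norm_ge_zero] by (metis abs_zero zero_le_one zero_less_numeral)

lemma disp_le_mono: "disp_le x D \<Longrightarrow> D \<le> D' \<Longrightarrow> disp_le x D'"
  by (auto simp: disp_le_def intro: order_trans)

text \<open>The factors are the constant of \<open>disp_xi_at_all\<close>, then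
  \<open>31 * l / D\<close>, then a bound for \<open>1 / q\<close> plus \<open>57 * m\<close> times
  the price of a doubling, where \<open>57 * m = 285 * n^2\<close>. In \<open>l\<close>, 750 is 10 *
  75: the parameter bound is \<open>q^15 = 2^(75 * n^2)\<close> and each doubling of a parameter
  costs \<open>10 * D\<close>.\<close>

definition gain :: "real \<Rightarrow> nat \<Rightarrow> real" where
  "gain \<delta> n = 10000 * (31 * (750 * (real n)\<^sup>2 + 6)) * (1 / 2 ^ n + 285 * (real n)\<^sup>2 * ((1 - \<delta>) ^ n + 174 * (1 / 2 ^ n)))"

lemma displacement_estimate:
  assumes D: "disp_le \<eta> D"
    and uc: "clustering TYPE('b) \<delta>" and n: "n \<ge> (1::nat)"
  defines "l \<equiv> (750 * (real n)\<^sup>2 + 6) * D"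
  shows "\<exists>\<xi>. disp_le \<xi> (gain \<delta> n * D) \<and> norm (\<xi> - \<eta>) \<le> 11 * l"
proof -
  \<comment> \<open>Large enough that \<open>J^3 * P^n = 2^(3 * n + 2 * n^2)\<close> is at most
    \<open>q = 2^m\<close>.\<close>
  define m where "m = 5 * n\<^sup>2"
  define q :: real where "q = 2 ^ m"
  define J :: nat where "J = 2 ^ n"
  define P where "P = (real J)\<^sup>2"
  define E where "E = ((1 - \<delta>) ^ n + 174 / J) * (31 * l)"
  have D0: "0 \<le> D" using D by (rule disp_le_nonneg)
  have m5: "m \<ge> 5" "m \<ge> n" using n by (auto simp: m_def power2_eq_square)
  have q32: "q \<ge> 32"
  proof -
    have "(2::real) ^ 5 \<le> 2 ^ m" using m5 by (intro power_increasing) auto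
    then show ?thesis by (simp add: q_def)
  qed
  have q2: "2 * q ^ k \<le> q ^ 15" if "k < 15" for k
  proof -
    have "2 * q ^ k \<le> q * q ^ k" using q32 by simp
    also have "\<dots> \<le> q ^ 15" unfolding power_Suc[symmetric] using that q32 by (intro power_increasing) auto
    finally show ?thesis .
  qed
  interpret root_flows_final U T0 T3 \<eta> l "q ^ 15" "31 * l" "q ^ 4" "q ^ 14" \<delta> n J P E q m
  proof unfold_locales
    show "disp (U i t) \<eta> \<le> l" if "i < 8" "\<bar>t\<bar> \<le> q ^ 15" for i t
    proof -
      have "q ^ 15 = 2 ^ (75 * n\<^sup>2)" by (simp add: q_def m_def flip: power_mult)
      then have "disp (U i t) \<eta> \<le> (10 * (75 * n\<^sup>2) + 1) * D"
        using unipotent_growth[OF D that(1), of t "75 * n\<^sup>2"] that(2) by simp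
      also have "\<dots> \<le> l" unfolding l_def using D0 by (intro mult_right_mono) auto
      finally show ?thesis .
    qed
    have "5 * D \<le> l" unfolding l_def using D0 by (intro mult_right_mono) auto
    then show "disp (T0 t) \<eta> \<le> l" "disp (T3 t) \<eta> \<le> l" if "\<bar>t\<bar> \<le> 1" for t
      using torus_growth[OF D that] by linarith+
    show "1 \<le> q ^ 15" "1 \<le> q ^ 4" "1 \<le> q ^ 14" "32 \<le> q" using q32 by auto
    show "2 * q ^ 4 \<le> q ^ 15" "2 * q ^ 14 \<le> q ^ 15" by (intro q2; simp)+
    show "J ^ 3 * P ^ n \<le> q"
    proof -
      have "J ^ 3 * P ^ n = 2 ^ (3 * n + 2 * n\<^sup>2)"
        by (simp add: J_def P_def flip: power_mult power_add) (simp add: power2_eq_square mult_ac)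
      also have "\<dots> \<le> q" unfolding q_def
      proof (rule power_increasing)
        show "3 * n + 2 * n\<^sup>2 \<le> m" using n by (simp add: m_def power2_eq_square)
      qed simp
      finally show ?thesis .
    qed
  qed (use uc n in \<open>simp_all add: J_def P_def E_def q_def\<close>)
  have "31 * l / q \<le> 31 * l / 2 ^ n"
  proof (rule divide_left_mono)
    show "2 ^ n \<le> q" unfolding q_def using m5 by (intro power_increasing) auto
  qed (use L0 q32 in auto)
  then have "10000 * (31 * l / q + 57 * m * E) \<le> 10000 * (31 * l / 2 ^ n + 57 * m * E)" by simp
  also have "\<dots> = gain \<delta> n * D"
  proof -
    define x :: real where "x = 1 / 2 ^ n"
    have e: "y / 2 ^ n = y * x" for y :: real by (simp add: x_def)
    show ?thesis unfolding E_def m_def J_def gain_def l_def of_nat_power of_nat_numeral e by (simp add: algebra_simps)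
  qed
  finally have "disp_le (xi_at 0) (gain \<delta> n * D)"
    unfolding disp_le_def using order_trans[OF disp_xi_at_all] by blast
  then show ?thesis using near_xi_at by blast
qed

text \<open>\<open>gain\<close> is a polynomial of degree 4 in \<open>n\<close> times a geometric
  decay, so one \<open>n\<close> chosen from \<delta> alone serves all \<open>\<eta>\<close> and
  \<open>D\<close>.\<close>

lemma displacement_contraction:
  assumes uc: "uniformly_convex TYPE('b)"
  shows "\<exists>C. \<forall>\<eta> D. disp_le \<eta> D \<longrightarrow> (\<exists>\<xi>. disp_le \<xi> (D / 2) \<and> norm (\<xi> - \<eta>) \<le> C * D)"
proof -
  obtain \<delta> where v: "clustering TYPE('b) \<delta>" using uniformly_convex_clustering[OF uc] by blast
  then have d: "0 < \<delta>" "\<delta> < 1" by (auto simp: clustering_def)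
  \<comment> \<open>Dominates both decay rates, \<open>1 - \<delta>\<close> and
    \<open>1/2\<close>.\<close>
  define a where "a = max (1 - \<delta>) (1/2)"
  have a: "0 < a" "a < 1" using d by (auto simp: a_def)
  \<comment> \<open>The fourth root of \<open>a\<close>: then \<open>n^4 * a^n\<close> is the fourth
    power of the null sequence \<open>n * b^n\<close>.\<close>
  define b where "b = sqrt (sqrt a)"
  have b: "0 \<le> b" "b < 1" "b ^ 4 = a"
  proof -
    have "b ^ 4 = (b\<^sup>2)\<^sup>2" by (simp flip: power_mult)
    also have "\<dots> = a" unfolding b_def using a by simp
    finally show "b ^ 4 = a" .
  qed (use a in \<open>auto simp: b_def\<close>)
  define K :: real where "K = 10000 * 31 * 756 * (1 + 285 * 175)"
  have "(\<lambda>n. K * (real n * b ^ n) ^ 4) \<longlonglongrightarrow> K * 0 ^ 4"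
    by (intro tendsto_intros powser_times_n_limit_0) (use b in auto)
  then have "\<forall>\<^sub>F n in sequentially. K * (real n * b ^ n) ^ 4 < 1/2" by (rule order_tendstoD) auto
  then obtain n where n: "n \<ge> 1" "K * (real n * b ^ n) ^ 4 < 1/2"
    by (metis (mono_tags, lifting) eventually_sequentially nle_le)
  have n1: "real n \<ge> 1" using n by simp
  have an: "0 \<le> a ^ n" "(1 - \<delta>) ^ n \<le> a ^ n" "1 / 2 ^ n \<le> a ^ n"
    using a d power_mono[of "1/2" a n] by (auto simp: a_def power_mono power_one_over)
  have small: "gain \<delta> n \<le> 1/2"
  proof -
    let ?N = "(real n)\<^sup>2" let ?X = "10000 * (31 * (750 * ?N + 6))"
    have N: "1 \<le> ?N" using n1 by simp
    have X: "0 \<le> ?X" "?X \<le> 10000 * (31 * 756 * ?N)" using N by auto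
    have "gain \<delta> n = ?X * (1 * (1 / 2 ^ n) + 285 * ?N * ((1 - \<delta>) ^ n + 174 * (1 / 2 ^ n)))" by (simp add: gain_def)
    also have "\<dots> \<le> ?X * (?N * a ^ n + 285 * ?N * (a ^ n + 174 * a ^ n))"
      using X an N by (intro mult_left_mono add_mono mult_mono) auto
    also have "\<dots> = ?X * (?N * (1 + 285 * 175) * a ^ n)" by (simp add: algebra_simps)
    also have "\<dots> \<le> (10000 * (31 * 756 * ?N)) * (?N * (1 + 285 * 175) * a ^ n)"
      using X an N by (intro mult_right_mono) auto
    also have "\<dots> = K * (?N * ?N * a ^ n)" by (simp add: K_def)
    also have "?N * ?N * a ^ n = (real n * b ^ n) ^ 4"
    proof -
      have "a ^ n = (b ^ n) ^ 4" unfolding b(3)[symmetric] by (simp flip: power_mult add: mult.commute)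
      then show ?thesis by (simp add: power_mult_distrib flip: power_add)
    qed
    finally show ?thesis using n(2) by linarith
  qed
  show ?thesis
  proof (rule exI[of _ "11 * (750 * (real n)\<^sup>2 + 6)"], intro allI impI)
    fix \<eta> D assume D: "disp_le \<eta> D"
    have D0: "0 \<le> D" using D by (rule disp_le_nonneg)
    obtain \<xi> where xi: "disp_le \<xi> (gain \<delta> n * D)" "norm (\<xi> - \<eta>) \<le> 11 * ((750 * (real n)\<^sup>2 + 6) * D)"
      using displacement_estimate[OF D v n(1)] by blast
    have "disp_le \<xi> (1/2 * D)" by (rule disp_le_mono[OF xi(1) mult_right_mono[OF small D0]])
    then have "disp_le \<xi> (D / 2)" by simp
    moreover have "norm (\<xi> - \<eta>) \<le> (11 * (750 * (real n)\<^sup>2 + 6)) * D" using xi(2) by (simp only: mult.assoc)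
    ultimately show "\<exists>\<xi>. disp_le \<xi> (D / 2) \<and> norm (\<xi> - \<eta>) \<le> (11 * (750 * (real n)\<^sup>2 + 6)) * D" by blast
  qed
qed

lemma disp_le_exists: "\<exists>D. disp_le x D"
proof -
  have "\<exists>D. \<forall>t. \<bar>t\<bar> \<le> 1 \<longrightarrow> disp (U i t) x \<le> D" if i: "i < 8" for i
  proof -
    have "continuous_on {-1..1} (\<lambda>t. U i t x - x)" by (intro continuous_intros flow_cont[OF flowU[OF i]])
    then have "bounded ((\<lambda>t. U i t x - x) ` {-1..1})" by (intro compact_imp_bounded compact_continuous_image) auto
    then obtain D where "\<forall>y\<in>(\<lambda>t. U i t x - x) ` {-1..1}. norm y \<le> D" by (auto simp: bounded_iff)
    then show ?thesis by (intro exI[of _ D]) (auto simp: abs_le_iff)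
  qed
  then obtain D where D: "\<And>i t. i < 8 \<Longrightarrow> \<bar>t\<bar> \<le> 1 \<Longrightarrow> disp (U i t) x \<le> D i" by metis
  have "disp_le x (Max (D ` {..<8}))"
    unfolding disp_le_def by (intro allI impI order_trans[OF D] Max_ge) auto
  then show ?thesis ..
qed

theorem common_fixed_point:
  assumes uc: "uniformly_convex TYPE('b)"
  shows "\<exists>x. \<forall>i<8. \<forall>t. U i t x = x"
proof -
  obtain C where C: "\<And>\<eta> D. disp_le \<eta> D \<Longrightarrow> \<exists>\<xi>. disp_le \<xi> (D / 2) \<and> norm (\<xi> - \<eta>) \<le> C * D"
    using displacement_contraction[OF uc] by blast
  obtain D where D: "disp_le 0 D" using disp_le_exists by blast
  have "\<exists>f. \<forall>n. disp_le (f n) (D / 2 ^ n) \<and> norm (f (Suc n) - f n) \<le> C * (D / 2 ^ n)"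
  proof (rule dependent_nat_choice)
    show "\<exists>x. disp_le x (D / 2 ^ 0)" using D by auto
    show "\<exists>y. disp_le y (D / 2 ^ Suc n) \<and> norm (y - x) \<le> C * (D / 2 ^ n)" if "disp_le x (D / 2 ^ n)" for x n
      using C[OF that] by (simp add: mult.commute)
  qed
  then obtain f where f: "\<And>n. disp_le (f n) (D / 2 ^ n)" "\<And>n. norm (f (Suc n) - f n) \<le> C * (D / 2 ^ n)" by blast
  have "summable (\<lambda>n. f (Suc n) - f n)"
  proof (rule summable_comparison_test')
    show "summable (\<lambda>n. C * D * (1/2) ^ n)" by (intro summable_mult summable_geometric) auto
    show "norm (f (Suc n) - f n) \<le> C * D * (1/2) ^ n" for n using f(2)[of n] by (simp add: power_one_over)
  qed
  then have "convergent (\<lambda>n. \<Sum>k<n. f (Suc k) - f k)" by (simp add: summable_iff_convergent)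
  then obtain y where "(\<lambda>n. \<Sum>k<n. f (Suc k) - f k) \<longlonglongrightarrow> y" by (auto simp: convergent_def)
  then have "(\<lambda>n. (f n - f 0) + f 0) \<longlonglongrightarrow> y + f 0" by (intro tendsto_intros) (simp add: sum_lessThan_telescope)
  then have lim: "f \<longlonglongrightarrow> y + f 0" by simp
  have "disp_le (y + f 0) 0"
    unfolding disp_le_def
  proof (intro allI impI)
    fix i :: nat and t :: real assume i: "i < 8" and t: "\<bar>t\<bar> \<le> 1"
    have cont: "isCont (U i t) (y + f 0)"
      using contraction_map_cont[OF contr[OF i], of UNIV] by (simp add: continuous_on_eq_continuous_at)
    have 1: "(\<lambda>n. disp (U i t) (f n)) \<longlonglongrightarrow> disp (U i t) (y + f 0)"
      using cont by (intro tendsto_intros lim isCont_tendsto_compose[of _ "U i t"])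
    have 2: "(\<lambda>n. D * (1/2) ^ n) \<longlonglongrightarrow> D * 0" by (intro tendsto_intros) auto
    have "disp (U i t) (f n) \<le> D * (1/2) ^ n" for n
      using f(1)[of n] i t by (simp add: disp_le_def power_one_over)
    then show "disp (U i t) (y + f 0) \<le> 0" using LIMSEQ_le[OF 1 2] by auto
  qed
  \<comment> \<open>With \<open>D = 0\<close> the growth bound vanishes, so invariance extends from
    parameters up to 1 to all parameters.\<close>
  note growth = unipotent_growth[OF this]
  have "U i t (y + f 0) = y + f 0" if i: "i < 8" for i t
  proof -
    obtain k where "\<bar>t\<bar> < 2 ^ k" using real_arch_pow[of 2 "\<bar>t\<bar>"] by auto
    then show ?thesis using growth[OF i, of t k] by simp
  qed
  then show ?thesis by blast
qed

end

section \<open>Root subgroups of the universal cover\<close>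

text \<open>In the type \<open>4\<close> the numeral 4 denotes 0, so it indexes the first row and column.\<close>

lemma ent_simps [simp]: "ent 1 = 2" "ent 2 = 3" "ent 3 = 4" "ent 4 = 1"
  by (simp_all add: ent_def bit0.Rep_1 bit0.Rep_numeral bit0.Rep_0)

text \<open>Listing the entries in the order of \<open>ent\<close> reduces matrix identities to
  polynomial identities between entries.\<close>

definition M4 :: "real \<Rightarrow> real \<Rightarrow> real \<Rightarrow> real \<Rightarrow> real \<Rightarrow> real \<Rightarrow> real \<Rightarrow> real \<Rightarrow> real \<Rightarrow> real \<Rightarrow> real \<Rightarrow> real
    \<Rightarrow> real \<Rightarrow> real \<Rightarrow> real \<Rightarrow> real \<Rightarrow> real^4^4" where
  "M4 a b c d e f g h i j k l m n p q =
     (\<chi> r s. [[a, b, c, d], [e, f, g, h], [i, j, k, l], [m, n, p, q]] ! (ent r - 1) ! (ent s - 1))"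

lemma M4_nth [simp]:
  shows "M4 a b c d e f g h i j k l m n p q $ 4 $ 4 = a"  "M4 a b c d e f g h i j k l m n p q $ 4 $ 1 = b"  "M4 a b c d e f g h i j k l m n p q $ 4 $ 2 = c"  "M4 a b c d e f g h i j k l m n p q $ 4 $ 3 = d"
    "M4 a b c d e f g h i j k l m n p q $ 1 $ 4 = e"  "M4 a b c d e f g h i j k l m n p q $ 1 $ 1 = f"  "M4 a b c d e f g h i j k l m n p q $ 1 $ 2 = g"  "M4 a b c d e f g h i j k l m n p q $ 1 $ 3 = h"
    "M4 a b c d e f g h i j k l m n p q $ 2 $ 4 = i"  "M4 a b c d e f g h i j k l m n p q $ 2 $ 1 = j"  "M4 a b c d e f g h i j k l m n p q $ 2 $ 2 = k"  "M4 a b c d e f g h i j k l m n p q $ 2 $ 3 = l"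
    "M4 a b c d e f g h i j k l m n p q $ 3 $ 4 = m"  "M4 a b c d e f g h i j k l m n p q $ 3 $ 1 = n"  "M4 a b c d e f g h i j k l m n p q $ 3 $ 2 = p"  "M4 a b c d e f g h i j k l m n p q $ 3 $ 3 = q"
  by (simp_all add: M4_def)

lemma M4_eqI:
  assumes "X $ 4 $ 4 = a"  "X $ 4 $ 1 = b"  "X $ 4 $ 2 = c"  "X $ 4 $ 3 = d"
    "X $ 1 $ 4 = e"  "X $ 1 $ 1 = f"  "X $ 1 $ 2 = g"  "X $ 1 $ 3 = h"
    "X $ 2 $ 4 = i"  "X $ 2 $ 1 = j"  "X $ 2 $ 2 = k"  "X $ 2 $ 3 = l"
    "X $ 3 $ 4 = m"  "X $ 3 $ 1 = n"  "X $ 3 $ 2 = p"  "X $ 3 $ 3 = q"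
  shows "X = M4 a b c d e f g h i j k l m n p q"
  unfolding vec_eq_iff forall_4 by (simp add: assms)

lemma M4_eq: "M4 a b c d e f g h i j k l m n p q = M4 a' b' c' d' e' f' g' h' i' j' k' l' m' n' p' q' \<longleftrightarrow>
   a = a' \<and> b = b' \<and> c = c' \<and> d = d' \<and> e = e' \<and> f = f' \<and> g = g' \<and> h = h' \<and>
   i = i' \<and> j = j' \<and> k = k' \<and> l = l' \<and> m = m' \<and> n = n' \<and> p = p' \<and> q = q'"
  unfolding vec_eq_iff forall_4 M4_nth by (rule iffI; elim conjE; intro conjI; assumption)

lemma M4_mult: "M4 a b c d e f g h i j k l m n p q ** M4 a' b' c' d' e' f' g' h' i' j' k' l' m' n' p' q' =
  M4 (a*a' + b*e' + c*i' + d*m') (a*b' + b*f' + c*j' + d*n') (a*c' + b*g' + c*k' + d*p') (a*d' + b*h' + c*l' + d*q')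
     (e*a' + f*e' + g*i' + h*m') (e*b' + f*f' + g*j' + h*n') (e*c' + f*g' + g*k' + h*p') (e*d' + f*h' + g*l' + h*q')
     (i*a' + j*e' + k*i' + l*m') (i*b' + j*f' + k*j' + l*n') (i*c' + j*g' + k*k' + l*p') (i*d' + j*h' + k*l' + l*q')
     (m*a' + n*e' + p*i' + q*m') (m*b' + n*f' + p*j' + q*n') (m*c' + n*g' + p*k' + q*p') (m*d' + n*h' + p*l' + q*q')"
  by (rule M4_eqI; simp add: matrix_matrix_mult_def sum_4)

lemma M4_transpose: "transpose (M4 a b c d e f g h i j k l m n p q) = M4 a e i m b f j n c g k p d h l q"
  by (rule M4_eqI; simp add: transpose_def)

lemma M4_one: "mat 1 = M4 1 0 0 0 0 1 0 0 0 0 1 0 0 0 0 1"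
  by (rule M4_eqI; simp add: mat_def)

lemma M4_Jmat: "Jmat = M4 0 0 1 0 0 0 0 1 (-1) 0 0 0 0 (-1) 0 0"
  by (rule M4_eqI; simp add: Jmat_def)

lemma M4_X2beta: "t *\<^sub>R X2beta = M4 0 0 0 0 0 0 0 t 0 0 0 0 0 0 0 0"
  by (rule M4_eqI; simp add: X2beta_def)

lemma continuous_on_M4:
  assumes "continuous_on S a" "continuous_on S b" "continuous_on S c" "continuous_on S d"
    "continuous_on S e" "continuous_on S f" "continuous_on S g" "continuous_on S h"
    "continuous_on S i" "continuous_on S j" "continuous_on S k" "continuous_on S l"
    "continuous_on S m" "continuous_on S n" "continuous_on S p" "continuous_on S q"
  shows "continuous_on S (\<lambda>t. M4 (a t) (b t) (c t) (d t) (e t) (f t) (g t) (h t) (i t) (j t) (k t) (l t) (m t) (n t) (p t) (q t))"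
  unfolding M4_def
proof (intro continuous_on_vec_lambda)
  fix r s :: 4
  show "continuous_on S (\<lambda>t. [[a t, b t, c t, d t], [e t, f t, g t, h t], [i t, j t, k t, l t], [m t, n t, p t, q t]] ! (ent r - 1) ! (ent s - 1))"
    using exhaust_4[of r] exhaust_4[of s] assms by (elim disjE) simp_all
qed

text \<open>In 2 x 2 blocks, 0 to 2 have a symmetric upper right block and 4 to 6 a symmetric lower
  left one; 3 and 7 are block diagonal, the second block being the inverse transpose of the
  first.\<close>

definition root_mat :: "nat \<Rightarrow> real \<Rightarrow> real^4^4" where
  "root_mat i t =
    [M4 1 0 t 0  0 1 0 0  0 0 1 0  0 0 0 1, M4 1 0 0 t  0 1 t 0  0 0 1 0  0 0 0 1,
     M4 1 0 0 0  0 1 0 t  0 0 1 0  0 0 0 1, M4 1 0 0 0  t 1 0 0  0 0 1 (-t)  0 0 0 1,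
     M4 1 0 0 0  0 1 0 0  t 0 1 0  0 0 0 1, M4 1 0 0 0  0 1 0 0  0 t 1 0  t 0 0 1,
     M4 1 0 0 0  0 1 0 0  0 0 1 0  0 t 0 1, M4 1 t 0 0  0 1 0 0  0 0 1 0  0 0 (-t) 1] ! i"

definition torus_mat :: "real \<Rightarrow> real \<Rightarrow> real^4^4" where
  "torus_mat a b = M4 (exp a) 0 0 0  0 (exp b) 0 0  0 0 (exp (-a)) 0  0 0 0 (exp (-b))"

definition one_param :: "(real \<Rightarrow> real^4^4) \<Rightarrow> bool" where
  "one_param f \<longleftrightarrow> continuous_on UNIV f \<and> f 0 = mat 1 \<and> (\<forall>s t. f (s + t) = f s ** f t) \<and> (\<forall>t. f t \<in> Sp4)"

lemma one_param_root: assumes "i < 8" shows "one_param (root_mat i)"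
  using assms unfolding less_8_cases one_param_def Sp4_def
  by (auto simp: root_mat_def M4_one M4_mult M4_transpose M4_Jmat M4_eq intro!: continuous_on_M4 continuous_intros)

lemma one_param_torus: "one_param (\<lambda>t. torus_mat (k * t) (l * t))"
  unfolding one_param_def Sp4_def
  by (auto simp: torus_mat_def M4_one M4_mult M4_transpose M4_Jmat M4_eq distrib_left intro!: continuous_on_M4 continuous_intros
      simp flip: exp_add)

text \<open>\<open>X2beta\<close> squares to zero, so the exponential series stops after two
  terms.\<close>

lemma mat_exp_X2beta: "mat_exp (t *\<^sub>R X2beta) = root_mat 2 t"
proof -
  let ?X = "t *\<^sub>R X2beta"
  have p2: "matpow ?X (Suc (Suc k)) = 0" for k
  proof -
    have XX: "?X ** ?X = 0" by (simp add: M4_X2beta M4_mult) (simp add: vec_eq_iff forall_4)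
    have "matpow ?X (Suc (Suc k)) = (?X ** ?X) ** matpow ?X k" by (simp add: matrix_mul_assoc)
    then show ?thesis by (simp add: XX)
  qed
  have "(\<Sum>k. matpow ?X k $ i $ j / fact k) = mat 1 $ i $ j + ?X $ i $ j" for i j
  proof -
    have "(\<Sum>k. matpow ?X k $ i $ j / fact k) = (\<Sum>k\<in>{0,1}. matpow ?X k $ i $ j / fact k)"
    proof (rule suminf_finite)
      fix k :: nat assume "k \<notin> {0, 1}"
      then obtain k' where "k = Suc (Suc k')" by (metis insertCI not0_implies_Suc One_nat_def)
      then show "matpow ?X k $ i $ j / fact k = 0" by (simp only: p2) simp
    qed simp
    then show ?thesis by (simp add: One_nat_def)
  qed
  then have "mat_exp ?X = mat 1 + ?X" by (simp add: mat_exp_def vec_eq_iff)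
  also have "\<dots> = root_mat 2 t"
    unfolding M4_X2beta M4_one root_mat_def by (simp add: vec_eq_iff forall_4)
  finally show ?thesis .
qed

section \<open>Lifting one-parameter subgroups to the universal cover\<close>

locale sp4_cover =
  fixes gmul :: "'g::topological_space \<Rightarrow> 'g \<Rightarrow> 'g" and e :: 'g and iv :: "'g \<Rightarrow> 'g" and p :: "'g \<Rightarrow> real^4^4"
  assumes cover: "universal_cover_Sp4 gmul e iv p"
begin

lemma group: "gmul (gmul x y) z = gmul x (gmul y z)" "gmul e x = x" "gmul x e = x" "gmul (iv x) x = e" "gmul x (iv x) = e"
  and cont_gmul: "continuous_on UNIV (\<lambda>z. gmul (fst z) (snd z))" and cont_iv: "continuous_on UNIV iv"
  and covering: "covering_space UNIV p Sp4" and p_gmul: "p (gmul x y) = p x ** p y"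
  using cover unfolding universal_cover_Sp4_def topological_group_def by auto

lemma cont_gmul': "continuous_on S a \<Longrightarrow> continuous_on S b \<Longrightarrow> continuous_on S (\<lambda>t. gmul (a t) (b t))"
  using continuous_on_compose2[OF cont_gmul, of S "\<lambda>t. (a t, b t)"] by (simp add: continuous_on_Pair)

lemma cont_iv': "continuous_on S a \<Longrightarrow> continuous_on S (\<lambda>t. iv (a t))"
  by (rule continuous_on_compose2[OF cont_iv]) auto

lemma p_Sp4: "p x \<in> Sp4" using covering by (auto simp: covering_space_def)

text \<open>\<open>p e\<close> is idempotent and preserves \<open>Jmat\<close>; multiplying the form
  identity by \<open>p e\<close> on the right gives \<open>Jmat ** p e = Jmat\<close>, and
  \<open>K\<close> inverts \<open>Jmat\<close>.\<close>

lemma p_e: "p e = mat 1"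
proof -
  have "transpose (p e) ** Jmat ** p e = Jmat" using p_Sp4[of e] by (simp add: Sp4_def)
  moreover have "p e ** p e = p e" using p_gmul[of e e] group by simp
  ultimately have J: "Jmat ** p e = Jmat" by (metis matrix_mul_assoc)
  define K where "K = M4 0 0 (-1) 0  0 0 0 (-1)  1 0 0 0  0 1 0 0"
  have K: "K ** Jmat = mat 1" by (simp add: K_def M4_Jmat M4_one M4_mult)
  have "p e = (K ** Jmat) ** p e" by (simp add: K)
  also have "\<dots> = K ** Jmat" by (simp only: matrix_mul_assoc[symmetric] J)
  finally show ?thesis by (simp add: K)
qed

lemma sheet:
  obtains T V q where "openin (top_of_set Sp4) T" "mat 1 \<in> T" "open V" "e \<in> V" "homeomorphism V T p q"
proof -
  have "mat 1 \<in> Sp4" using p_Sp4[of e] p_e by simp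
  then obtain T v where T: "mat 1 \<in> T" "openin (top_of_set Sp4) T" "\<Union>v = UNIV \<inter> p -` T"
      "\<forall>u\<in>v. openin (top_of_set UNIV) u" "\<forall>u\<in>v. \<exists>q. homeomorphism u T p q"
    using covering unfolding covering_space_def by metis
  have "e \<in> \<Union>v" using T p_e by auto
  then show ?thesis using that T by (metis Union_iff open_openin subtopology_UNIV)
qed

text \<open>The quotient \<open>h\<close> of the two lifts takes values in the kernel of
  \<open>p\<close>. Nearby values of \<open>h\<close> differ by a kernel element in the sheet around
  \<open>e\<close>, where \<open>p\<close> is injective, so \<open>h\<close> is locally constant.
  Every identity in the cover is reduced to matrices in this way.\<close>

lemma lift_unique:
  fixes f g :: "'t::topological_space \<Rightarrow> 'g"
  assumes T: "connected T" and f: "continuous_on T f" and g: "continuous_on T g"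
    and pf: "\<And>t. t \<in> T \<Longrightarrow> p (f t) = p (g t)" and a: "a \<in> T" "f a = g a" and t: "t \<in> T"
  shows "f t = g t"
proof -
  obtain W V q where V: "open V" "e \<in> V" and hom: "homeomorphism V W p q" by (rule sheet)
  have inj: "x = e" if "x \<in> V" "p x = p e" for x
    using hom that V(2) by (metis homeomorphism_apply1)
  define h where "h t = gmul (iv (f t)) (g t)" for t
  have ch: "continuous_on T h" unfolding h_def by (intro cont_gmul' cont_iv' f g)
  have ph: "p (h t) = p e" if "t \<in> T" for t
    using pf[OF that] group(4)[of "f t"] by (metis h_def p_gmul)
  have "h a = h t"
  proof (rule connected_local_const[OF T a(1) t], rule ballI)
    fix b assume b: "b \<in> T"
    have "continuous_on T (\<lambda>t. gmul (iv (h b)) (h t))" by (intro cont_gmul' ch continuous_on_const)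
    then have "((\<lambda>t. gmul (iv (h b)) (h t)) \<longlongrightarrow> gmul (iv (h b)) (h b)) (at b within T)"
      using b by (simp add: continuous_on_def)
    then have "\<forall>\<^sub>F t in at b within T. gmul (iv (h b)) (h t) \<in> V"
      by (rule topological_tendstoD) (use V group in auto)
    moreover have "\<forall>\<^sub>F t in at b within T. t \<in> T" by (simp add: eventually_at_topological) (use open_UNIV in blast)
    ultimately show "\<forall>\<^sub>F t in at b within T. h b = h t"
    proof eventually_elim
      fix t assume "gmul (iv (h b)) (h t) \<in> V" "t \<in> T"
      moreover have "p (gmul (iv (h b)) (h t)) = p e"
        using ph[OF b] ph[OF \<open>t \<in> T\<close>] group(4)[of "h b"] by (metis p_gmul)
      ultimately have "gmul (iv (h b)) (h t) = e" using inj by simp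
      then show "h b = h t" by (metis group(1,2,3,5))
    qed
  qed
  then have "h t = e" using a(2) group by (simp add: h_def)
  then show ?thesis by (metis h_def group(1,2,3,5))
qed

primrec sq_pow :: "nat \<Rightarrow> 'g \<Rightarrow> 'g" where
  "sq_pow 0 x = x"
| "sq_pow (Suc k) x = gmul (sq_pow k x) (sq_pow k x)"

lemma sq_pow_square: "sq_pow (Suc k) x = sq_pow k (gmul x x)"
  by (induction k) auto

lemma cont_sq_pow: "continuous_on S a \<Longrightarrow> continuous_on S (\<lambda>t. sq_pow k (a t))"
  by (induction k) (auto intro: cont_gmul')

text \<open>The lift is the local lift near 0, extended by the repeated squaring \<open>\<phi> t = \<phi> (t / 2 ^ k) ^ (2 ^ k)\<close>.\<close>

lemma one_param_lift:
  assumes f: "one_param f"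
  shows "\<exists>\<phi>. continuous_on UNIV \<phi> \<and> (\<forall>s t. \<phi> (s + t) = gmul (\<phi> s) (\<phi> t)) \<and> (\<forall>t. p (\<phi> t) = f t) \<and> \<phi> 0 = e"
proof -
  have f0: "f 0 = mat 1" and fadd: "\<And>s t. f (s + t) = f s ** f t" and fc: "continuous_on UNIV f" and fS: "\<And>t. f t \<in> Sp4"
    using f by (auto simp: one_param_def)
  obtain W V q where W: "openin (top_of_set Sp4) W" "mat 1 \<in> W" and V: "open V" "e \<in> V" and hom: "homeomorphism V W p q"
    by (rule sheet)
  obtain \<epsilon> where eps: "\<epsilon> > 0" "\<And>t. \<bar>t\<bar> < \<epsilon> \<Longrightarrow> f t \<in> W"
  proof -
    obtain O' where O': "open O'" "W = Sp4 \<inter> O'" using W(1) by (auto simp: openin_open)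
    have "open (f -` O')" using fc O'(1) by (simp add: continuous_on_open_vimage)
    moreover have "0 \<in> f -` O'" using W(2) O'(2) f0 by auto
    ultimately obtain d where d: "d > 0" "\<And>y. dist y 0 < d \<Longrightarrow> y \<in> f -` O'" unfolding open_dist by blast
    have "f t \<in> W" if "\<bar>t\<bar> < d" for t using d(2)[of t] that fS O'(2) by (auto simp: dist_norm)
    then show ?thesis using that d(1) by blast
  qed
  define \<psi> where "\<psi> t = q (f t)" for t
  have c\<psi>: "continuous_on {t. \<bar>t\<bar> < \<epsilon>} \<psi>"
    unfolding \<psi>_def
    by (rule continuous_on_compose2[of W q]) (use hom eps(2) fc in \<open>auto simp: homeomorphism_def intro: continuous_on_subset\<close>)
  have p\<psi>: "p (\<psi> t) = f t" if "\<bar>t\<bar> < \<epsilon>" for t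
    using hom eps(2)[OF that] by (simp add: \<psi>_def homeomorphism_apply2)
  have \<psi>0: "\<psi> 0 = e" using hom V(2) by (simp add: \<psi>_def f0 p_e[symmetric] homeomorphism_apply1)
  let ?I = "{- \<epsilon>/2<..<\<epsilon>/2}"
  \<comment> \<open>On this square the sum stays in the domain of the local lift, and both sides
    lift \<open>f (s + t)\<close> with the same value at the origin.\<close>
  have \<psi>add: "\<psi> (s + t) = gmul (\<psi> s) (\<psi> t)" if st: "s \<in> ?I" "t \<in> ?I" for s t
  proof -
    have "(\<lambda>z. \<psi> (fst z + snd z)) (s, t) = (\<lambda>z. gmul (\<psi> (fst z)) (\<psi> (snd z))) (s, t)"
    proof (rule lift_unique[where T="?I \<times> ?I" and a="(0, 0)"])
      show "connected (?I \<times> ?I)" by (intro connected_Times) auto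
      show "continuous_on (?I \<times> ?I) (\<lambda>z. \<psi> (fst z + snd z))"
        by (rule continuous_on_compose2[OF c\<psi>]) (auto intro!: continuous_intros)
      show "continuous_on (?I \<times> ?I) (\<lambda>z. gmul (\<psi> (fst z)) (\<psi> (snd z)))"
        by (intro cont_gmul' continuous_on_compose2[OF c\<psi>]) (auto intro!: continuous_intros)
      show "p (\<psi> (fst z + snd z)) = p (gmul (\<psi> (fst z)) (\<psi> (snd z)))" if "z \<in> ?I \<times> ?I" for z
        using that by (auto simp: p_gmul p\<psi> fadd)
    qed (use st eps \<psi>0 group in auto)
    then show ?thesis by simp
  qed
  define \<phi>k where "\<phi>k k t = sq_pow k (\<psi> (t / 2 ^ k))" for k and t :: real
  have step: "\<phi>k (Suc k) t = \<phi>k k t" if "\<bar>t\<bar> < 2 ^ k * (\<epsilon>/2)" for k t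
  proof -
    let ?x = "t / 2 ^ Suc k"
    have b: "\<bar>t\<bar> / 2 ^ k < \<epsilon>/2" using that by (simp add: pos_divide_less_eq mult.commute)
    have "\<bar>?x\<bar> \<le> \<bar>t\<bar> / 2 ^ k" by (simp add: abs_mult divide_right_mono field_simps)
    then have "?x \<in> ?I" using b by (auto simp: abs_le_iff abs_less_iff)
    then have "gmul (\<psi> ?x) (\<psi> ?x) = \<psi> (?x + ?x)" by (simp only: \<psi>add)
    also have "?x + ?x = t / 2 ^ k" by simp
    finally show ?thesis unfolding \<phi>k_def sq_pow_square by simp
  qed
  have stable: "\<phi>k j t = \<phi>k k t" if "\<bar>t\<bar> < 2 ^ k * (\<epsilon>/2)" "k \<le> j" for j k t
    using that(2)
  proof (induction j rule: dec_induct)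
    case (step j)
    have "2 ^ k * (\<epsilon>/2) \<le> 2 ^ j * (\<epsilon>/2)" using step eps by (intro mult_right_mono power_increasing) auto
    then show ?case using \<open>\<And>k t. \<bar>t\<bar> < 2 ^ k * (\<epsilon>/2) \<Longrightarrow> \<phi>k (Suc k) t = \<phi>k k t\<close>[of t j] step that(1) by simp
  qed simp
  have ex: "\<exists>k. \<bar>t\<bar> < 2 ^ k * (\<epsilon>/2)" for t
    using real_arch_pow[of 2 "\<bar>t\<bar> / (\<epsilon>/2)"] eps by (auto simp: field_simps)
  \<comment> \<open>By \<open>stable\<close> every admissible \<open>k\<close> gives the same value;
    \<open>LEAST\<close> merely picks one.\<close>
  define \<phi> where "\<phi> t = \<phi>k (LEAST k. \<bar>t\<bar> < 2 ^ k * (\<epsilon>/2)) t" for t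
  have \<phi>: "\<phi> t = \<phi>k k t" if "\<bar>t\<bar> < 2 ^ k * (\<epsilon>/2)" for k t
    unfolding \<phi>_def by (rule stable[symmetric]) (rule LeastI2_ex[OF ex], use that Least_le in auto)
  have p\<phi>k: "p (sq_pow k x) = f (2 ^ k * s)" if "p x = f s" for k x s
    using that
  proof (induction k)
    case (Suc k)
    have eq: "2 ^ Suc k * s = 2 ^ k * s + 2 ^ k * s" by simp
    show ?case unfolding eq fadd using Suc by (simp add: p_gmul)
  qed simp
  have small: "\<bar>t / 2 ^ k\<bar> < \<epsilon>" if "\<bar>t\<bar> < 2 ^ k * (\<epsilon>/2)" for k t
  proof -
    have "\<bar>t\<bar> / 2 ^ k < \<epsilon>/2" using that by (subst pos_divide_less_eq) (simp_all add: mult.commute)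
    moreover have "\<bar>t / 2 ^ k\<bar> = \<bar>t\<bar> / 2 ^ k" by simp
    ultimately show ?thesis using eps(1) by linarith
  qed
  have p\<phi>: "p (\<phi> t) = f t" for t
  proof -
    obtain k where k: "\<bar>t\<bar> < 2 ^ k * (\<epsilon>/2)" using ex by blast
    have "p (\<psi> (t / 2 ^ k)) = f (t / 2 ^ k)" by (intro p\<psi> small k)
    from p\<phi>k[OF this, of k] show ?thesis unfolding \<phi>[OF k] \<phi>k_def by simp
  qed
  have c\<phi>: "continuous_on UNIV \<phi>"
  proof -
    let ?U = "\<lambda>k::nat. {t. \<bar>t\<bar> < 2 ^ k * (\<epsilon>/2)}"
    have "continuous_on (\<Union>k. ?U k) \<phi>"
    proof (rule continuous_on_open_UN)
      show "open (?U k)" for k by (intro open_Collect_less continuous_intros)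
      show "continuous_on (?U k) \<phi>" for k
      proof (rule continuous_on_eq[where f="\<phi>k k"])
        show "continuous_on (?U k) (\<phi>k k)" unfolding \<phi>k_def
        proof (intro cont_sq_pow continuous_on_compose2[OF c\<psi>])
          show "(\<lambda>t. t / 2 ^ k) ` ?U k \<subseteq> {t. \<bar>t\<bar> < \<epsilon>}" using small by auto
        qed (intro continuous_intros, simp)
      qed (simp add: \<phi>)
    qed
    moreover have "(\<Union>k. ?U k) = UNIV" using ex by auto
    ultimately show ?thesis by simp
  qed
  have \<phi>0: "\<phi> 0 = e" using \<phi>[of 0 0] eps by (simp add: \<phi>k_def \<psi>0)
  have "\<phi> (s + t) = gmul (\<phi> s) (\<phi> t)" for s t
  proof -
    have "(\<lambda>z. \<phi> (fst z + snd z)) (s, t) = (\<lambda>z. gmul (\<phi> (fst z)) (\<phi> (snd z))) (s, t)"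
      by (rule lift_unique[where T=UNIV and a="(0, 0)"])
        (auto simp: connected_UNIV p_gmul p\<phi> fadd \<phi>0 group intro!: cont_gmul' continuous_on_compose2[OF c\<phi>] continuous_intros)
    then show ?thesis by simp
  qed
  then show ?thesis using c\<phi> p\<phi> \<phi>0 by blast
qed

end

text \<open>The set is star-shaped about the origin. Connectedness is what uniqueness of lifts needs
  in order to transfer the Gauss decomposition to the cover.\<close>

lemma connected_moebius_domain: "connected {z :: real \<times> real. 0 < 1 + fst z * snd z}"
proof (rule starlike_imp_connected, unfold starlike_def, intro bexI[of _ "(0, 0)"] ballI subsetI)
  fix z y :: "real \<times> real"
  assume z: "z \<in> {z. 0 < 1 + fst z * snd z}" and "y \<in> closed_segment (0, 0) z"
  then obtain r where r: "0 \<le> r" "r \<le> 1" and y: "y = r *\<^sub>R z" by (auto simp: in_segment simp flip: zero_prod_def)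
  have "0 < 1 + (r * r) * (fst z * snd z)"
  proof (cases "fst z * snd z \<ge> 0")
    case True
    then have "0 \<le> (r * r) * (fst z * snd z)" using r by simp
    then show ?thesis by linarith
  next
    case False
    have "r * r \<le> 1" using r by (simp add: mult_le_one)
    then have "(r * r) * (fst z * snd z) \<ge> 1 * (fst z * snd z)" using False by (intro mult_right_mono_neg) auto
    then show ?thesis using z by simp
  qed
  then show "y \<in> {z. 0 < 1 + fst z * snd z}" by (simp add: y mult_ac)
qed simp

section \<open>Relations between root subgroups in the cover\<close>

locale sp4_cover_roots = sp4_cover gmul e iv p
  for gmul :: "'g::topological_space \<Rightarrow> 'g \<Rightarrow> 'g" and e :: 'g and iv :: "'g \<Rightarrow> 'g" and p :: "'g \<Rightarrow> real^4^4" +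
  fixes u :: "nat \<Rightarrow> real \<Rightarrow> 'g" and h0 h3 :: "real \<Rightarrow> 'g"
  assumes u: "i < 8 \<Longrightarrow> continuous_on UNIV (u i)" "i < 8 \<Longrightarrow> u i (s + t) = gmul (u i s) (u i t)"
      "i < 8 \<Longrightarrow> p (u i t) = root_mat i t" "i < 8 \<Longrightarrow> u i 0 = e"
    and h0: "continuous_on UNIV h0" "h0 (s + t) = gmul (h0 s) (h0 t)" "p (h0 t) = torus_mat t 0" "h0 0 = e"
    and h3: "continuous_on UNIV h3" "h3 (s + t) = gmul (h3 s) (h3 t)" "p (h3 t) = torus_mat (- t) t" "h3 0 = e"
begin

lemma cont_roots:
  "i < 8 \<Longrightarrow> continuous_on S f \<Longrightarrow> continuous_on S (\<lambda>z. u i (f z))"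
  "continuous_on S f \<Longrightarrow> continuous_on S (\<lambda>z. h0 (f z))"
  "continuous_on S f \<Longrightarrow> continuous_on S (\<lambda>z. h3 (f z))"
  using continuous_on_compose2[OF u(1), of i S f] continuous_on_compose2[OF h0(1), of S f]
    continuous_on_compose2[OF h3(1), of S f] by auto

text \<open>A relation in two real parameters lifts from matrices to the cover: both sides lift the
  same map on a connected plane and agree at the origin.\<close>

lemma relationI:
  assumes "continuous_on UNIV (\<lambda>z :: real \<times> real. F (fst z) (snd z))" "continuous_on UNIV (\<lambda>z. G (fst z) (snd z))"
    and "\<And>s t. p (F s t) = p (G s t)" and "F 0 0 = G 0 0"
  shows "F s t = G s t"
  using lift_unique[where T=UNIV and a="(0, 0)" and t="(s, t)", OF connected_UNIV assms(1,2)] assms(3,4) by simp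

lemma moebius_relationI:
  assumes "continuous_on {z :: real \<times> real. 0 < 1 + fst z * snd z} (\<lambda>z. F (fst z) (snd z))"
    and "continuous_on {z :: real \<times> real. 0 < 1 + fst z * snd z} (\<lambda>z. G (fst z) (snd z))"
    and "\<And>s t. 0 < 1 + s * t \<Longrightarrow> p (F s t) = p (G s t)" and "F 0 0 = G 0 0" and "0 < 1 + s * t"
  shows "F s t = G s t"
  using lift_unique[where a="(0, 0)" and t="(s, t)", OF connected_moebius_domain assms(1,2)] assms(3-5) by simp

lemmas p_simps = p_gmul u(3) h0(3) h3(3) root_mat_def torus_mat_def M4_mult M4_eq exp_minus

lemma torus_commute: "gmul (h0 s) (h3 t) = gmul (h3 t) (h0 s)"
  by (rule relationI) (auto simp: p_simps group h0 h3 intro!: cont_gmul' cont_roots continuous_intros)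

lemma torus_root:
  assumes "i < 8"
  shows "gmul (h0 s) (u i t) = gmul (u i (exp (weight0 i * s) * t)) (h0 s)"
    and "gmul (h3 s) (u i t) = gmul (u i (exp (weight3 i * s) * t)) (h3 s)"
proof -
  have exp2: "exp (s * 2) = exp s * exp s" for s :: real by (simp only: mult_2_right exp_add)
  have p0: "p (gmul (h0 s) (u i t)) = p (gmul (u i (exp (weight0 i * s) * t)) (h0 s))" for s t
    using assms unfolding less_8_cases
    by (auto simp: p_simps weight0_def exp2 field_simps)
  have p3: "p (gmul (h3 s) (u i t)) = p (gmul (u i (exp (weight3 i * s) * t)) (h3 s))" for s t
    using assms unfolding less_8_cases
    by (auto simp: p_simps weight3_def exp2 field_simps)
  show "gmul (h0 s) (u i t) = gmul (u i (exp (weight0 i * s) * t)) (h0 s)"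
    by (rule relationI[OF _ _ p0]) (use assms in \<open>auto simp: group h0 u intro!: cont_gmul' cont_roots continuous_intros\<close>)
  show "gmul (h3 s) (u i t) = gmul (u i (exp (weight3 i * s) * t)) (h3 s)"
    by (rule relationI[OF _ _ p3]) (use assms in \<open>auto simp: group h3 u intro!: cont_gmul' cont_roots continuous_intros\<close>)
qed

lemma roots_commute:
  assumes "(i, j) \<in> commuting_roots"
  shows "gmul (u i s) (u j t) = gmul (u j t) (u i s)"
proof (rule relationI[where F="\<lambda>s t. gmul (u i s) (u j t)" and G="\<lambda>s t. gmul (u j t) (u i s)"])
  have ij: "i < 8" "j < 8" using assms by (auto simp: commuting_roots_def)
  then show "continuous_on UNIV (\<lambda>z. gmul (u i (fst z)) (u j (snd z)))"
      "continuous_on UNIV (\<lambda>z. gmul (u j (snd z)) (u i (fst z)))" "gmul (u i 0) (u j 0) = gmul (u j 0) (u i 0)"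
    by (auto simp: u intro!: cont_gmul' cont_roots continuous_intros)
  show "p (gmul (u i s) (u j t)) = p (gmul (u j t) (u i s))" for s t
    using assms unfolding commuting_roots_def by (auto simp: p_simps)
qed

lemma moebius:
  assumes "0 < 1 + s * c"
  shows "gmul (u 0 s) (u 4 c) = gmul (u 4 (c / (1 + s * c))) (gmul (h0 (ln (1 + s * c))) (u 0 (s / (1 + s * c))))"
    and "gmul (u 3 s) (u 7 c) = gmul (u 7 (c / (1 + s * c))) (gmul (h3 (ln (1 + s * c))) (u 3 (s / (1 + s * c))))"
proof -
  let ?S = "{z :: real \<times> real. 0 < 1 + fst z * snd z}"
  have ne: "1 + fst z * snd z \<noteq> 0" if "z \<in> ?S" for z using that by auto
  have c: "continuous_on ?S (\<lambda>z. snd z / (1 + fst z * snd z))" "continuous_on ?S (\<lambda>z. fst z / (1 + fst z * snd z))"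
    "continuous_on ?S (\<lambda>z. ln (1 + fst z * snd z))"
    by (intro continuous_intros ballI ne; simp)+
  have p04: "p (gmul (u 0 s) (u 4 c)) = p (gmul (u 4 (c / (1 + s * c))) (gmul (h0 (ln (1 + s * c))) (u 0 (s / (1 + s * c)))))"
    and p37: "p (gmul (u 3 s) (u 7 c)) = p (gmul (u 7 (c / (1 + s * c))) (gmul (h3 (ln (1 + s * c))) (u 3 (s / (1 + s * c)))))"
    if "0 < 1 + s * c" for s c
  proof -
    define w where "w = 1 + s * c"
    have w: "w \<noteq> 0" "exp (ln w) = w" "1 + s * c = w" "s * c + 1 = w" and cs: "c * s = w - 1"
      using that by (auto simp: w_def)
    have sum: "c * s / w + inverse w = 1" "inverse w + c * s / w = 1"
      unfolding cs using w(1) by (simp_all add: divide_simps)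
    show "p (gmul (u 0 s) (u 4 c)) = p (gmul (u 4 (c / (1 + s * c))) (gmul (h0 (ln (1 + s * c))) (u 0 (s / (1 + s * c)))))"
      "p (gmul (u 3 s) (u 7 c)) = p (gmul (u 7 (c / (1 + s * c))) (gmul (h3 (ln (1 + s * c))) (u 3 (s / (1 + s * c)))))"
      unfolding w_def[symmetric] by (simp_all add: p_simps w sum)
  qed
  show "gmul (u 0 s) (u 4 c) = gmul (u 4 (c / (1 + s * c))) (gmul (h0 (ln (1 + s * c))) (u 0 (s / (1 + s * c))))"
    by (rule moebius_relationI[OF _ _ p04 _ assms]) (simp_all add: group u h0 cont_gmul' cont_roots c continuous_on_fst continuous_on_snd continuous_on_id)
  show "gmul (u 3 s) (u 7 c) = gmul (u 7 (c / (1 + s * c))) (gmul (h3 (ln (1 + s * c))) (u 3 (s / (1 + s * c))))"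
    by (rule moebius_relationI[OF _ _ p37 _ assms]) (simp_all add: group u h3 cont_gmul' cont_roots c continuous_on_fst continuous_on_snd continuous_on_id)
qed

lemma root_relations:
  "gmul (u 7 t) (u 2 c) = gmul (u 2 c) (gmul (u 1 (t * c)) (gmul (u 0 (t\<^sup>2 * c)) (u 7 t)))"
  "gmul (u 7 t) (u 1 c) = gmul (u 1 c) (gmul (u 0 (2 * t * c)) (u 7 t))"
  "gmul (u 0 t) (u 3 c) = gmul (u 3 c) (gmul (u 0 t) (gmul (u 1 (- (t * c))) (u 2 (t * c\<^sup>2))))"
  "gmul (u 0 t) (u 5 c) = gmul (u 5 c) (gmul (u 6 (- (t * c\<^sup>2))) (gmul (u 7 (t * c)) (u 0 t)))"
  "gmul (u 3 t) (u 6 c) = gmul (u 6 c) (gmul (u 5 (- (t * c))) (gmul (u 4 (t\<^sup>2 * c)) (u 3 t)))"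
  "gmul (u 3 t) (u 5 c) = gmul (u 5 c) (gmul (u 4 (- (2 * t * c))) (u 3 t))"
  "gmul (u 7 t) (u 5 c) = gmul (u 5 c) (gmul (u 6 (- (2 * t * c))) (u 7 t))"
  "gmul (u 7 t) (u 4 c) = gmul (u 4 c) (gmul (u 5 (- (t * c))) (gmul (u 6 (t\<^sup>2 * c)) (u 7 t)))"
  by (rule relationI;
      auto simp: p_simps algebra_simps power2_eq_square group u intro!: cont_gmul' cont_roots continuous_intros)+

end

lemma (in sp4_cover) sp4_cover_roots_exist: "\<exists>u h0 h3. sp4_cover_roots gmul e iv p u h0 h3"
proof -
  obtain u where u: "\<forall>i. i < 8 \<longrightarrow> continuous_on UNIV (u i) \<and> (\<forall>s t. u i (s + t) = gmul (u i s) (u i t)) \<and>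
      (\<forall>t. p (u i t) = root_mat i t) \<and> u i 0 = e"
    using one_param_lift[OF one_param_root] by metis
  obtain h0 where h0: "continuous_on UNIV h0 \<and> (\<forall>s t. h0 (s + t) = gmul (h0 s) (h0 t)) \<and>
      (\<forall>t. p (h0 t) = torus_mat t 0) \<and> h0 0 = e"
    using one_param_lift[OF one_param_torus[of 1 0]] by auto
  obtain h3 where h3: "continuous_on UNIV h3 \<and> (\<forall>s t. h3 (s + t) = gmul (h3 s) (h3 t)) \<and>
      (\<forall>t. p (h3 t) = torus_mat (- t) t) \<and> h3 0 = e"
    using one_param_lift[OF one_param_torus[of "-1" 1]] by auto
  have "sp4_cover_roots gmul e iv p u h0 h3"
    by unfold_locales (use u h0 h3 in auto)
  then show ?thesis by blast
qed

section \<open>The fixed point for an arbitrary action\<close>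

lemma flow_act:
  fixes act :: "'g::topological_space \<Rightarrow> 'b::banach \<Rightarrow> 'b"
  assumes act: "continuous_isometric_action gmul e act" and uc: "uniformly_convex TYPE('b)"
    and v: "continuous_on UNIV v" "\<And>s t. v (s + t) = gmul (v s) (v t)" "v 0 = e"
  shows "flow (\<lambda>t. act (v t))"
proof -
  have d: "dist (act g x) (act g y) = dist x y" for g x y
    using act by (simp add: continuous_isometric_action_def)
  have "isometry_map (act g)" for g
    using isometry_affine[OF uc d, of g] d by (auto simp: isometry_map_def dist_norm)
  moreover have "continuous_on UNIV (\<lambda>t. act (v t) q)" for q
    using act continuous_on_compose2[of UNIV "\<lambda>z. act (fst z) (snd z)" UNIV "\<lambda>t. (v t, q)"] v(1)
    by (simp add: continuous_isometric_action_def continuous_on_Pair)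
  ultimately show ?thesis using act v(2,3) by (simp add: flow_def continuous_isometric_action_def)
qed

theorem theorem5p18:
  fixes gmul :: "'g::topological_space \<Rightarrow> 'g \<Rightarrow> 'g" and e :: 'g and iv :: "'g \<Rightarrow> 'g"
    and p :: "'g \<Rightarrow> real^4^4" and \<phi> :: "real \<Rightarrow> 'g"
    and act :: "'g \<Rightarrow> 'b::banach \<Rightarrow> 'b"
  assumes "universal_cover_Sp4 gmul e iv p"
    and "lifted_one_param gmul p X2beta \<phi>"
    and "uniformly_convex TYPE('b)"
    and "continuous_isometric_action gmul e act"
  shows "\<exists>x. \<forall>t. act (\<phi> t) x = x"
proof -
  interpret sp4_cover gmul e iv p by unfold_locales (rule assms(1))
  obtain u h0 h3 where "sp4_cover_roots gmul e iv p u h0 h3" using sp4_cover_roots_exist by blast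
  then interpret sp4_cover_roots gmul e iv p u h0 h3 .
  have act_mult: "act g (act h x) = act (gmul g h) x" for g h x
    using assms(4) by (simp add: continuous_isometric_action_def)
  have act_commute: "act (u i s) (act (u j t) x) = act (u j t) (act (u i s) x)" if "(i, j) \<in> commuting_roots" for i j s t x
    by (simp only: act_mult roots_commute[OF that])
  note flow = flow_act[OF assms(4,3)]
  interpret root_flows "\<lambda>i t. act (u i t)" "\<lambda>t. act (h0 t)" "\<lambda>t. act (h3 t)"
    by (unfold_locales; (erule act_commute)?;
        simp only: act_mult torus_commute torus_root moebius root_relations group(1) flow u h0 h3)
  obtain x where x: "\<And>i t. i < 8 \<Longrightarrow> act (u i t) x = x" using common_fixed_point[OF assms(3)] by blast
  have \<phi>: "continuous_on UNIV \<phi>" "\<phi> (s + t) = gmul (\<phi> s) (\<phi> t)" "p (\<phi> t) = root_mat 2 t" for s t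
    using assms(2) by (auto simp: lifted_one_param_def mat_exp_X2beta)
  \<comment> \<open>\<open>\<phi> 0\<close> is idempotent, hence \<open>e\<close>. With the same
    start and the same projection as \<open>u 2\<close>, the lift \<open>\<phi>\<close> is
    \<open>u 2\<close>.\<close>
  have "\<phi> 0 = gmul (iv (\<phi> 0)) (gmul (\<phi> 0) (\<phi> 0))" by (simp add: group flip: group(1))
  then have "\<phi> 0 = e" using \<phi>(2)[of 0 0] group by simp
  then have "\<phi> t = u 2 t" for t
    using lift_unique[of UNIV \<phi> "u 2" 0 t] \<phi> u by (simp add: connected_UNIV)
  then show ?thesis using x[of 2] by auto
qed

end
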